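(* Let $n\ge1$ and $k\ge2$ be integers and let $\varphi(x)=|x|^2$ on $\mathbb{R}^{4n}$. There exists $\varepsilon>0$ depending only on $k,n$ and a constant $C>0$ depending only on $k,n,\varepsilon$ such that the weighted $k$-Bergman kernel $K$ satisfies $$|K(x,y)|\le C\,e^{|x|^2+|y|^2+\frac{\varepsilon}{2}(|x|+|y|)-\varepsilon|x-y|}$$ for any $x,y\in\mathbb{R}^{4n}$ with $|x-y|>3$.
   Context: Primed indices $A',A_1',\dots$ range over $\{0',1'\}$; the unprimed index $A$ ranges over $\{0,\dots,2n-1\}$; $i=\sqrt{-1}$. Vector fields on $\mathbb{R}^{4n}$: for $l=0,\dots,n-1$, $Z_{(2l)0'}=\partial_{x_{4l+1}}+i\partial_{x_{4l+2}}$, $Z_{(2l)1'}=-\partial_{x_{4l+3}}-i\partial_{x_{4l+4}}$, $Z_{(2l+1)0'}=\partial_{x_{4l+3}}-i\partial_{x_{4l+4}}$, $Z_{(2l+1)1'}=\partial_{x_{4l+1}}-i\partial_{x_{4l+2}}$. Put $Z_A^{0'}:=Z_{A1'}$, $Z_A^{1'}:=-Z_{A0'}$. $\mathscr V_0=\odot^k\mathbb{C}^2$ is the space of tuples $(f_{A_1'\ldots A_k'})$ symmetric in all indices, with inner product $\langle f,g\rangle=\sum_{A_1',\ldots,A_k'}f_{A_1'\ldots A_k'}\overline{g_{A_1'\ldots A_k'}}$ (sum over all index values). $L^2_\varphi(\mathbb{R}^{4n},\mathscr V_0)$ is the Hilbert space with inner product $\langle f,g\rangle_\varphi=\int_{\mathbb{R}^{4n}}\langle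 f,g\rangle e^{-2\varphi}dV$, $dV$ Lebesgue measure. The $k$-Cauchy-Fueter operator is $(\mathscr D_0f)_{A_2'\ldots A_k'A}=\sum_{A_1'=0',1'}Z_A^{A_1'}f_{A_1'A_2'\ldots A_k'}$, taken in the sense of distributions. The weighted $k$-Bergman space is the closed subspace $A^2_{(k)}(\mathbb{R}^{4n},\varphi)=\{f\in L^2_\varphi(\mathbb{R}^{4n},\mathscr V_0):\mathscr D_0f=0\}$ (its elements are smooth), and $P:L^2_\varphi(\mathbb{R}^{4n},\mathscr V_0)\to A^2_{(k)}(\mathbb{R}^{4n},\varphi)$ is the orthogonal projection. Identify $\odot^k\mathbb{C}^2\cong\mathbb{C}^{k+1}$ by $f\mapsto(f_0,\ldots,f_k)^t$, where $f_j:=f_{1'\ldots1'0'\ldots0'}$ with exactly $j$ indices equal to $1'$. The weighted $k$-Bergman kernel $K(x,y)$ is the (continuous) $(k+1)\times(k+1)$-matrix valued kernel of $P$ under this identification, i.e. $Pf(x)=\int_{\mathbb{R}^{4n}}K(x,y)f(y)e^{-2\varphi(y)}dV(y)$ for $f\in L^2_\varphi(\mathbb{R}^{4n},\mathscr V_0)$; in particular it reproduces every $f\in A^2_{(k)}(\mathbb{R}^{4n},\varphi)$. $|K(x,y)|$ denotes the Euclidean norm of the matrix. *)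

theory Defs
  imports "HOL-Analysis.Analysis" "HOL-Library.Multiset"
begin

(* Points of R^{4n} with n = CARD('n): the coordinate x_{4l+j} (j = 1, ..., 4) is x $ l $ j.
   The norms on both levels of the nested vector type are l^2 norms, so norm is
   the Euclidean norm of R^{4n}, and lborel is its Lebesgue measure. In the index type 4 the
   numeral 4 denotes the same element as 0, distinct from 1, 2 and 3. *)
type_synonym 'n pt = "real ^ 4 ^ 'n"

(* Primed indices 0', 1' are the two elements 0, 1 of the type 2; the tuple A_1' ... A_k' is a
   list of length k. The unprimed indices 2l and 2l+1 are the pairs (l, 0) and (l, 1). *)
type_synonym tuple = "2 list \<Rightarrow> complex"

subsection \<open>Vector fields\<close>

definition partial :: "'n::finite \<Rightarrow> 4 \<Rightarrow> ('n pt \<Rightarrow> complex) \<Rightarrow> 'n pt \<Rightarrow> complex" where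
  "partial l j u x = frechet_derivative u (at x) (axis l (axis j 1))"

definition Z_low :: "'n::finite \<times> 2 \<Rightarrow> 2 \<Rightarrow> ('n pt \<Rightarrow> complex) \<Rightarrow> 'n pt \<Rightarrow> complex" where
  "Z_low A a u x = (let l = fst A in
     if snd A = 0 then
       (if a = 0 then partial l 1 u x + \<i> * partial l 2 u x
                 else - partial l 3 u x - \<i> * partial l 4 u x)
     else
       (if a = 0 then partial l 3 u x - \<i> * partial l 4 u x
                 else partial l 1 u x - \<i> * partial l 2 u x))"

definition Z_up :: "'n::finite \<times> 2 \<Rightarrow> 2 \<Rightarrow> ('n pt \<Rightarrow> complex) \<Rightarrow> 'n pt \<Rightarrow> complex" where
  "Z_up A a u x = (if a = 0 then Z_low A 1 u x else - Z_low A 0 u x)"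

subsection \<open>Test functions\<close>

fun C_k :: "nat \<Rightarrow> ('a::euclidean_space \<Rightarrow> complex) \<Rightarrow> bool" where
  "C_k 0 u \<longleftrightarrow> continuous_on UNIV u"
| "C_k (Suc m) u \<longleftrightarrow> (\<forall>x. u differentiable (at x)) \<and>
     (\<forall>b\<in>Basis. C_k m (\<lambda>x. frechet_derivative u (at x) b))"

definition test_function :: "('a::euclidean_space \<Rightarrow> complex) \<Rightarrow> bool" where
  "test_function u \<longleftrightarrow> (\<forall>m. C_k m u) \<and> compact (closure {x. u x \<noteq> 0})"

subsection \<open>Symmetric tuples and the weighted \<open>L\<^sup>2\<close> space\<close>

(* Two lists have the same multiset iff they are permutations of each other. Entries at lists
   of length other than k are set to 0, so that this is exactly the space of tuples. *)
definition V0 :: "nat \<Rightarrow> tuple set" where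
  "V0 k = {v. (\<forall>I J. length I = k \<longrightarrow> mset I = mset J \<longrightarrow> v I = v J) \<and>
              (\<forall>I. length I \<noteq> k \<longrightarrow> v I = 0)}"

definition inner_V0 :: "nat \<Rightarrow> tuple \<Rightarrow> tuple \<Rightarrow> complex" where
  "inner_V0 k v w = (\<Sum>I | length I = k. v I * cnj (w I))"

definition L2_phi :: "nat \<Rightarrow> ('n::finite pt \<Rightarrow> real) \<Rightarrow> ('n pt \<Rightarrow> tuple) set" where
  "L2_phi k \<phi> = {f. (\<forall>x. f x \<in> V0 k) \<and>
      (\<forall>I. (\<lambda>x. f x I) \<in> borel_measurable lborel) \<and>
      integrable lborel (\<lambda>x. inner_V0 k (f x) (f x) * exp (- 2 * \<phi> x))}"

definition inner_phi ::
    "nat \<Rightarrow> ('n::finite pt \<Rightarrow> real) \<Rightarrow> ('n pt \<Rightarrow> tuple) \<Rightarrow> ('n pt \<Rightarrow> tuple) \<Rightarrow> complex" where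
  "inner_phi k \<phi> f g = (LINT x|lborel. inner_V0 k (f x) (g x) * exp (- 2 * \<phi> x))"

subsection \<open>The \<open>k\<close>-Cauchy-Fueter operator and the weighted Bergman space\<close>

(* The component (A_2' ... A_k', A) of D_0 f as a distribution, evaluated at the test function
   psi. The Z's have constant coefficients, so the derivative is moved to psi with a minus sign. *)
definition D0 :: "('n::finite pt \<Rightarrow> tuple) \<Rightarrow> 2 list \<Rightarrow> 'n \<times> 2 \<Rightarrow> ('n pt \<Rightarrow> complex) \<Rightarrow> complex"
  where
  "D0 f I A \<psi> = (\<Sum>a\<in>UNIV. - (LINT x|lborel. f x (a # I) * Z_up A a \<psi> x))"

definition bergman_space :: "nat \<Rightarrow> ('n::finite pt \<Rightarrow> real) \<Rightarrow> ('n pt \<Rightarrow> tuple) set" where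
  "bergman_space k \<phi> = {f \<in> L2_phi k \<phi>.
     \<forall>I A \<psi>. length I = k - 1 \<longrightarrow> test_function \<psi> \<longrightarrow> D0 f I A \<psi> = 0}"

(* g represents P f; elements of L^2 are functions here, so g is unique only almost everywhere. *)
definition bergman_projection ::
    "nat \<Rightarrow> ('n::finite pt \<Rightarrow> real) \<Rightarrow> ('n pt \<Rightarrow> tuple) \<Rightarrow> ('n pt \<Rightarrow> tuple) \<Rightarrow> bool" where
  "bergman_projection k \<phi> f g \<longleftrightarrow> g \<in> bergman_space k \<phi> \<and>
     (\<forall>h \<in> bergman_space k \<phi>. inner_phi k \<phi> (\<lambda>x I. f x I - g x I) h = 0)"

subsection \<open>The weighted Bergman kernel\<close>

definition coord :: "nat \<Rightarrow> tuple \<Rightarrow> nat \<Rightarrow> complex" where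
  "coord k v j = v (replicate j 1 @ replicate (k - j) 0)"

(* A (k+1) x (k+1) matrix is a function of two indices, used only at indices <= k. The function g
   is the continuous (hence smooth) representative of P f, so P f (x) makes sense at every x. *)
definition is_bergman_kernel ::
    "nat \<Rightarrow> ('n::finite pt \<Rightarrow> real) \<Rightarrow> ('n pt \<Rightarrow> 'n pt \<Rightarrow> nat \<Rightarrow> nat \<Rightarrow> complex) \<Rightarrow> bool" where
  "is_bergman_kernel k \<phi> K \<longleftrightarrow>
     (\<forall>i\<le>k. \<forall>j\<le>k. continuous_on UNIV (\<lambda>(x, y). K x y i j)) \<and>
     (\<forall>f \<in> L2_phi k \<phi>. \<exists>g. bergman_projection k \<phi> f g \<and>
        (\<forall>I. continuous_on UNIV (\<lambda>x. g x I)) \<and>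
        (\<forall>x. \<forall>i\<le>k.
           integrable lborel
             (\<lambda>y. (\<Sum>j\<le>k. K x y i j * coord k (f y) j) * exp (- 2 * \<phi> y)) \<and>
           coord k (g x) i =
             (LINT y|lborel. (\<Sum>j\<le>k. K x y i j * coord k (f y) j) * exp (- 2 * \<phi> y))))"

definition matrix_norm :: "nat \<Rightarrow> (nat \<Rightarrow> nat \<Rightarrow> complex) \<Rightarrow> real" where
  "matrix_norm k M = sqrt (\<Sum>i\<le>k. \<Sum>j\<le>k. (cmod (M i j))\<^sup>2)"

end

theory Submission
  imports Defs "HOL-Probability.Distributions"
begin

text \<open>
  For the quadratic weight the Bergman kernel can be written down, and its decay can be read off.

  A unit vector \<open>\<theta>\<close> of \<open>\<complex>\<^sup>2\<close> makes \<open>\<real>\<^sup>4\<^sup>n\<close> a complex vector space with the \<open>2n\<close> complex linear coordinates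
  \<open>spinor_coord \<theta> y A\<close>. If \<open>p\<close> is antiholomorphic for this structure, then the tuple
  \<open>p(y) cnj \<theta>\<^sub>I\<close>, where \<open>\<theta>\<^sub>I\<close> is the product of the entries of \<open>\<theta>\<close> along the word \<open>I\<close>
  (\<open>monomial \<theta> I\<close> below), is annihilated by the Cauchy-Fueter operator; the Bergman space is the closed span of
  such tuples as \<open>\<theta>\<close> varies. This suggests to average the Bargmann-Fock kernels of all these complex structures.
  With \<open>t = pairing \<theta> x y\<close>, twice the Hermitian product of \<open>x\<close> and \<open>y\<close> for the structure of \<open>\<theta>\<close>, the kernel is

    \<open>K(x,y)\<^sub>J\<^sub>I = c \<integral> (t + k + 1) e\<^sup>t cnj \<theta>\<^sub>J \<theta>\<^sub>I d\<theta>\<close>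

  over the unit sphere, with a constant \<open>c > 0\<close>. The real part of \<open>t\<close> is \<open>2 x\<bullet>y = |x|\<^sup>2 + |y|\<^sup>2 - |x - y|\<^sup>2\<close>
  for every \<open>\<theta>\<close> and \<open>|t| \<le> 2|x||y|\<close>, so \<open>K\<close> is at most a constant times
  \<open>(1 + |x||y|) exp (|x|\<^sup>2 + |y|\<^sup>2 - |x - y|\<^sup>2)\<close> (\<open>bergman_kernel_entry_bound\<close>). The theorem follows with
  \<open>\<epsilon> = 1\<close>: the polynomial factor is absorbed by \<open>exp ((|x| + |y|)/2)\<close> and \<open>exp (- |x - y|\<^sup>2)\<close> is at most
  \<open>exp (1 - |x - y|)\<close>.

  Two facts identify the kernel. First, the sections of the integral lie in the Bergman space
  (\<open>kernel_section_in_bergman\<close>), by the remark above. Secondly, they reproduce every continuous element \<open>f\<close> of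
  it (\<open>reproducing_formula\<close>). Only the distributional equation is available for \<open>f\<close>, hence all derivatives are
  put on the Gaussian \<open>G(y) = exp (- 2|y|\<^sup>2)\<close>, after a cutoff argument (\<open>bergman_exchange\<close>). The reproducing
  formula then rests on three points.

  The pairing of \<open>t\<^sup>m G\<close> with \<open>f\<close> is, up to sign, an \<open>m\<close>-fold derivative of \<open>f\<close> along an isotropic complex vector
  (\<open>null_deriv_power\<close>). The equation makes these derivatives symmetric in all their primed indices together
  with the indices of \<open>f\<close> (\<open>coefficient_iter_deriv_symmetric\<close>).

  By Schur orthogonality on the sphere (\<open>sphere_moment\<close>), averaging over \<open>\<theta>\<close> projects on tensors
  symmetric in \<open>m + k\<close> indices, up to the factor \<open>1/(m + k + 1)\<close>. On the symmetric tensor at hand it returns the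
  ordinary derivative of \<open>f\<close> in direction \<open>x\<close> (\<open>sphere_coefficient_identity\<close>); the factor \<open>t + k + 1\<close>
  in the kernel compensates the denominators.

  Summing the Taylor series gives the Gaussian average of \<open>f\<close> around \<open>x\<close> (\<open>hermite_expansion_sums\<close>), which is
  a multiple of \<open>f(x)\<close> because the components of \<open>f\<close> are weakly harmonic (\<open>gaussian_mean_value\<close>).
\<close>

section \<open>Gaussian growth and pairing with the weighted space\<close>

lemma integrable_gauss_real:
  assumes "s > 0" shows "integrable lborel (\<lambda>x::real. exp (-(s * x\<^sup>2)))"
proof -
  define \<sigma> where "\<sigma> = 1 / sqrt (2 * s)"
  have \<sigma>: "\<sigma> > 0" "\<sigma>\<^sup>2 = 1 / (2 * s)" using assms by (auto simp: \<sigma>_def power_divide)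
  have "integrable lborel (\<lambda>x. sqrt (2 * pi * \<sigma>\<^sup>2) * normal_density 0 \<sigma> x)"
    by (intro integrable_mult_right integrable_normal_density) (use \<sigma> in auto)
  moreover have "sqrt (2 * pi * \<sigma>\<^sup>2) * normal_density 0 \<sigma> x = exp (-(s * x\<^sup>2))" for x
    using \<sigma> assms by (simp add: normal_density_def real_sqrt_divide real_sqrt_mult)
  ultimately show ?thesis by simp
qed

lemma integrable_gauss:
  assumes "s > 0"
  shows "integrable lborel (\<lambda>x::'a::euclidean_space. exp (-(s * (norm x)\<^sup>2)))"
proof -
  interpret product_sigma_finite "\<lambda>_::'a. lborel :: real measure" ..
  have *: "exp (-(s * (norm (\<Sum>b\<in>Basis. f b *\<^sub>R b :: 'a))\<^sup>2)) = (\<Prod>b\<in>(Basis::'a set). exp (-(s * (f b)\<^sup>2)))" for f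
  proof -
    have "(norm (\<Sum>b\<in>Basis. f b *\<^sub>R b :: 'a))\<^sup>2 = (\<Sum>b\<in>(Basis::'a set). (f b)\<^sup>2)"
      unfolding power2_norm_eq_inner by (subst euclidean_inner) (simp add: power2_eq_square)
    thus ?thesis by (simp add: sum_distrib_left exp_sum flip: sum_negf)
  qed
  show ?thesis
    apply (subst lborel_eq)
    apply (subst integrable_distr_eq)
    apply measurable
    unfolding * by (intro product_integrable_prod integrable_gauss_real assms finite_Basis)
qed

abbreviation (input) sq_norm :: "'a::real_normed_vector \<Rightarrow> real" where
  "sq_norm \<equiv> (\<lambda>x. (norm x)\<^sup>2)"

text \<open>
  The growth condition under which a function can be paired with every element of the weighted
  space. The factor \<open>exp (c |y|)\<close> leaves room for polynomials and for a shift of the centre of a Gaussian.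
\<close>

definition gauss_dominated :: "('a::euclidean_space \<Rightarrow> complex) \<Rightarrow> bool" where
  "gauss_dominated u \<longleftrightarrow> u \<in> borel_measurable borel \<and>
     (\<exists>C c. \<forall>y. cmod (u y) \<le> C * exp (- 2 * (norm y)\<^sup>2 + c * norm y))"

definition weighted_L2 :: "('a::euclidean_space \<Rightarrow> complex) \<Rightarrow> bool" where
  "weighted_L2 g \<longleftrightarrow> g \<in> borel_measurable borel \<and>
     integrable lborel (\<lambda>y. (cmod (g y))\<^sup>2 * exp (- 2 * (norm y)\<^sup>2))"

lemma gauss_dominated_weighted_square:
  assumes "gauss_dominated u"
  shows "integrable lborel (\<lambda>y. (cmod (u y))\<^sup>2 * exp (2 * (norm (y::'a::euclidean_space))\<^sup>2))"
proof -
  from assms obtain C c where [measurable]: "u \<in> borel_measurable borel"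
    and b: "\<And>y. cmod (u y) \<le> C * exp (- 2 * (norm y)\<^sup>2 + c * norm y)"
    unfolding gauss_dominated_def by blast
  show ?thesis
  proof (rule Bochner_Integration.integrable_bound)
    show "integrable lborel (\<lambda>y::'a. (C\<^sup>2 * exp (c\<^sup>2)) * exp (- (1 * (norm y)\<^sup>2)))"
      by (intro integrable_mult_right integrable_gauss) simp
    show "AE y in lborel. norm ((cmod (u y))\<^sup>2 * exp (2 * (norm y)\<^sup>2)) \<le>
        norm (C\<^sup>2 * exp (c\<^sup>2) * exp (- (1 * (norm y)\<^sup>2)))"
    proof (rule AE_I2)
      fix y :: 'a
      have "(cmod (u y))\<^sup>2 \<le> (C * exp (- 2 * (norm y)\<^sup>2 + c * norm y))\<^sup>2"
        by (intro power_mono b) auto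
      also have "\<dots> = C\<^sup>2 * exp (2 * (- 2 * (norm y)\<^sup>2 + c * norm y))"
        by (simp only: power_mult_distrib exp_double)
      finally have "(cmod (u y))\<^sup>2 * exp (2 * (norm y)\<^sup>2) \<le>
          C\<^sup>2 * exp (2 * (- 2 * (norm y)\<^sup>2 + c * norm y)) * exp (2 * (norm y)\<^sup>2)"
        by (intro mult_right_mono) auto
      also have "\<dots> = C\<^sup>2 * exp (2 * (c * norm y) - 2 * (norm y)\<^sup>2)"
        by (simp add: mult.assoc algebra_simps flip: exp_add)
      also have "\<dots> \<le> C\<^sup>2 * exp (c\<^sup>2 - (norm y)\<^sup>2)"
      proof -
        have "0 \<le> (c - norm y)\<^sup>2" by simp
        hence "2 * (c * norm y) - 2 * (norm y)\<^sup>2 \<le> c\<^sup>2 - (norm y)\<^sup>2"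
          by (simp add: power2_diff algebra_simps)
        thus ?thesis by (intro mult_left_mono) auto
      qed
      finally show "norm ((cmod (u y))\<^sup>2 * exp (2 * (norm y)\<^sup>2)) \<le>
          norm (C\<^sup>2 * exp (c\<^sup>2) * exp (- (1 * (norm y)\<^sup>2)))"
        by (simp add: abs_mult mult.assoc exp_diff exp_minus field_simps)
    qed
  qed simp
qed

text \<open>
  The product is dominated by the sum of the squares of \<open>|g| exp (- |y|\<^sup>2)\<close> and \<open>|u| exp (|y|\<^sup>2)\<close>.
\<close>

lemma integrable_weighted_pairing:
  assumes "weighted_L2 g" "gauss_dominated u"
  shows "integrable lborel (\<lambda>y. g y * u (y::'a::euclidean_space))"
proof (rule Bochner_Integration.integrable_bound)
  have [measurable]: "g \<in> borel_measurable borel" "u \<in> borel_measurable borel"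
    using assms by (auto simp: weighted_L2_def gauss_dominated_def)
  show "integrable lborel (\<lambda>y. (cmod (g y))\<^sup>2 * exp (- 2 * (norm y)\<^sup>2) + (cmod (u y))\<^sup>2 * exp (2 * (norm y)\<^sup>2))"
    using assms by (intro Bochner_Integration.integrable_add gauss_dominated_weighted_square) (auto simp:
        weighted_L2_def)
  show "(\<lambda>y. g y * u y) \<in> borel_measurable lborel" by measurable
  show "AE y in lborel. norm (g y * u y) \<le> norm ((cmod (g y))\<^sup>2 * exp (- 2 * (norm y)\<^sup>2) +
      (cmod (u y))\<^sup>2 * exp (2 * (norm y)\<^sup>2))"
  proof (rule AE_I2)
    fix y :: 'a
    define E where "E = exp ((norm y)\<^sup>2)"
    have E: "E > 0" "exp (- 2 * (norm y)\<^sup>2) = 1 / E\<^sup>2" "exp (2 * (norm y)\<^sup>2) = E\<^sup>2"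
      unfolding E_def by (auto simp: exp_minus exp_double field_simps)
    have "0 \<le> (cmod (g y) / E - cmod (u y) * E)\<^sup>2" by simp
    hence "2 * (cmod (g y) * cmod (u y)) \<le> (cmod (g y))\<^sup>2 / E\<^sup>2 + (cmod (u y))\<^sup>2 * E\<^sup>2"
      using E(1) by (simp add: power2_diff power_divide power_mult_distrib)
    moreover have "0 \<le> cmod (g y) * cmod (u y)" by simp
    ultimately have "cmod (g y) * cmod (u y) \<le> (cmod (g y))\<^sup>2 / E\<^sup>2 + (cmod (u y))\<^sup>2 * E\<^sup>2" by linarith
    thus "norm (g y * u y) \<le> norm ((cmod (g y))\<^sup>2 * exp (- 2 * (norm y)\<^sup>2) +
        (cmod (u y))\<^sup>2 * exp (2 * (norm y)\<^sup>2))"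
      unfolding E by (simp add: norm_mult)
  qed
qed

lemma gauss_dominated_shifted_gaussian:
  assumes "s \<ge> 2"
  shows "gauss_dominated (\<lambda>y::'a::euclidean_space. of_real (exp (-(s * (norm (y - x))\<^sup>2))))"
  unfolding gauss_dominated_def
proof (intro conjI exI allI)
  show "(\<lambda>y. complex_of_real (exp (- (s * (norm (y - x))\<^sup>2)))) \<in> borel_measurable borel"
    by measurable
  fix y :: 'a
  have "2 * (norm (y-x))\<^sup>2 \<le> s * (norm (y - x))\<^sup>2" using assms by (intro mult_right_mono) auto
  moreover have "(norm y - norm x)\<^sup>2 \<le> (norm (y-x))\<^sup>2"
    by (metis abs_le_square_iff abs_norm_cancel norm_triangle_ineq3)
  hence "2 * (norm y)\<^sup>2 - 4 * norm x * norm y \<le> 2 * (norm (y-x))\<^sup>2"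
    using zero_le_power2[of "norm x"] unfolding power2_diff mult.assoc by (simp only: mult.commute[of "norm y"])
  ultimately show "cmod (complex_of_real (exp (- (s * (norm (y - x))\<^sup>2)))) \<le>
      1 * exp (- 2 * (norm y)\<^sup>2 + (4 * norm x) * norm y)"
    by simp
qed

lemma gauss_dominated_add:
  assumes "gauss_dominated u" "gauss_dominated v"
  shows "gauss_dominated (\<lambda>y. u y + v y)"
proof -
  from assms obtain C c where [measurable]: "u \<in> borel_measurable borel"
    and b: "\<And>y. cmod (u y) \<le> C * exp (- 2 * (norm y)\<^sup>2 + c * norm y)"
    unfolding gauss_dominated_def by blast
  from assms obtain D d where [measurable]: "v \<in> borel_measurable borel"
    and d: "\<And>y. cmod (v y) \<le> D * exp (- 2 * (norm y)\<^sup>2 + d * norm y)"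
    unfolding gauss_dominated_def by blast
  have "cmod (u y + v y) \<le> (\<bar>C\<bar> + \<bar>D\<bar>) * exp (- 2 * (norm y)\<^sup>2 + max c d * norm y)" for y
  proof -
    have "cmod (u y) \<le> \<bar>C\<bar> * exp (- 2 * (norm y)\<^sup>2 + max c d * norm y)"
      by (rule order.trans[OF b mult_mono]) (auto intro: mult_right_mono)
    moreover have "cmod (v y) \<le> \<bar>D\<bar> * exp (- 2 * (norm y)\<^sup>2 + max c d * norm y)"
      by (rule order.trans[OF d mult_mono]) (auto intro: mult_right_mono)
    ultimately show ?thesis
      by (smt (verit) norm_triangle_ineq distrib_right)
  qed
  thus ?thesis unfolding gauss_dominated_def by (intro conjI) (auto, measurable)
qed

lemma gauss_dominated_mult:
  assumes "gauss_dominated u" "\<And>y. cmod (p y) \<le> B * exp (b * norm y)" "p \<in> borel_measurable borel"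
  shows "gauss_dominated (\<lambda>y. p y * u y)"
proof -
  from assms obtain C c where [measurable]: "u \<in> borel_measurable borel"
    and b: "\<And>y. cmod (u y) \<le> C * exp (- 2 * (norm y)\<^sup>2 + c * norm y)"
    unfolding gauss_dominated_def by blast
  have [measurable]: "p \<in> borel_measurable borel" by fact
  have "cmod (p y * u y) \<le> (B * C) * exp (- 2 * (norm y)\<^sup>2 + (b + c) * norm y)" for y
  proof -
    have "cmod (p y * u y) \<le> (B * exp (b * norm y)) * (C * exp (- 2 * (norm y)\<^sup>2 + c * norm y))"
      unfolding norm_mult by (intro mult_mono assms b) (auto intro: order.trans[OF norm_ge_zero assms(2)])
    also have "\<dots> = (B * C) * exp (- 2 * (norm y)\<^sup>2 + (b + c) * norm y)"
      by (simp add: distrib_right exp_add exp_diff)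
    finally show ?thesis .
  qed
  thus ?thesis unfolding gauss_dominated_def by (intro conjI) (auto, measurable)
qed

lemma gauss_dominated_scale: "gauss_dominated u \<Longrightarrow> gauss_dominated (\<lambda>y. c * u y)"
  by (rule gauss_dominated_mult[where B="cmod c" and b=0]) auto

section \<open>Polynomials times a Gaussian, and the fields \<open>Z\<close> on them\<close>

lemma partial_eqI:
  assumes "(u has_derivative u') (at y)"
  shows "partial l j u y = u' (axis l (axis j 1))"
  using frechet_derivative_at[OF assms] by (simp add: partial_def)

lemma partial_add:
  assumes "u differentiable (at y)" "v differentiable (at y)"
  shows "partial l j (\<lambda>y. u y + v y) y = partial l j u y + partial l j v y"
proof -
  from assms obtain u' v' where "(u has_derivative u') (at y)" "(v has_derivative v') (at y)"
    unfolding differentiable_def by blast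
  note d = this
  show ?thesis using partial_eqI[OF has_derivative_add[OF d]] partial_eqI[OF d(1)] partial_eqI[OF d(2)]
    by simp
qed

lemma partial_mult:
  assumes "u differentiable (at y)" "v differentiable (at y)"
  shows "partial l j (\<lambda>y. u y * v y) y = u y * partial l j v y + partial l j u y * v y"
proof -
  from assms obtain u' v' where "(u has_derivative u') (at y)" "(v has_derivative v') (at y)"
    unfolding differentiable_def by blast
  note d = this
  show ?thesis using partial_eqI[OF has_derivative_mult[OF d]] partial_eqI[OF d(1)] partial_eqI[OF d(2)]
    by simp
qed

lemma partial_const [simp]: "partial l j (\<lambda>y. c) = (\<lambda>y. 0)"
  by (rule ext, subst partial_eqI[OF has_derivative_const]) simp

lemma partial_cmult:
  assumes "u differentiable (at y)"
  shows "partial l j (\<lambda>y. c * u y) y = c * partial l j u y"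
  by (subst partial_mult) (auto simp: assms)

lemma has_derivative_coordinate:
  "((\<lambda>y::'n::finite pt. complex_of_real (y $ l $ j)) has_derivative (\<lambda>h. of_real (h $ l $ j))) (at y)"
  by (intro bounded_linear_imp_has_derivative bounded_linear_compose[OF bounded_linear_of_real]
       bounded_linear_compose[OF bounded_linear_vec_nth bounded_linear_vec_nth])

lemma differentiable_coordinate: "(\<lambda>y::'n::finite pt. complex_of_real (y $ l $ j)) differentiable (at y)"
  using has_derivative_coordinate differentiable_def by blast

lemma partial_coordinate:
  "partial l j (\<lambda>y::'n::finite pt. complex_of_real (y $ l' $ j')) y = (if l = l' \<and> j = j' then 1 else 0)"
  by (subst partial_eqI[OF has_derivative_coordinate]) (auto simp: axis_def)

lemma norm_coordinate_le: "\<bar>y $ l $ j\<bar> \<le> norm (y :: 'n::finite pt)"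
  by (meson component_le_norm_cart Finite_Cartesian_Product.norm_nth_le norm_nth_le order.trans real_norm_def)

abbreviation gaussian :: "real \<Rightarrow> 'n::finite pt \<Rightarrow> 'n pt \<Rightarrow> complex" where
  "gaussian s x \<equiv> (\<lambda>y. of_real (exp (- (s * (norm (y - x))\<^sup>2))))"

lemma has_derivative_gaussian:
  "(gaussian s x has_derivative (\<lambda>h. of_real (- 2 * s * ((y - x) \<bullet> h)) * gaussian s x y)) (at y)"
proof -
  have "((\<lambda>y. exp (- (s * ((y - x) \<bullet> (y - x))))) has_derivative
          (\<lambda>h. - 2 * s * ((y - x) \<bullet> h) * exp (- (s * ((y - x) \<bullet> (y - x)))))) (at y)"
    by (auto intro!: derivative_eq_intros simp: inner_commute)
  from bounded_linear.has_derivative[OF bounded_linear_of_real this]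
  show ?thesis by (simp add: power2_norm_eq_inner)
qed

lemma differentiable_gaussian: "gaussian s x differentiable (at y)"
  using has_derivative_gaussian differentiable_def by blast

lemma partial_gaussian:
  "partial l j (gaussian s x) y = of_real (- 2 * s * (y - x) $ l $ j) * gaussian s x y"
  by (subst partial_eqI[OF has_derivative_gaussian]) (simp add: inner_axis)

text \<open>
  The Gaussian with centre \<open>x\<close> times polynomials. The class contains the Gaussian and is stable under
  all partial derivatives, which is why derivatives of a solution, known only in the sense of distributions, can be
  replaced by derivatives of its members.
\<close>

inductive_set gauss_poly :: "real \<Rightarrow> 'n::finite pt \<Rightarrow> ('n pt \<Rightarrow> complex) set" for s x where
  gaussian: "gaussian s x \<in> gauss_poly s x"
| coordinate: "u \<in> gauss_poly s x \<Longrightarrow> (\<lambda>y. of_real (y $ l $ j) * u y) \<in> gauss_poly s x"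
| add: "u \<in> gauss_poly s x \<Longrightarrow> v \<in> gauss_poly s x \<Longrightarrow> (\<lambda>y. u y + v y) \<in> gauss_poly s x"
| scale: "u \<in> gauss_poly s x \<Longrightarrow> (\<lambda>y. c * u y) \<in> gauss_poly s x"

lemma gauss_poly_differentiable: "u \<in> gauss_poly s x \<Longrightarrow> u differentiable (at y)"
  by (induction rule: gauss_poly.induct)
    (auto intro!: differentiable_mult differentiable_add differentiable_gaussian differentiable_coordinate)

lemma gauss_poly_zero: "(\<lambda>y. 0) \<in> gauss_poly s x"
  using gauss_poly.scale[OF gauss_poly.gaussian, of 0] by simp

lemma gauss_poly_diff: "u \<in> gauss_poly s x \<Longrightarrow> v \<in> gauss_poly s x \<Longrightarrow> (\<lambda>y. u y - v y) \<in> gauss_poly s x"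
  using gauss_poly.add[OF _ gauss_poly.scale[of v s x "-1"]] by simp

lemma gauss_poly_minus: "u \<in> gauss_poly s x \<Longrightarrow> (\<lambda>y. - u y) \<in> gauss_poly s x"
  using gauss_poly.scale[of u s x "-1"] by simp

lemma gauss_poly_sum:
  "(\<And>i. i \<in> I \<Longrightarrow> u i \<in> gauss_poly s x) \<Longrightarrow> (\<lambda>y. \<Sum>i\<in>I. u i y) \<in> gauss_poly s x"
  by (induction I rule: infinite_finite_induct) (auto intro: gauss_poly_zero gauss_poly.add)

lemma partial_gaussian_fun:
  "partial l j (gaussian s x) = (\<lambda>y. - 2 * of_real s * (of_real (y $ l $ j) * gaussian s x y) +
      (2 * of_real s * of_real (x $ l $ j)) * gaussian s x y)"
  by (rule ext, subst partial_gaussian) (simp add: algebra_simps)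

lemma partial_gauss_poly_coordinate:
  assumes "u \<in> gauss_poly s x"
  shows "partial l j (\<lambda>y. of_real (y $ l' $ j') * u y) =
    (\<lambda>y. (if l = l' \<and> j = j' then 1 else 0) * u y + of_real (y $ l' $ j') * partial l j u y)"
  using assms by (intro ext)
    (simp add: partial_mult partial_coordinate gauss_poly_differentiable differentiable_coordinate)

lemma partial_gauss_poly_add:
  assumes "u \<in> gauss_poly s x" "v \<in> gauss_poly s x"
  shows "partial l j (\<lambda>y. u y + v y) = (\<lambda>y. partial l j u y + partial l j v y)"
  using assms by (intro ext) (simp add: partial_add gauss_poly_differentiable)

lemma partial_gauss_poly_scale:
  assumes "u \<in> gauss_poly s x"
  shows "partial l j (\<lambda>y. c * u y) = (\<lambda>y. c * partial l j u y)"
  using assms by (intro ext) (simp add: partial_cmult gauss_poly_differentiable)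

lemma gauss_poly_partial: "u \<in> gauss_poly s x \<Longrightarrow> partial l j u \<in> gauss_poly s x"
proof (induction rule: gauss_poly.induct)
  case gaussian
  show ?case unfolding partial_gaussian_fun
    by (intro gauss_poly.add gauss_poly.scale gauss_poly.coordinate gauss_poly.gaussian)
qed (simp_all only: partial_gauss_poly_coordinate partial_gauss_poly_add partial_gauss_poly_scale
      gauss_poly.add gauss_poly.scale gauss_poly.coordinate)

text \<open>
  By induction on the class: a partial derivative and the multiplication by a coordinate commute up to a scalar.
\<close>

lemma partial_commute:
  "u \<in> gauss_poly s x \<Longrightarrow> partial l j (partial l' j' u) = partial l' j' (partial l j u)"
proof (induction rule: gauss_poly.induct)
  case gaussian
  have *: "partial l j (\<lambda>y. c * (of_real (y $ l' $ j') * gaussian s x y) + d * gaussian s x y) =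
    (\<lambda>y. c * ((if l = l' \<and> j = j' then 1 else 0) * gaussian s x y +
        of_real (y $ l' $ j') * partial l j (gaussian s x) y)
       + d * partial l j (gaussian s x) y)" for c d l j l' j'
    by (simp only: partial_gauss_poly_coordinate[of _ s x] partial_gauss_poly_add[of _ s x]
        partial_gauss_poly_scale[of _ s x]
        gauss_poly.scale gauss_poly.coordinate gauss_poly.gaussian)
  show ?case
    unfolding partial_gaussian_fun *
    by (auto simp: algebra_simps)
next
  case (coordinate u l'' j'')
  thus ?case
    by (simp only: partial_gauss_poly_coordinate[of _ s x] partial_gauss_poly_add[of _ s x]
        partial_gauss_poly_scale[of _ s x]
        gauss_poly.add gauss_poly.scale gauss_poly.coordinate gauss_poly_partial) (simp add: algebra_simps)
next
  case (add u v)
  thus ?case by (simp add: partial_gauss_poly_add[of _ s x] gauss_poly_partial)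
next
  case (scale u c)
  thus ?case by (simp add: partial_gauss_poly_scale[of _ s x] gauss_poly_partial)
qed

lemma norm_le_exp_norm: "cmod (complex_of_real (y $ l $ j)) \<le> 1 * exp (1 * norm (y :: 'n::finite pt))"
  using norm_coordinate_le[of y l j] exp_ge_add_one_self[of "norm y"] by (simp del: exp_ge_add_one_self)

lemma gauss_poly_dominated:
  assumes "s \<ge> 2" shows "u \<in> gauss_poly s x \<Longrightarrow> gauss_dominated u"
proof (induction rule: gauss_poly.induct)
  case gaussian
  show ?case by (rule gauss_dominated_shifted_gaussian[OF assms])
next
  case (coordinate u l j)
  show ?case by (rule gauss_dominated_mult[OF coordinate.IH norm_le_exp_norm])
      (intro borel_measurable_continuous_onI continuous_intros)
qed (auto intro: gauss_dominated_add gauss_dominated_scale)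

lemma Z_low_cases:
  "Z_low (l, 0) 0 u y = partial l 1 u y + \<i> * partial l 2 u y"
  "Z_low (l, 0) 1 u y = - partial l 3 u y - \<i> * partial l 4 u y"
  "Z_low (l, 1) 0 u y = partial l 3 u y - \<i> * partial l 4 u y"
  "Z_low (l, 1) 1 u y = partial l 1 u y - \<i> * partial l 2 u y"
  by (simp_all add: Z_low_def)

lemma UNIV_2_01: "(UNIV :: 2 set) = {0, 1}"
proof -
  have "(2::2) = 0" using exhaust_2[of "0::2"] zero_neq_one by metis
  thus ?thesis using UNIV_2 by (metis insert_commute)
qed

lemma cases_2_01: "(a::2) = 0 \<or> a = 1"
  using UNIV_2_01 by auto

text \<open>
  Every \<open>Z_low A b\<close> combines two partial derivatives with constant coefficients. This form carries facts on
  partial derivatives over to the \<open>Z\<close> without going through the four cases.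
\<close>

lemma Z_low_linear_combination:
  "\<exists>c d l i j. \<forall>u y. Z_low A b u y = c * partial l i u y + d * partial l j u y"
proof (cases "snd A = 0"; cases "b = 0")
    assume h: "snd A = 0" "b = 0"
    show ?thesis by (rule exI[of _ 1], rule exI[of _ "\<i>"], rule exI[of _ "fst A"], rule exI[of _ "1::4"],
        rule exI[of _ "2::4"]) (simp add: h Z_low_def Let_def)
  next
    assume h: "snd A = 0" "b \<noteq> 0"
    show ?thesis by (rule exI[of _ "-1"], rule exI[of _ "-\<i>"], rule exI[of _ "fst A"], rule exI[of _
        "3::4"], rule exI[of _ "4::4"]) (simp add: h Z_low_def Let_def)
  next
    assume h: "snd A \<noteq> 0" "b = 0"
    show ?thesis by (rule exI[of _ 1], rule exI[of _ "-\<i>"], rule exI[of _ "fst A"], rule exI[of _ "3::4"],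
        rule exI[of _ "4::4"]) (simp add: h Z_low_def Let_def)
  next
    assume h: "snd A \<noteq> 0" "b \<noteq> 0"
    show ?thesis by (rule exI[of _ 1], rule exI[of _ "-\<i>"], rule exI[of _ "fst A"], rule exI[of _ "1::4"],
        rule exI[of _ "2::4"]) (simp add: h Z_low_def Let_def)
qed

lemma Z_low_mult:
  assumes "u differentiable (at y)" "v differentiable (at y)"
  shows "Z_low A b (\<lambda>y. u y * v y) y = u y * Z_low A b v y + Z_low A b u y * v y"
  using assms by (simp add: Z_low_def Let_def partial_mult algebra_simps)

lemma Z_low_add:
  assumes "u differentiable (at y)" "v differentiable (at y)"
  shows "Z_low A b (\<lambda>y. u y + v y) y = Z_low A b u y + Z_low A b v y"
  using assms by (simp add: Z_low_def Let_def partial_add algebra_simps)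

lemma Z_low_cmult:
  assumes "u differentiable (at y)"
  shows "Z_low A b (\<lambda>y. c * u y) y = c * Z_low A b u y"
  using assms by (simp add: Z_low_def Let_def partial_cmult algebra_simps)

lemma gauss_poly_Z_low: 
  assumes "u \<in> gauss_poly s x" shows "Z_low A b u \<in> gauss_poly s x"
proof -
  obtain c d l i j where "\<And>u y. Z_low A b u y = c * partial l i u y + d * partial l j u y"
    using Z_low_linear_combination[of A b] by blast
  hence "Z_low A b u = (\<lambda>y. c * partial l i u y + d * partial l j u y)" by blast
  thus ?thesis by (auto intro!: gauss_poly.add gauss_poly.scale gauss_poly_partial assms)
qed

lemma Z_low_gauss_poly_add:
  "u \<in> gauss_poly s x \<Longrightarrow> v \<in> gauss_poly s x \<Longrightarrow>
   Z_low A b (\<lambda>y. u y + v y) = (\<lambda>y. Z_low A b u y + Z_low A b v y)"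
  by (intro ext Z_low_add gauss_poly_differentiable)

lemma Z_low_gauss_poly_scale:
  "u \<in> gauss_poly s x \<Longrightarrow> Z_low A b (\<lambda>y. c * u y) = (\<lambda>y. c * Z_low A b u y)"
  by (intro ext Z_low_cmult gauss_poly_differentiable)

lemma Z_low_commute:
  assumes "u \<in> gauss_poly s x"
  shows "Z_low A b (Z_low A' b' u) = Z_low A' b' (Z_low A b u)"
proof (rule ext)
  fix y
  obtain c d l i j where Z: "\<And>u y. Z_low A b u y = c * partial l i u y + d * partial l j u y"
    using Z_low_linear_combination[of A b] by blast
  obtain c' d' l' i' j' where Z': "\<And>u y. Z_low A' b' u y = c' * partial l' i' u y + d' * partial l' j' u y"
    using Z_low_linear_combination[of A' b'] by blast
  have ZZ: "Z_low A b u = (\<lambda>y. c * partial l i u y + d * partial l j u y)"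
    "Z_low A' b' u = (\<lambda>y. c' * partial l' i' u y + d' * partial l' j' u y)"
    by (simp_all add: Z Z' fun_eq_iff)
  have comb: "partial l'' j'' (\<lambda>y. c * partial l i u y + d * partial l j u y) =
     (\<lambda>y. c * partial l'' j'' (partial l i u) y + d * partial l'' j'' (partial l j u) y)" for c d l i j l'' j''
    by (simp only: partial_gauss_poly_add[of _ s x] partial_gauss_poly_scale[of _ s x]
        gauss_poly.scale gauss_poly_partial assms)
  show "Z_low A b (Z_low A' b' u) y = Z_low A' b' (Z_low A b u) y"
    unfolding Z Z' unfolding ZZ comb using partial_commute[OF assms] by (simp add: algebra_simps)
qed

section \<open>From test functions to Gaussians\<close>

text \<open>
  The flat function \<open>exp (- 1 / t)\<close> with the negative powers of \<open>t\<close> that its derivatives produce.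
\<close>

definition flat :: "nat \<Rightarrow> real \<Rightarrow> real" where
  "flat j t = (if t > 0 then exp (- 1 / t) / t ^ j else 0)"

lemma flat_tendsto_0: "(flat j \<longlongrightarrow> 0) (at 0)"
proof -
  have "((\<lambda>t. inverse t ^ j / exp (inverse t)) \<longlongrightarrow> 0) (at_right (0::real))"
    by (rule filterlim_compose[OF tendsto_power_div_exp_0 filterlim_inverse_at_top_right])
  hence r: "(flat j \<longlongrightarrow> 0) (at_right 0)"
    by (rule Lim_transform_eventually)
      (auto simp: flat_def eventually_at_filter exp_minus field_simps)
  have "((\<lambda>t. 0) \<longlongrightarrow> 0) (at_left (0::real))" by simp
  hence "(flat j \<longlongrightarrow> 0) (at_left 0)"
    by (rule Lim_transform_eventually) (auto simp: flat_def eventually_at_filter)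
  with r show ?thesis by (simp add: filterlim_at_split)
qed

lemma flat_has_real_derivative:
  "(flat j has_real_derivative (flat (j + 2) t - real j * flat (j + 1) t)) (at t)"
proof -
  consider "t < 0" | "t > 0" | "t = 0" by linarith
  thus ?thesis
  proof cases
    case 1
    have "((\<lambda>t. 0) has_real_derivative 0) (at t)" by simp
    hence "(flat j has_real_derivative 0) (at t)"
      by (rule has_field_derivative_transform_within_open[of _ _ _ "{..<0}"]) (use 1 in \<open>auto simp: flat_def\<close>)
    thus ?thesis using 1 by (simp add: flat_def)
  next
    case 2
    have "((\<lambda>t. exp (- 1 / t) / t ^ j) has_real_derivative (flat (j + 2) t - real j * flat (j + 1) t)) (at t)"
      using 2 by (auto intro!: derivative_eq_intros simp: flat_def field_simps power2_eq_square simp flip: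
          power_Suc)
        (cases j; simp add: field_simps)
    thus ?thesis
      by (rule has_field_derivative_transform_within_open[of _ _ _ "{0<..}"]) (use 2 in \<open>auto simp: flat_def\<close>)
  next
    case 3
    have "((\<lambda>h. (flat j (0 + h) - flat j 0) / h) \<longlongrightarrow> 0) (at 0)"
      by (rule Lim_transform_eventually[OF flat_tendsto_0[of "Suc j"]])
        (auto simp: flat_def eventually_at_filter)
    thus ?thesis using 3 by (simp add: DERIV_def flat_def)
  qed
qed

lemma flat_bounds: "0 \<le> flat 0 t" "flat 0 t \<le> 1" "0 \<le> flat 2 t" "flat 2 t \<le> 2"
proof -
  show "flat 2 t \<le> 2"
  proof (cases "t > 0")
    case True
    have "1 + 1 / t + (1 / t)\<^sup>2 / 2 \<le> exp (1 / t)" using True by (intro exp_lower_Taylor_quadratic) simp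
    hence "(1 / t)\<^sup>2 / 2 \<le> exp (1 / t)" using True by (smt (verit) divide_pos_pos)
    thus ?thesis using True by (simp add: flat_def exp_minus field_simps)
  qed (simp add: flat_def)
qed (auto simp: flat_def)

text \<open>
  \<open>cutoff 0 \<delta>\<close> is a smooth bump supported in the ball of radius \<open>1 / \<delta>\<close>. Its value at the origin is \<open>exp (- 1)\<close>;
  there is no plateau, since only the limit \<open>\<delta> \<rightarrow> 0\<close> matters.
\<close>

definition cutoff :: "nat \<Rightarrow> real \<Rightarrow> 'n::finite pt \<Rightarrow> complex" where
  "cutoff j \<delta> y = of_real (flat j (1 - \<delta>\<^sup>2 * (norm y)\<^sup>2))"

lemma has_derivative_cutoff:
  "(cutoff j \<delta> has_derivative (\<lambda>h. (cutoff (j + 2) \<delta> y - of_nat j * cutoff (j +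
      1) \<delta> y) * of_real (- 2 * \<delta>\<^sup>2 * (y \<bullet> h)))) (at y)"
proof -
  have 1: "((\<lambda>y. 1 - \<delta>\<^sup>2 * (y \<bullet> y)) has_derivative (\<lambda>h. - 2 * \<delta>\<^sup>2 * (y \<bullet> h))) (at y)"
    by (auto intro!: derivative_eq_intros simp: inner_commute)
  let ?t = "1 - \<delta>\<^sup>2 * (y \<bullet> y)"
  have 2: "(flat j has_derivative (\<lambda>h. (flat (j + 2) ?t - real j * flat (j + 1) ?t) * h)) (at ?t)"
    using flat_has_real_derivative by (simp add: has_field_derivative_def)
  from bounded_linear.has_derivative[OF bounded_linear_of_real has_derivative_compose[OF 1 2]]
  show ?thesis unfolding cutoff_def by (simp add: power2_norm_eq_inner cutoff_def)
qed

lemma differentiable_cutoff: "cutoff j \<delta> differentiable (at y)"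
  using has_derivative_cutoff differentiable_def by blast

lemma partial_cutoff:
  "partial l i (cutoff j \<delta>) =
    (\<lambda>y. (cutoff (j + 2) \<delta> y + (- of_nat j) * cutoff (j +
        1) \<delta> y) * (of_real (- 2 * \<delta>\<^sup>2) * of_real (y $ l $ i)))"
  by (rule ext, subst partial_eqI[OF has_derivative_cutoff]) (simp add: inner_axis)

lemma C_k_Suc_partial:
  fixes u :: "'n::finite pt \<Rightarrow> complex"
  shows "C_k (Suc m) u \<longleftrightarrow> (\<forall>x. u differentiable (at x)) \<and> (\<forall>l j. C_k m (partial l j u))"
  by (auto simp: Basis_vec_def partial_def[abs_def])

lemma C_k_mono_Suc: "C_k (Suc m) (u :: 'n::finite pt \<Rightarrow> complex) \<Longrightarrow> C_k m u"
proof (induction m arbitrary: u)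
  case 0
  thus ?case by (auto intro!: continuous_at_imp_continuous_on differentiable_imp_continuous_within)
next
  case (Suc m)
  thus ?case by (subst C_k_Suc_partial) (subst (asm) C_k_Suc_partial, blast)
qed

lemma C_k_add:
  fixes u v :: "'n::finite pt \<Rightarrow> complex"
  shows "C_k m u \<Longrightarrow> C_k m v \<Longrightarrow> C_k m (\<lambda>y. u y + v y)"
proof (induction m arbitrary: u v)
  case 0
  thus ?case by (auto intro: continuous_intros)
next
  case (Suc m)
  hence *: "\<And>x. u differentiable (at x)" "\<And>x. v differentiable (at x)"
     "\<And>l j. C_k m (partial l j u)" "\<And>l j. C_k m (partial l j v)"
    unfolding C_k_Suc_partial by auto
  have "partial l j (\<lambda>y. u y + v y) = (\<lambda>y. partial l j u y + partial l j v y)" for l j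
    by (intro ext partial_add *)
  thus ?case unfolding C_k_Suc_partial using * Suc.IH by (auto intro: differentiable_add)
qed

lemma C_k_mult:
  fixes u v :: "'n::finite pt \<Rightarrow> complex"
  shows "C_k m u \<Longrightarrow> C_k m v \<Longrightarrow> C_k m (\<lambda>y. u y * v y)"
proof (induction m arbitrary: u v)
  case 0
  thus ?case by (auto intro: continuous_intros)
next
  case (Suc m)
  hence *: "\<And>x. u differentiable (at x)" "\<And>x. v differentiable (at x)"
     "\<And>l j. C_k m (partial l j u)" "\<And>l j. C_k m (partial l j v)"
    unfolding C_k_Suc_partial by auto
  have "partial l j (\<lambda>y. u y * v y) = (\<lambda>y. u y * partial l j v y + partial l j u y * v y)" for l j
    by (intro ext partial_mult *)
  thus ?case unfolding C_k_Suc_partial using * Suc.IH Suc.prems[THEN C_k_mono_Suc]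
    by (auto intro!: C_k_add differentiable_mult)
qed

lemma C_k_const: "C_k m (\<lambda>y::'n::finite pt. c)"
  by (induction m arbitrary: c) (auto simp: C_k_Suc_partial simp del: C_k.simps(2))

lemma C_k_coordinate: "C_k m (\<lambda>y::'n::finite pt. of_real (y $ l $ j))"
proof (cases m)
  case 0
  thus ?thesis by (auto intro!: continuous_intros)
next
  case (Suc m')
  have "partial l' j' (\<lambda>y::'n::finite pt. complex_of_real (y $ l $ j)) = (\<lambda>y. if l' = l \<and> j' =
      j then 1 else 0)" for l' j'
    by (rule ext) (simp add: partial_coordinate)
  thus ?thesis unfolding Suc C_k_Suc_partial using C_k_const differentiable_coordinate by auto
qed

text \<open>
  The induction runs over all \<open>j\<close> at once because differentiation raises \<open>j\<close>.
\<close>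

lemma C_k_cutoff: "C_k m (cutoff j \<delta> :: 'n::finite pt \<Rightarrow> complex)"
proof (induction m arbitrary: j)
  case 0
  show ?case
    by (auto intro!: continuous_at_imp_continuous_on differentiable_imp_continuous_within differentiable_cutoff)
next
  case (Suc m)
  show ?case unfolding C_k_Suc_partial partial_cutoff
    by (intro conjI allI differentiable_cutoff C_k_mult C_k_add C_k_const C_k_coordinate Suc.IH)
qed

lemma C_k_gauss_poly: "u \<in> gauss_poly s x \<Longrightarrow> C_k m u"
proof (induction m arbitrary: u)
  case 0
  thus ?case
    by (auto intro!: continuous_at_imp_continuous_on differentiable_imp_continuous_within
        gauss_poly_differentiable)
qed (auto simp: C_k_Suc_partial simp del: C_k.simps(2) intro: gauss_poly_differentiable gauss_poly_partial)

lemma cutoff_nonzero: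
  assumes "\<delta> > 0" "cutoff j \<delta> y \<noteq> 0" shows "\<delta> * norm y < 1"
proof -
  have "(\<delta> * norm y)\<^sup>2 < 1\<^sup>2"
    using assms(2) unfolding cutoff_def flat_def power_mult_distrib by (auto split: if_splits)
  thus ?thesis by (rule power_less_imp_less_base) simp
qed

lemma test_function_cutoff:
  assumes "u \<in> gauss_poly s x" "\<delta> > 0"
  shows "test_function (\<lambda>y. cutoff 0 \<delta> y * u y)"
  unfolding test_function_def
proof (intro conjI allI)
  show "C_k m (\<lambda>y. cutoff 0 \<delta> y * u y)" for m
    by (intro C_k_mult C_k_cutoff C_k_gauss_poly[OF assms(1)])
  have "{y. cutoff 0 \<delta> y * u y \<noteq> 0} \<subseteq> cball 0 (1 / \<delta>)"
    using cutoff_nonzero[OF assms(2)] assms(2) by (force simp: field_simps)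
  thus "compact (closure {y. cutoff 0 \<delta> y * u y \<noteq> 0})"
    using bounded_cball bounded_subset compact_closure by blast
qed

text \<open>
  On the support \<open>\<delta> |y| < 1\<close>, so one of the two factors \<open>\<delta>\<close> in the derivative survives.
\<close>

lemma norm_partial_cutoff:
  assumes "\<delta> > 0"
  shows "cmod (partial l i (cutoff 0 \<delta>) y) \<le> 4 * \<delta>"
proof (cases "cutoff 2 \<delta> y = 0")
  case True
  thus ?thesis using assms by (simp add: partial_cutoff numeral_2_eq_2)
next
  case False
  have "\<bar>y $ l $ i\<bar> * \<delta> \<le> 1"
  proof -
    have "\<delta> * \<bar>y $ l $ i\<bar> \<le> \<delta> * norm y" using assms norm_coordinate_le by (intro mult_left_mono) auto
    thus ?thesis using cutoff_nonzero[OF assms False] by (simp add: mult.commute)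
  qed
  have pc: "partial l i (cutoff 0 \<delta>) y = cutoff 2 \<delta> y * (of_real (- 2 * \<delta>\<^sup>2) * of_real (y $ l $ i))"
    by (simp add: partial_cutoff numeral_2_eq_2)
  have "cmod (partial l i (cutoff 0 \<delta>) y) = flat 2 (1 - \<delta>\<^sup>2 * (norm y)\<^sup>2) * (2 * \<delta> * (\<bar>y $ l $ i\<bar> * \<delta>))"
    using flat_bounds(3) assms
    by (simp add: pc norm_mult norm_power cutoff_def power2_eq_square abs_mult)
  also have "\<dots> \<le> 2 * (2 * \<delta> * 1)"
    by (intro mult_mono) (use assms flat_bounds \<open>\<bar>y $ l $ i\<bar> * \<delta> \<le> 1\<close> in auto)
  finally show ?thesis by simp
qed

lemma norm_Z_low_le:
  assumes "\<And>l j. cmod (partial l j u y) \<le> B"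
  shows "cmod (Z_low A b u y) \<le> 2 * B"
proof -
  have "cmod (a + \<i> * c) \<le> 2 * B" "cmod (a - \<i> * c) \<le> 2 * B" "cmod (- a - \<i> * c) \<le> 2 * B"
    if "cmod a \<le> B" "cmod c \<le> B" for a c
    using that norm_triangle_ineq[of a "\<i> * c"] norm_triangle_ineq4[of a "\<i> *
        c"] norm_triangle_ineq4[of "-a" "\<i> * c"]
    by (auto simp: norm_mult)
  thus ?thesis unfolding Z_low_def Let_def using assms by auto
qed

lemma L2_phi_component:
  assumes "f \<in> L2_phi k sq_norm"
  shows "weighted_L2 (\<lambda>y. f y I)"
proof (cases "length I = k")
  case False
  hence "(\<lambda>y. f y I) = (\<lambda>y. 0)" using assms by (auto simp: L2_phi_def V0_def)
  thus ?thesis by (simp add: weighted_L2_def)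
next
  case True
  have [measurable]: "(\<lambda>y. f y J) \<in> borel_measurable borel" for J
    using assms by (auto simp: L2_phi_def)
  have i: "integrable lborel (\<lambda>x. inner_V0 k (f x) (f x) * exp (- 2 * (norm x)\<^sup>2))"
    using assms by (auto simp: L2_phi_def)
  show ?thesis unfolding weighted_L2_def
  proof (intro conjI Bochner_Integration.integrable_bound[OF i] AE_I2)
    fix x
    have fin: "finite {I::2 list. length I = k}" using finite_lists_length_eq[of "UNIV::2 set" k] by simp
    have eq: "inner_V0 k (f x) (f x) = of_real (\<Sum>I | length I = k. (cmod (f x I))\<^sup>2)"
      by (simp only: inner_V0_def of_real_sum complex_norm_square)
    have "(cmod (f x I))\<^sup>2 \<le> (\<Sum>I | length I = k. (cmod (f x I))\<^sup>2)"
      by (rule member_le_sum) (use True fin in auto)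
    thus "norm ((cmod (f x I))\<^sup>2 * exp (- 2 * (norm x)\<^sup>2)) \<le>
        norm (inner_V0 k (f x) (f x) * exp (- 2 * (norm x)\<^sup>2))"
      unfolding eq by (simp add: norm_mult sum_nonneg del: of_real_sum)
  qed auto
qed

text \<open>
  The derivative of the cutoff is of order \<open>\<delta>\<close>, hence only the derivative of \<open>u\<close> contributes in the limit.
\<close>

lemma tendsto_cutoff_pairing:
  fixes x :: "'n::finite pt"
  assumes g: "weighted_L2 g" and u: "u \<in> gauss_poly s x" and s: "s \<ge> 2"
  shows "(\<lambda>n. LINT y|lborel. g y * Z_low A b (\<lambda>y. cutoff 0 (1 / real (Suc n)) y * u y) y)
     \<longlonglongrightarrow> (LINT y|lborel. g y * (exp (- 1) * Z_low A b u y))"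
proof (rule integral_dominated_convergence[where w = "\<lambda>y. cmod (g y * Z_low A b u y) + 8 * cmod (g y * u y)"])
  have Z: "Z_low A b (\<lambda>y. cutoff 0 (1 / real (Suc n)) y * u y) y =
      cutoff 0 (1 / real (Suc n)) y * Z_low A b u y + Z_low A b (cutoff 0 (1 / real (Suc n))) y * u y" for n y
    by (intro Z_low_mult differentiable_cutoff gauss_poly_differentiable[OF u])
  have g_meas [measurable]: "g \<in> borel_measurable borel" using g by (simp add: weighted_L2_def)
  have u_meas [measurable]: "u \<in> borel_measurable borel" "Z_low A b u \<in> borel_measurable borel"
    using gauss_poly_dominated[OF s u] gauss_poly_dominated[OF s gauss_poly_Z_low[OF u]]
    by (auto simp: gauss_dominated_def)
  have [measurable]: "cutoff j \<delta> \<in> borel_measurable borel" for j \<delta>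
    using C_k_cutoff[of 0] by (auto intro: borel_measurable_continuous_onI)
  have [measurable]: "Z_low A b (cutoff 0 \<delta>) \<in> borel_measurable borel" for \<delta>
  proof -
    obtain c d l i j where *: "\<And>y. Z_low A b (cutoff 0 \<delta>) y =
        c * partial l i (cutoff 0 \<delta>) y + d * partial l j (cutoff 0 \<delta>) y"
      using Z_low_linear_combination[of A b] by blast
    have "C_k 0 (partial l i (cutoff 0 \<delta>))" for l i
      using C_k_cutoff[of 1] unfolding One_nat_def C_k_Suc_partial by blast
    hence "partial l i (cutoff 0 \<delta>) \<in> borel_measurable borel" for l i
      by (auto intro: borel_measurable_continuous_onI)
    thus ?thesis unfolding * by measurable
  qed
  show "(\<lambda>y. g y * (exp (- 1) * Z_low A b u y)) \<in> borel_measurable lborel" by measurable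
  show "(\<lambda>y. g y * Z_low A b (\<lambda>y. cutoff 0 (1 / real (Suc n)) y * u y) y) \<in> borel_measurable lborel" for n
    unfolding Z by measurable
  show "integrable lborel (\<lambda>y. cmod (g y * Z_low A b u y) + 8 * cmod (g y * u y))"
    by (intro Bochner_Integration.integrable_add integrable_mult_right integrable_norm
        integrable_weighted_pairing g gauss_poly_dominated[OF s u] gauss_poly_dominated[OF s
            gauss_poly_Z_low[OF u]])
  have lim0: "(\<lambda>n. 1 / real (Suc n)) \<longlonglongrightarrow> 0"
    using LIMSEQ_inverse_real_of_nat by (simp add: inverse_eq_divide)
  show "AE y in lborel. (\<lambda>n. g y * Z_low A b (\<lambda>y. cutoff 0 (1 / real (Suc n)) y * u y) y)
     \<longlonglongrightarrow> g y * (exp (- 1) * Z_low A b u y)"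
  proof (rule AE_I2)
    fix y :: "'n pt"
    have "isCont (flat 0) 1" using flat_has_real_derivative DERIV_isCont by blast
    moreover have "(\<lambda>n. 1 - (1 / real (Suc n))\<^sup>2 * (norm y)\<^sup>2) \<longlonglongrightarrow> 1 - 0\<^sup>2 * (norm y)\<^sup>2"
      by (intro tendsto_intros lim0)
    ultimately have "(\<lambda>n. flat 0 (1 - (1 / real (Suc n))\<^sup>2 * (norm y)\<^sup>2)) \<longlonglongrightarrow> flat 0 1"
      by (auto intro: isCont_tendsto_compose)
    hence c: "(\<lambda>n. cutoff 0 (1 / real (Suc n)) y) \<longlonglongrightarrow> exp (- 1)"
    proof -
      have fl: "complex_of_real (flat 0 1) = exp (- 1)"
        using exp_of_real[of "- 1", where 'a=complex] by (simp add: flat_def)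
      show ?thesis unfolding cutoff_def fl[symmetric]
        by (rule tendsto_of_real) fact
    qed
    have norm_cutoff: "cmod (Z_low A b (cutoff 0 (1 / real (Suc n))) y) \<le> 2 * (4 * (1 / real (Suc n)))" for n
      by (rule norm_Z_low_le, rule norm_partial_cutoff) simp
    have "(\<lambda>n. 2 * (4 * (1 / real (Suc n)))) \<longlonglongrightarrow> 2 * (4 * 0)"
      by (intro tendsto_intros lim0)
    hence z: "(\<lambda>n. Z_low A b (cutoff 0 (1 / real (Suc n))) y) \<longlonglongrightarrow> 0"
      by (intro Lim_null_comparison[OF always_eventually[OF allI[OF norm_cutoff]]]) simp
    have "(\<lambda>n. g y * (cutoff 0 (1 / real (Suc n)) y * Z_low A b u y +
        Z_low A b (cutoff 0 (1 / real (Suc n))) y * u y))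
      \<longlonglongrightarrow> g y * (exp (- 1) * Z_low A b u y + 0 * u y)"
      by (intro tendsto_intros c z)
    thus "(\<lambda>n. g y * Z_low A b (\<lambda>y. cutoff 0 (1 / real (Suc n)) y * u y) y)
     \<longlonglongrightarrow> g y * (exp (- 1) * Z_low A b u y)" unfolding Z by simp
  qed
  show "AE y in lborel. norm (g y * Z_low A b (\<lambda>y. cutoff 0 (1 / real (Suc n)) y * u y) y)
     \<le> cmod (g y * Z_low A b u y) + 8 * cmod (g y * u y)" for n
  proof (rule AE_I2)
    fix y :: "'n pt"
    have "cmod (cutoff 0 (1 / real (Suc n)) y) \<le> 1"
      using flat_bounds by (simp add: cutoff_def)
    moreover have "cmod (Z_low A b (cutoff 0 (1 / real (Suc n))) y) \<le> 8"
    proof -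
      have "cmod (Z_low A b (cutoff 0 (1 / real (Suc n))) y) \<le> 2 * (4 * (1 / real (Suc n)))"
        by (rule norm_Z_low_le, rule norm_partial_cutoff) simp
      also have "\<dots> \<le> 8" by (simp add: field_simps)
      finally show ?thesis .
    qed
    ultimately have "cmod (cutoff 0 (1 / real (Suc n)) y * Z_low A b u y +
        Z_low A b (cutoff 0 (1 / real (Suc n))) y * u y)
      \<le> 1 * cmod (Z_low A b u y) + 8 * cmod (u y)"
      by (intro order.trans[OF norm_triangle_ineq add_mono]) (auto simp: norm_mult intro!: mult_right_mono
          mult_left_le_one_le)
    hence "cmod (g y) * cmod (cutoff 0 (1 / real (Suc n)) y * Z_low A b u y +
        Z_low A b (cutoff 0 (1 / real (Suc n))) y * u y)
      \<le> cmod (g y) * (1 * cmod (Z_low A b u y) + 8 * cmod (u y))"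
      by (intro mult_left_mono) auto
    also have "\<dots> = cmod (g y) * cmod (Z_low A b u y) + 8 * (cmod (g y) * cmod (u y))"
      by (simp add: algebra_simps)
    finally show "norm (g y * Z_low A b (\<lambda>y. cutoff 0 (1 / real (Suc n)) y * u y) y)
     \<le> cmod (g y * Z_low A b u y) + 8 * cmod (g y * u y)"
      by (simp only: Z norm_mult)
  qed
qed

lemma D0_expand:
  "D0 f I A \<psi> = - (LINT y|lborel. f y (0 # I) * Z_low A 1 \<psi> y) + (LINT y|lborel. f y (1 # I) * Z_low A 0 \<psi> y)"
  unfolding D0_def UNIV_2_01 by (simp add: Z_up_def)

text \<open>
  The weak equation \<open>D0 f = 0\<close> for rapidly decaying functions: a primed index of \<open>f\<close> may be exchanged with the
  primed index of a derivative. In everything that follows the equation enters through this exchange.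
\<close>

lemma bergman_exchange:
  assumes f: "f \<in> bergman_space k sq_norm" and I: "length I = k - 1"
    and u: "u \<in> gauss_poly s x" and s: "s \<ge> 2"
  shows "(LINT y|lborel. f y (0 # I) * Z_low A 1 u y) = (LINT y|lborel. f y (1 # I) * Z_low A 0 u y)"
proof -
  have L2: "weighted_L2 (\<lambda>y. f y J)" for J
    using f by (auto simp: bergman_space_def intro: L2_phi_component)
  have "D0 f I A (\<lambda>y. cutoff 0 (1 / real (Suc n)) y * u y) = 0" for n
    using f I test_function_cutoff[OF u, of "1 / real (Suc n)"] unfolding bergman_space_def by fastforce
  hence eq: "(LINT y|lborel. f y (0 # I) * Z_low A 1 (\<lambda>y. cutoff 0 (1 / real (Suc n)) y * u y) y) =
     (LINT y|lborel. f y (1 # I) * Z_low A 0 (\<lambda>y. cutoff 0 (1 / real (Suc n)) y * u y) y)" for n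
    unfolding D0_expand by (simp add: add_eq_0_iff2)
  have "(LINT y|lborel. f y (0 # I) * (exp (- 1) * Z_low A 1 u y)) =
      (LINT y|lborel. f y (1 # I) * (exp (- 1) * Z_low A 0 u y))"
    using tendsto_cutoff_pairing[OF L2 u s, of "0 # I" A 1] tendsto_cutoff_pairing[OF L2 u s, of "1 # I" A 0]
    unfolding eq by (rule LIMSEQ_unique)
  thus ?thesis by (simp add: mult.left_commute)
qed

section \<open>Complex structures, null vectors and words of derivatives\<close>

text \<open>
  These are the functions \<open>Z_low A b\<close> applied to \<open>|y|\<^sup>2 / 2\<close>. As a \<open>2n \<times> 2\<close> matrix they represent the point \<open>y\<close> by
  \<open>n\<close> quaternions, written as \<open>2 \<times> 2\<close> blocks.
\<close>

definition null_coord :: "'n::finite pt \<Rightarrow> 'n \<times> 2 \<Rightarrow> 2 \<Rightarrow> complex" where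
  "null_coord y A b = (let l = fst A in
     if snd A = 0 then (if b = 0 then of_real (y $ l $ 1) + \<i> * of_real (y $ l $ 2)
                        else - of_real (y $ l $ 3) - \<i> * of_real (y $ l $ 4))
     else (if b = 0 then of_real (y $ l $ 3) - \<i> * of_real (y $ l $ 4)
           else of_real (y $ l $ 1) - \<i> * of_real (y $ l $ 2)))"

lemma null_coord_cases [simp]:
  "null_coord y (l, 0) 0 = of_real (y $ l $ 1) + \<i> * of_real (y $ l $ 2)"
  "null_coord y (l, 0) 1 = - of_real (y $ l $ 3) - \<i> * of_real (y $ l $ 4)"
  "null_coord y (l, 1) 0 = of_real (y $ l $ 3) - \<i> * of_real (y $ l $ 4)"
  "null_coord y (l, 1) 1 = of_real (y $ l $ 1) - \<i> * of_real (y $ l $ 2)"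
  by (simp_all add: null_coord_def)

lemma Z_low_gaussian:
  "Z_low A b (gaussian s 0) y = - 2 * of_real s * null_coord y A b * gaussian s 0 y"
  unfolding Z_low_def null_coord_def Let_def partial_gaussian by (simp add: algebra_simps)

lemma sum_UNIV_2: "(\<Sum>a\<in>UNIV. g (a::2)) = g 0 + g 1"
  unfolding UNIV_2_01 by simp

lemma sum_UNIV_unprimed: "(\<Sum>A\<in>UNIV. g (A :: 'n::finite \<times> 2)) = (\<Sum>l\<in>UNIV. g (l, 0) + g (l, 1))"
proof -
  have "sum g (UNIV \<times> UNIV) = (\<Sum>l\<in>UNIV. \<Sum>a\<in>UNIV. g (l, a))" by (simp add: sum.cartesian_product)
  thus ?thesis by (simp add: sum_UNIV_2)
qed

text \<open>
  The matrix of \<open>y\<close> applied to \<open>\<theta>\<close>: for a unit vector \<open>\<theta>\<close> a linear isometry of \<open>\<real>\<^sup>4\<^sup>n\<close> onto \<open>\<complex>\<^sup>2\<^sup>n\<close>, i.e. a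
  choice of a complex structure.
\<close>

definition spinor_coord :: "(2 \<Rightarrow> complex) \<Rightarrow> 'n::finite pt \<Rightarrow> 'n \<times> 2 \<Rightarrow> complex" where
  "spinor_coord \<theta> y A = (\<Sum>b\<in>UNIV. \<theta> b * null_coord y A b)"

text \<open>
  The factor \<open>2\<close> is the one in the exponent of the weight, so that \<open>exp (pairing \<theta> x y)\<close> is, up to a
  constant, the Bargmann-Fock kernel of the complex structure given by \<open>\<theta>\<close>.
\<close>

definition pairing :: "(2 \<Rightarrow> complex) \<Rightarrow> 'n::finite pt \<Rightarrow> 'n pt \<Rightarrow> complex" where
  "pairing \<theta> x y = 2 * (\<Sum>A\<in>UNIV. cnj (spinor_coord \<theta> x A) * spinor_coord \<theta> y A)"

lemma has_derivative_spinor_coord: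
  "((\<lambda>y::'n::finite pt. spinor_coord \<theta> y A) has_derivative (\<lambda>h. spinor_coord \<theta> h A)) (at y)"
proof -
  have 1: "((\<lambda>y::'n pt. null_coord y A b) has_derivative (\<lambda>h. null_coord h A b)) (at y)" for b
    unfolding null_coord_def Let_def
    by (cases "snd A = 0"; cases "b = 0")
      (auto intro!: has_derivative_add has_derivative_diff has_derivative_minus has_derivative_mult_right
          has_derivative_coordinate)
  show ?thesis unfolding spinor_coord_def
    by (intro has_derivative_sum has_derivative_mult_right 1)
qed

lemma has_derivative_pairing: "(pairing \<theta> x has_derivative (pairing \<theta> x)) (at y)"
  unfolding pairing_def
  by (intro has_derivative_sum has_derivative_mult_right has_derivative_spinor_coord)

lemma differentiable_pairing: "pairing \<theta> x differentiable (at y)"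
  using has_derivative_pairing differentiable_def by blast

lemma partial_pairing: "partial l j (pairing \<theta> x) y = pairing \<theta> x (axis l (axis j 1))"
  by (rule partial_eqI[OF has_derivative_pairing])

text \<open>
  The Cauchy-Riemann operators of the complex structure given by \<open>\<theta>\<close>.
\<close>

definition spinor_deriv :: "(2 \<Rightarrow> complex) \<Rightarrow> 'n::finite \<times> 2 \<Rightarrow> ('n pt \<Rightarrow> complex) \<Rightarrow> 'n pt \<Rightarrow> complex" where
  "spinor_deriv \<theta> A u y = (\<Sum>b\<in>UNIV. \<theta> b * Z_low A b u y)"

lemma axis_axis_nth: "axis l (axis j (1::real)) $ l' $ j' = (if l = l' \<and> j = j' then 1 else 0)"
  by (auto simp: axis_def)

text \<open>
  \<open>Z_low A b\<close> applied to \<open>null_coord y B c\<close> is antisymmetric in \<open>b\<close> and \<open>c\<close>, and here it is contracted with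
  \<open>\<theta>\<^sub>b \<theta>\<^sub>c\<close>.
\<close>

lemma spinor_deriv_spinor_coord:
  "spinor_deriv \<theta> A (\<lambda>y. spinor_coord \<theta> y B) y = 0"
proof -
  have "partial l j (\<lambda>y. spinor_coord \<theta> y B) y = spinor_coord \<theta> (axis l (axis j 1)) B" for l j B
    by (rule partial_eqI[OF has_derivative_spinor_coord])
  note p = this
  obtain l a l' a' where AB: "A = (l, a)" "B = (l', a')" by fastforce
  show ?thesis
    unfolding AB using cases_2_01[of a] cases_2_01[of a']
    unfolding spinor_deriv_def sum_UNIV_2
    by (elim disjE; hypsubst; simp only: Z_low_cases p) (auto simp: sum_UNIV_2 spinor_coord_def
        axis_axis_nth algebra_simps)
qed

lemma spinor_deriv_pairing: "spinor_deriv \<theta> A (pairing \<theta> x) y = 0"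
proof -
  obtain c :: "'a \<times> 2 \<Rightarrow> complex" where c: "pairing \<theta> x y = (\<Sum>B\<in>UNIV. c B * spinor_coord \<theta> y B)" for y
    using that[of "\<lambda>B. 2 * cnj (spinor_coord \<theta> x B)"] by (simp add: pairing_def sum_distrib_left mult.assoc)
  have p: "partial l j (pairing \<theta> x) y = (\<Sum>B\<in>UNIV. c B * partial l j (\<lambda>y. spinor_coord \<theta> y B) y)" for l j
    by (simp add: partial_pairing c partial_eqI[OF has_derivative_spinor_coord])
  have Z: "Z_low A b (pairing \<theta> x) y = (\<Sum>B\<in>UNIV. c B * Z_low A b (\<lambda>y. spinor_coord \<theta> y B) y)" for b
    unfolding Z_low_def Let_def p
    by (auto simp: sum_distrib_left sum.distrib sum_subtractf sum_negf algebra_simps)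
  have "spinor_deriv \<theta> A (pairing \<theta> x) y = (\<Sum>B\<in>UNIV. c B * spinor_deriv \<theta> A (\<lambda>y. spinor_coord \<theta> y B) y)"
    unfolding spinor_deriv_def Z sum_distrib_left by (subst sum.swap) (simp add: mult.left_commute)
  thus ?thesis by (simp add: spinor_deriv_spinor_coord)
qed

lemma gauss_poly_pairing_mult:
  assumes "u \<in> gauss_poly s z" shows "(\<lambda>y. pairing \<theta> x y * u y) \<in> gauss_poly s z"
proof -
  have 1: "(\<lambda>y. null_coord y A b * u y) \<in> gauss_poly s z" for A b
    unfolding null_coord_def Let_def
    by (cases "snd A = 0"; cases "b = 0")
      (auto simp: ring_distribs mult.assoc intro!: gauss_poly.add gauss_poly_diff gauss_poly_minus
          gauss_poly.scale gauss_poly.coordinate assms)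
  have "(\<lambda>y. \<Sum>A\<in>UNIV. \<Sum>b\<in>UNIV. (2 * cnj (spinor_coord \<theta> x A) * \<theta> b) * (null_coord y A b *
      u y)) \<in> gauss_poly s z"
    by (intro gauss_poly_sum gauss_poly.scale 1)
  also have "(\<lambda>y. \<Sum>A\<in>UNIV. \<Sum>b\<in>UNIV. (2 * cnj (spinor_coord \<theta> x A) * \<theta> b) * (null_coord y A b * u y)) =
      (\<lambda>y. pairing \<theta> x y * u y)"
    unfolding pairing_def spinor_coord_def sum_distrib_left sum_distrib_right by (simp add: ac_simps)
  finally show ?thesis .
qed

lemma gauss_poly_pairing_power:
  "(\<lambda>y. pairing \<theta> x y ^ m * gaussian s z y) \<in> gauss_poly s z"
proof (induction m)
  case (Suc m)
  from gauss_poly_pairing_mult[OF this] show ?case by (simp add: mult.assoc)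
qed (simp add: gauss_poly.gaussian)

text \<open>
  The derivative along the complex vector whose matrix arises from that of \<open>x\<close> by multiplication with a matrix unit. The real
  direction \<open>x\<close> is the sum of the two diagonal ones (\<open>real_deriv_eq\<close>).
\<close>

definition dir_deriv :: "'n::finite pt \<Rightarrow> 2 \<Rightarrow> 2 \<Rightarrow> ('n pt \<Rightarrow> complex) \<Rightarrow> 'n pt \<Rightarrow> complex" where
  "dir_deriv x a b u y = (\<Sum>A\<in>UNIV. cnj (null_coord x A a) / 2 * Z_low A b u y)"

text \<open>
  The derivative along the complex vector that arises from \<open>x\<close> by the rank one matrix formed from \<open>\<theta>\<close> and \<open>cnj \<theta>\<close>. This
  vector is isotropic.
\<close>

definition null_deriv :: "(2 \<Rightarrow> complex) \<Rightarrow> 'n::finite pt \<Rightarrow> ('n pt \<Rightarrow> complex) \<Rightarrow> 'n pt \<Rightarrow> complex" where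
  "null_deriv \<theta> x u y = (\<Sum>a\<in>UNIV. \<Sum>b\<in>UNIV. cnj (\<theta> a) * \<theta> b * dir_deriv x a b u y)"

lemma null_deriv_spinor:
  "null_deriv \<theta> x u y = (\<Sum>A\<in>UNIV. cnj (spinor_coord \<theta> x A) / 2 * spinor_deriv \<theta> A u y)"
  unfolding null_deriv_def dir_deriv_def spinor_coord_def spinor_deriv_def
  by (simp add: sum_UNIV_2 sum_distrib_left sum.distrib algebra_simps add_divide_distrib)

text \<open>
  A derivative along an isotropic vector \<open>v\<close> annihilates the linear form \<open>v \<bullet> y\<close>. Here \<open>pairing \<theta> x y\<close> is such
  a form, so only the Gaussian is differentiated and each derivative brings down one factor.
\<close>

lemma null_deriv_pairing_power:
  "null_deriv \<theta> x (\<lambda>y. pairing \<theta> x y ^ m * gaussian 2 0 y) = (\<lambda>y. - (pairing \<theta> x y ^ Suc m * gaussian 2 0 y))"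
proof -
  have s: "spinor_deriv \<theta> A (\<lambda>y. pairing \<theta> x y ^ m * gaussian 2 0 y) y = 
     - 4 * spinor_coord \<theta> y A * (pairing \<theta> x y ^ m * gaussian 2 0 y)" for A y
  proof (induction m)
    case 0
    show ?case
      by (simp add: spinor_deriv_def Z_low_gaussian[of _ _ 2, simplified] spinor_coord_def sum_distrib_left
          sum_distrib_right algebra_simps)
  next
    case (Suc m)
    have "Z_low A b (\<lambda>y. pairing \<theta> x y * (pairing \<theta> x y ^ m * gaussian 2 0 y)) y =
      pairing \<theta> x y * Z_low A b (\<lambda>y. pairing \<theta> x y ^ m * gaussian 2 0 y) y
        + Z_low A b (pairing \<theta> x) y * (pairing \<theta> x y ^ m * gaussian 2 0 y)" for b
      by (intro Z_low_mult differentiable_pairing gauss_poly_differentiable[OF gauss_poly_pairing_power])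
    hence "spinor_deriv \<theta> A (\<lambda>y. pairing \<theta> x y * (pairing \<theta> x y ^ m * gaussian 2 0 y)) y =
      pairing \<theta> x y * spinor_deriv \<theta> A (\<lambda>y. pairing \<theta> x y ^ m * gaussian 2 0 y) y
      + spinor_deriv \<theta> A (pairing \<theta> x) y * (pairing \<theta> x y ^ m * gaussian 2 0 y)"
      by (simp add: spinor_deriv_def sum_distrib_left sum_distrib_right sum.distrib algebra_simps)
    thus ?case unfolding Suc.IH spinor_deriv_pairing by (simp add: mult.assoc mult.left_commute)
  qed
  show ?thesis unfolding null_deriv_spinor s
    by (rule ext) (simp add: pairing_def sum_distrib_left sum_distrib_right algebra_simps flip: sum_negf)
qed

lemma null_deriv_power:
  "(null_deriv \<theta> x ^^ m) (gaussian 2 0) = (\<lambda>y. (-1) ^ m * (pairing \<theta> x y ^ m * gaussian 2 0 y))"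
proof (induction m)
  case (Suc m)
  have d: "null_deriv \<theta> x (\<lambda>y. c * u y) = (\<lambda>y. c * null_deriv \<theta> x u y)" if "u \<in> gauss_poly 2 0" for u c
    by (rule ext) (simp add: null_deriv_def dir_deriv_def Z_low_gauss_poly_scale[OF that] sum_distrib_left
        mult_ac)
  show ?case
    unfolding funpow.simps comp_apply Suc.IH d[OF gauss_poly_pairing_power] null_deriv_pairing_power by simp
qed simp

lemma gauss_poly_dir_deriv: "u \<in> gauss_poly s z \<Longrightarrow> dir_deriv x a b u \<in> gauss_poly s z"
  unfolding dir_deriv_def[abs_def] by (intro gauss_poly_sum gauss_poly.scale gauss_poly_Z_low)

lemma Z_low_gauss_poly_sum:
  "(\<And>i. i \<in> I \<Longrightarrow> u i \<in> gauss_poly s z) \<Longrightarrow> Z_low A b (\<lambda>y. \<Sum>i\<in>I. u i y) = (\<lambda>y. \<Sum>i\<in>I. Z_low A b (u i) y)"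
proof (induction I rule: infinite_finite_induct)
  case (insert i I)
  thus ?case by (simp add: Z_low_gauss_poly_add[of _ s z] gauss_poly_sum)
qed (simp_all add: Z_low_def Let_def fun_eq_iff)

lemma dir_deriv_sum_scale:
  assumes "\<And>i. i \<in> I \<Longrightarrow> u i \<in> gauss_poly s z"
  shows "dir_deriv x a b (\<lambda>y. \<Sum>i\<in>I. c i * u i y) = (\<lambda>y. \<Sum>i\<in>I. c i * dir_deriv x a b (u i) y)"
proof (rule ext)
  fix y
  have "Z_low A b (\<lambda>y. \<Sum>i\<in>I. c i * u i y) = (\<lambda>y. \<Sum>i\<in>I. c i * Z_low A b (u i) y)" for A
    using assms by (subst Z_low_gauss_poly_sum[of _ _ s z]) (auto intro: gauss_poly.scale simp:
        Z_low_gauss_poly_scale[of _ s z])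
  thus "dir_deriv x a b (\<lambda>y. \<Sum>i\<in>I. c i * u i y) y = (\<Sum>i\<in>I. c i * dir_deriv x a b (u i) y)"
    unfolding dir_deriv_def sum_distrib_left by (subst sum.swap) (simp add: sum_distrib_left mult.left_commute)
qed

lemma dir_deriv_commute:
  assumes "u \<in> gauss_poly s z"
  shows "dir_deriv x a b (dir_deriv x a' b' u) = dir_deriv x a' b' (dir_deriv x a b u)"
proof (rule ext)
  fix y
  have Z: "Z_low A b (dir_deriv x a' b' u) = (\<lambda>y. \<Sum>B\<in>UNIV. cnj (null_coord x B a') / 2 *
      Z_low A b (Z_low B b' u) y)" for A b a' b'
    unfolding dir_deriv_def[abs_def]
    by (subst Z_low_gauss_poly_sum[of _ _ s z], (intro gauss_poly.scale gauss_poly_Z_low assms)[1])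
      (simp only: Z_low_gauss_poly_scale[OF gauss_poly_Z_low[OF assms]])
  have "dir_deriv x a b (dir_deriv x a' b' u) y = (\<Sum>A\<in>UNIV. \<Sum>B\<in>UNIV. cnj (null_coord x A a) / 2 *
      (cnj (null_coord x B a') / 2 * Z_low A b (Z_low B b' u) y))" for a b a' b'
    by (subst dir_deriv_def) (simp add: Z sum_distrib_left)
  thus "dir_deriv x a b (dir_deriv x a' b' u) y = dir_deriv x a' b' (dir_deriv x a b u) y"
    by (simp only:) (subst sum.swap, intro sum.cong refl, subst Z_low_commute[OF assms], rule mult.left_commute)
qed

text \<open>
  Both words are consumed in parallel; they have equal length wherever this is used.
\<close>

fun iter_deriv :: "'n::finite pt \<Rightarrow> 2 list \<Rightarrow> 2 list \<Rightarrow> ('n pt \<Rightarrow> complex) \<Rightarrow> 'n pt \<Rightarrow> complex" where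
  "iter_deriv x (a # as) (b # bs) u = iter_deriv x as bs (dir_deriv x a b u)"
| "iter_deriv x _ _ u = u"

lemma gauss_poly_iter_deriv: "u \<in> gauss_poly s z \<Longrightarrow> iter_deriv x as bs u \<in> gauss_poly s z"
  by (induction x as bs u rule: iter_deriv.induct) (auto intro: gauss_poly_dir_deriv)

lemma iter_deriv_commute:
  "u \<in> gauss_poly s z \<Longrightarrow> iter_deriv x as bs (dir_deriv x a b u) = dir_deriv x a b (iter_deriv x as bs u)"
proof (induction x as bs u rule: iter_deriv.induct)
  case (1 x a' as b' bs u)
  thus ?case
    using dir_deriv_commute[OF "1.prems", of x a b a' b'] by (simp add: gauss_poly_dir_deriv)
qed auto

lemma iter_deriv_sum_scale:
  "(\<And>i. i \<in> I \<Longrightarrow> u i \<in> gauss_poly s z) \<Longrightarrow> length as = length bs \<Longrightarrow>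
    iter_deriv x as bs (\<lambda>y. \<Sum>i\<in>I. c i * u i y) = (\<lambda>y. \<Sum>i\<in>I. c i * iter_deriv x as bs (u i) y)"
proof (induction as arbitrary: bs u)
  case (Cons a as)
  then obtain b bs' where bs: "bs = b # bs'" by (cases bs) auto
  show ?case unfolding bs using Cons by (simp add: dir_deriv_sum_scale[of _ _ s z] gauss_poly_dir_deriv bs)
qed simp

text \<open>
  The entry at \<open>I\<close> of the tensor power of \<open>\<theta>\<close>.
\<close>

definition monomial :: "(2 \<Rightarrow> complex) \<Rightarrow> 2 list \<Rightarrow> complex" where
  "monomial \<theta> I = prod_list (map \<theta> I)"

lemma monomial_simps [simp]: 
  "monomial \<theta> [] = 1" "monomial \<theta> (a # I) = \<theta> a * monomial \<theta> I"
  "monomial \<theta> (I @ J) = monomial \<theta> I * monomial \<theta> J"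
  by (simp_all add: monomial_def)

abbreviation words :: "nat \<Rightarrow> 2 list set" where "words m \<equiv> {I. length I = m}"

lemma finite_words [simp]: "finite (words m)"
  using finite_lists_length_eq[of "UNIV::2 set" m] by simp

lemma sum_words_Suc: "(\<Sum>I\<in>words (Suc m). g I) = (\<Sum>a\<in>UNIV. \<Sum>I\<in>words m. g (a # I))"
proof -
  have "words (Suc m) = (\<lambda>(a, I). a # I) ` (UNIV \<times> words m)" by (force simp: length_Suc_conv)
  moreover have "inj_on (\<lambda>(a, I). a # I) (UNIV \<times> words m)" by (auto simp: inj_on_def)
  ultimately show ?thesis
    by (simp add: sum.reindex sum.cartesian_product case_prod_unfold)
qed

lemma sum_words_append: "(\<Sum>w\<in>words (m + k). g w) = (\<Sum>I\<in>words m. \<Sum>J\<in>words k. g (I @ J))"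
  by (induction m arbitrary: g) (simp_all add: sum_words_Suc)

text \<open>
  Expanding over words instead of collecting equal factors avoids multinomial coefficients: the words with a given number of
  ones are counted only once, in \<open>card_words_count\<close>.
\<close>

lemma null_deriv_power_expand:
  "u \<in> gauss_poly s z \<Longrightarrow> (null_deriv \<theta> x ^^ m) u y =
     (\<Sum>as\<in>words m. \<Sum>bs\<in>words m. cnj (monomial \<theta> as) * monomial \<theta> bs * iter_deriv x as bs u y)"
proof (induction m arbitrary: u y)
  case 0
  show ?case by simp
next
  case (Suc m)
  have eq: "null_deriv \<theta> x u = (\<lambda>y. \<Sum>(a,b)\<in>UNIV. cnj (\<theta> a) * \<theta> b * dir_deriv x a b u y)"
    unfolding null_deriv_def[abs_def] UNIV_Times_UNIV[symmetric] sum.cartesian_product ..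
  hence eq': "null_deriv \<theta> x u = (\<lambda>y. \<Sum>p\<in>UNIV. (cnj (\<theta> (fst p)) * \<theta> (snd p)) *
      (\<lambda>p. dir_deriv x (fst p) (snd p) u) p y)"
    by (simp add: case_prod_unfold)
  have mem: "null_deriv \<theta> x u \<in> gauss_poly s z"
    unfolding null_deriv_def[abs_def] by (intro gauss_poly_sum gauss_poly.scale gauss_poly_dir_deriv Suc.prems)
  have "iter_deriv x as bs (null_deriv \<theta> x u) y = (\<Sum>a\<in>UNIV. \<Sum>b\<in>UNIV. cnj (\<theta> a) * \<theta> b *
      iter_deriv x as bs (dir_deriv x a b u) y)"
    if "length as = m" "length bs = m" for as bs
    unfolding eq' 
    by (subst iter_deriv_sum_scale[of _ _ s z]) 
      (auto simp: that gauss_poly_dir_deriv Suc.prems sum.cartesian_product case_prod_unfold)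
  hence "(null_deriv \<theta> x ^^ m) (null_deriv \<theta> x u) y =
    (\<Sum>as\<in>words m. \<Sum>bs\<in>words m. \<Sum>a\<in>UNIV. \<Sum>b\<in>UNIV. cnj (monomial \<theta> as) * monomial \<theta> bs * (cnj (\<theta> a) * \<theta> b *
        iter_deriv x as bs (dir_deriv x a b u) y))"
    unfolding Suc.IH[OF mem] by (simp add: sum_distrib_left)
  also have "\<dots> = (\<Sum>a\<in>UNIV. \<Sum>as\<in>words m. \<Sum>b\<in>UNIV. \<Sum>bs\<in>words m. cnj (monomial \<theta> as) * monomial \<theta> bs *
      (cnj (\<theta> a) * \<theta> b * iter_deriv x as bs (dir_deriv x a b u) y))"
    unfolding sum_UNIV_2 sum.distrib ..
  finally show ?case
    by (simp add: funpow_swap1 sum_words_Suc mult_ac)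
qed

definition real_deriv :: "'n::finite pt \<Rightarrow> ('n pt \<Rightarrow> complex) \<Rightarrow> 'n pt \<Rightarrow> complex" where
  "real_deriv x u y = (\<Sum>l\<in>UNIV. \<Sum>j\<in>UNIV. of_real (x $ l $ j) * partial l j u y)"

lemma real_deriv_eq: "real_deriv x u y = (\<Sum>a\<in>UNIV. dir_deriv x a a u y)"
  unfolding real_deriv_def dir_deriv_def sum_UNIV_2 sum_UNIV_unprimed Z_low_cases null_coord_cases sum_4
      sum.distrib[symmetric]
  by (intro sum.cong refl) (simp add: complex_eq_iff, simp add: field_simps)

lemma real_deriv_power_expand:
  "u \<in> gauss_poly s z \<Longrightarrow> (real_deriv x ^^ m) u y = (\<Sum>as\<in>words m. iter_deriv x as as u y)"
proof (induction m arbitrary: u y)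
  case 0
  show ?case by simp
next
  case (Suc m)
  have eq: "real_deriv x u = (\<lambda>y. \<Sum>a\<in>UNIV. 1 * dir_deriv x a a u y)"
    by (simp add: real_deriv_eq[abs_def])
  have mem: "real_deriv x u \<in> gauss_poly s z"
    unfolding eq by (intro gauss_poly_sum gauss_poly.scale gauss_poly_dir_deriv Suc.prems)
  have "iter_deriv x as as (real_deriv x u) y = (\<Sum>a\<in>UNIV. iter_deriv x as as (dir_deriv x a a u) y)" for as
    unfolding eq by (subst iter_deriv_sum_scale[of _ _ s z]) (auto simp: gauss_poly_dir_deriv Suc.prems)
  hence "(real_deriv x ^^ m) (real_deriv x u) y = (\<Sum>as\<in>words m. \<Sum>a\<in>UNIV. iter_deriv x as as (dir_deriv x a a
      u) y)"
    unfolding Suc.IH[OF mem] by simp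
  thus ?case by (simp add: funpow_swap1 sum_words_Suc sum.swap[of _ "words m"])
qed

section \<open>Symmetry of the Taylor coefficients\<close>

text \<open>
  For a derivative \<open>u\<close> of a Gaussian this is, up to sign, the integral of that derivative of the component
  \<open>f\<^sub>I\<close> against the Gaussian.
\<close>

definition coefficient :: "('n::finite pt \<Rightarrow> tuple) \<Rightarrow> 2 list \<Rightarrow> ('n pt \<Rightarrow> complex) \<Rightarrow> complex" where
  "coefficient f I u = (LINT y|lborel. f y I * u y)"

lemma bergman_weighted_L2:
  "f \<in> bergman_space k sq_norm \<Longrightarrow> weighted_L2 (\<lambda>y. f y I)"
  by (auto simp: bergman_space_def intro: L2_phi_component)

lemma bergman_permute:
  "f \<in> bergman_space k \<phi> \<Longrightarrow> length I = k \<Longrightarrow> mset I = mset J \<Longrightarrow> f y I = f y J"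
  by (auto simp: bergman_space_def L2_phi_def V0_def)

lemma integrable_coefficient:
  assumes "f \<in> bergman_space k sq_norm" "u \<in> gauss_poly s z" "s \<ge> 2"
  shows "integrable lborel (\<lambda>y. f y I * u y)"
  by (intro integrable_weighted_pairing bergman_weighted_L2[OF assms(1)] gauss_poly_dominated[OF assms(3,2)])

lemma coefficient_sum_scale:
  assumes "f \<in> bergman_space k sq_norm" "s \<ge> 2" "\<And>i. i \<in> S \<Longrightarrow> u i \<in> gauss_poly s z"
  shows "coefficient f I (\<lambda>y. \<Sum>i\<in>S. c i * u i y) = (\<Sum>i\<in>S. c i * coefficient f I (u i))"
proof -
  have "coefficient f I (\<lambda>y. \<Sum>i\<in>S. c i * u i y) = (LINT y|lborel. (\<Sum>i\<in>S. c i * (f y I * u i y)))"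
    unfolding coefficient_def by (simp add: sum_distrib_left mult_ac)
  also have "\<dots> = (\<Sum>i\<in>S. c i * coefficient f I (u i))"
    unfolding coefficient_def
    by (subst Bochner_Integration.integral_sum)
      (auto intro!: integrable_mult_right integrable_coefficient[OF assms(1) _ assms(2)] assms(3))
  finally show ?thesis .
qed

lemma coefficient_exchange:
  assumes f: "f \<in> bergman_space k sq_norm" and I: "length I = k - 1"
    and u: "u \<in> gauss_poly s z" and s: "s \<ge> 2"
  shows "coefficient f (b # I) (dir_deriv x a b' u) = coefficient f (b' # I) (dir_deriv x a b u)"
proof -
  have *: "coefficient f (0 # I) (dir_deriv x a 1 u) = coefficient f (1 # I) (dir_deriv x a 0 u)"
    unfolding dir_deriv_def[abs_def]
    using bergman_exchange[OF f I u s]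
    by (simp only: coefficient_sum_scale[OF f s gauss_poly_Z_low[OF u]]) (simp add: coefficient_def)
  show ?thesis using cases_2_01[of b] cases_2_01[of b'] * by auto
qed

text \<open>
  The derivative indices \<open>bs\<close> and the tensor indices \<open>I\<close> together form a symmetric word. By induction all entries
  but the first may be permuted; the missing transposition of the first derivative index with a tensor index is
  \<open>coefficient_exchange\<close>. The tensor indices serve as the pivot, so at least one is required.
\<close>

lemma coefficient_iter_deriv_symmetric:
  assumes f: "f \<in> bergman_space k sq_norm" and k: "k \<ge> 1" and s: "s \<ge> 2"
  shows "u \<in> gauss_poly s z \<Longrightarrow> length bs = length as \<Longrightarrow> length bs' = length as \<Longrightarrow>
    length I = k \<Longrightarrow> mset (bs @ I) = mset (bs' @ I') \<Longrightarrow>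
    coefficient f I (iter_deriv x as bs u) = coefficient f I' (iter_deriv x as bs' u)"
proof (induction as arbitrary: u bs bs' I I')
  case Nil
  thus ?case using bergman_permute[OF f, of I I'] by (simp add: coefficient_def)
next
  case (Cons a as)
  obtain b cs where bs: "bs = b # cs" using Cons.prems by (cases bs) auto
  obtain b' cs' where bs': "bs' = b' # cs'" using Cons.prems by (cases bs') auto
  have len: "length cs = length as" "length cs' = length as" using Cons.prems by (auto simp: bs bs')
  have lenI': "length I' = k" using Cons.prems(2-5) by (metis length_append add_left_cancel size_mset)
  show ?case
  proof (cases "b = b'")
    case True
    show ?thesis unfolding bs bs' True iter_deriv.simps
      by (rule Cons.IH) (use Cons.prems len in \<open>auto simp: bs bs' True gauss_poly_dir_deriv\<close>)
  next
    case False
    \<comment> \<open>\<open>M\<close> consists of the letters other than \<open>b\<close> and \<open>b'\<close>: move \<open>b'\<close> to the first tensor slot, exchange it with \<open>b\<close>, rearrange again.\<close>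
    define M where "M = mset (cs @ I) - {#b'#}"
    have ms: "add_mset b (mset (cs @ I)) = add_mset b' (mset (cs' @ I'))"
      using Cons.prems(5) by (simp add: bs bs')
    hence "b' \<in># mset (cs @ I)" using False by (metis insert_noteq_member)
    hence M: "mset (cs @ I) = add_mset b' M" by (simp add: M_def)
    hence M': "mset (cs' @ I') = add_mset b M" using ms by (simp add: add_mset_commute)
    obtain d where d: "mset d = M" using ex_mset by blast
    have lend: "length d = length as + (k - 1)"
      using arg_cong[OF M, of size] len Cons.prems(4) k by (simp flip: d)
    define d1 d2 where "d1 = take (length as) d" and "d2 = drop (length as) d"
    have dd: "mset d1 + mset d2 = M" "length d1 = length as" "length d2 = k - 1"
      using lend by (auto simp: d1_def d2_def d simp flip: mset_append)
    have "coefficient f I (iter_deriv x as cs (dir_deriv x a b u)) =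
        coefficient f (b' # d2) (iter_deriv x as d1 (dir_deriv x a b u))"
      by (rule Cons.IH) (use Cons.prems len dd M k in \<open>auto simp: gauss_poly_dir_deriv\<close>)
    also have "\<dots> = coefficient f (b # d2) (iter_deriv x as d1 (dir_deriv x a b' u))"
      unfolding iter_deriv_commute[OF Cons.prems(1)]
      by (rule coefficient_exchange[OF f dd(3) gauss_poly_iter_deriv[OF Cons.prems(1)] s])
    also have "\<dots> = coefficient f I' (iter_deriv x as cs' (dir_deriv x a b' u))"
      by (rule Cons.IH) (use Cons.prems len dd M' k in \<open>auto simp: gauss_poly_dir_deriv\<close>)
    finally show ?thesis by (simp add: bs bs')
  qed
qed

section \<open>Moments of the sphere and the homogeneous reproducing identity\<close>

lemma measurable_cnj [measurable]: "cnj \<in> borel_measurable borel"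
  by (intro borel_measurable_continuous_onI continuous_intros)

abbreviation unit_interval :: "real measure" where "unit_interval \<equiv> restrict_space lborel {0..1}"

text \<open>
  The sphere in \<open>\<complex>\<^sup>2\<close> modulo a common phase, on which the kernel does not depend: with \<open>|\<theta>\<^sub>0|\<^sup>2\<close> as
  parameter the invariant measure becomes Lebesgue measure on the unit square.
\<close>

definition sphere_param :: "real \<times> real \<Rightarrow> 2 \<Rightarrow> complex" where
  "sphere_param p a = (if a = 0 then of_real (sqrt (fst p)) else of_real (sqrt (1 -
      fst p)) * cis (2 * pi * snd p))"

abbreviation sphere_monomial :: "real \<times> real \<Rightarrow> 2 list \<Rightarrow> complex" where
  "sphere_monomial p \<equiv> monomial (sphere_param p)"

definition sphere_measure :: "(real \<times> real) measure" where
  "sphere_measure = unit_interval \<Otimes>\<^sub>M unit_interval"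

lemma prob_space_unit_interval: "prob_space unit_interval"
  by (rule prob_spaceI) (simp add: emeasure_restrict_space space_restrict_space)

interpretation unit_interval: prob_space unit_interval
  by (rule prob_space_unit_interval)

interpretation unit_square: pair_prob_space unit_interval unit_interval ..

interpretation sphere: prob_space sphere_measure
  unfolding sphere_measure_def by (rule unit_square.P.prob_space_axioms)

lemma measurable_sphere_param [measurable]: "(\<lambda>p. sphere_param p a) \<in> borel_measurable sphere_measure"
proof -
  have 1: "(\<lambda>x. x) \<in> borel_measurable unit_interval" by (simp add: measurable_restrict_space1)
  have [measurable]: "fst \<in> borel_measurable sphere_measure" "snd \<in> borel_measurable sphere_measure"
    unfolding sphere_measure_def
    using measurable_compose[OF measurable_fst 1] measurable_compose[OF measurable_snd 1] by auto
  have [measurable]: "cis \<in> borel_measurable borel"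
    by (intro borel_measurable_continuous_onI continuous_intros)
  show ?thesis unfolding sphere_param_def by measurable
qed

lemma sphere_param_norm:
  assumes "p \<in> space sphere_measure"
  shows "(cmod (sphere_param p 0))\<^sup>2 + (cmod (sphere_param p 1))\<^sup>2 = 1"
proof -
  have "0 \<le> fst p" "fst p \<le> 1"
    using assms by (auto simp: sphere_measure_def space_pair_measure space_restrict_space)
  thus ?thesis by (simp add: sphere_param_def norm_mult)
qed

lemma count_list_words: "count_list w (0::2) + count_list w 1 = length w"
proof (induction w)
  case (Cons a w)
  thus ?case using cases_2_01[of a] by auto
qed simp

lemma mset_eq_iff_count:
  assumes "length u = length w"
  shows "mset u = mset w \<longleftrightarrow> count_list u (1::2) = count_list w 1"
proof
  assume *: "count_list u (1::2) = count_list w 1"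
  hence "count_list u 0 = count_list w 0" using count_list_words[of u] count_list_words[of w] assms by linarith
  with * have "count_list u a = count_list w a" for a using cases_2_01[of a] by auto
  thus "mset u = mset w" by (intro multiset_eqI) (simp add: count_mset)
qed (metis count_mset)

lemma card_words_count:
  "card {w \<in> words N. count_list w (1::2) = q} = N choose q"
proof -
  have "(\<Sum>w\<in>words N. of_bool (count_list w (1::2) = q) :: nat) = N choose q"
  proof (induction N arbitrary: q)
    case 0
    show ?case by (cases q) auto
  next
    case (Suc N)
    show ?case
      by (cases q) (simp_all add: sum_words_Suc sum_UNIV_2 Suc.IH del: sum_of_bool_eq)
  qed
  moreover have "{w \<in> words N. count_list w (1::2) = q} = words N \<inter> {w. count_list w 1 = q}" by auto
  moreover have "(\<Sum>w\<in>words N. of_bool (count_list w (1::2) = q) :: nat) =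
      card (words N \<inter> {w. count_list w 1 = q})"
    by (subst sum_of_bool_eq) auto
  ultimately show ?thesis by (simp only:)
qed

lemma monomial_sphere:
  "sphere_monomial p w = 
     of_real (sqrt (fst p) ^ (length w - count_list w 1) * sqrt (1 -
         fst p) ^ count_list w 1) * cis (2 * pi * snd p * count_list w 1)"
proof (induction w)
  case (Cons a w)
  have *: "count_list w 1 \<le> length w" by (simp add: count_le_length)
  from cases_2_01[of a] show ?case
  proof
    assume a: "a = 0"
    show ?thesis unfolding monomial_simps Cons.IH using *
      by (simp add: a Suc_diff_le sphere_param_def)
  next
    assume a: "a = 1"
    have "cis (2 * pi * snd p * real (Suc (count_list w 1))) =
        cis (2 * pi * snd p) * cis (2 * pi * snd p * real (count_list w 1))"
      by (simp add: cis_mult algebra_simps)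
    moreover have "count_list (a # w) 1 = Suc (count_list w 1)" "length (a # w) - count_list (a # w) 1 =
        length w - count_list w 1"
      by (simp_all add: a)
    moreover have "sphere_param p a = of_real (sqrt (1 - fst p)) * cis (2 * pi * snd p)"
      by (simp add: a sphere_param_def)
    ultimately show ?thesis unfolding monomial_simps Cons.IH
      by (simp only: power_Suc of_real_mult mult_ac)
  qed
qed simp

lemma integral_cis_int:
  "(LINT b|unit_interval. cis (2 * pi * of_int d * b)) = (if d = 0 then 1 else 0)"
proof (cases "d = 0")
  case True
  have "unit_interval.prob {0..1} = 1"
    using unit_interval.prob_space by (simp add: space_restrict_space)
  thus ?thesis using True by simp
next
  case False
  have "(LINT b|unit_interval. cis (2 * pi * of_int d * b)) =
      (LINT b|lborel. indicator {0..1} b *\<^sub>R cis (2 * pi * of_int d * b))"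
    by (subst integral_restrict_space) auto
  also have "\<dots> = cis (2 * pi * of_int d * 1) / (\<i> * of_real (2 * pi * of_int d)) -
      cis (2 * pi * of_int d * 0) / (\<i> * of_real (2 * pi * of_int d))"
  proof (rule integral_FTC_Icc)
    fix b :: real
    define c where "c = \<i> * of_real (2 * pi * of_int d)"
    have c: "c \<noteq> 0" "cis (2 * pi * of_int d * b) = exp (c * of_real b)" for b
      using False by (auto simp: c_def cis_conv_exp mult.assoc)
    have "((\<lambda>z. exp (c * z) / c) has_field_derivative exp (c * of_real b)) (at (of_real b))"
      using c(1) by (auto intro!: derivative_eq_intros)
    from has_vector_derivative_real_field[OF this]
    show "((\<lambda>b. cis (2 * pi * of_int d * b) / (\<i> * of_real (2 * pi * of_int d))) has_vector_derivative
      cis (2 * pi * of_int d * b)) (at b within {0..1})"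
      unfolding c(2) unfolding c_def .
  qed (auto intro!: continuous_intros)
  also have "\<dots> = 0" using cis_multiple_2pi[of "of_int d"]
      by (simp add: mult.commute[of _ "of_int d"] mult.left_commute)
  finally show ?thesis using False by simp
qed

lemma integral_beta:
  assumes "q \<le> N"
  shows "(LINT s|unit_interval. s ^ (N - q) * (1 - s) ^ q) = 1 / (real (N + 1) * real (N choose q))"
proof -
  have "(LINT s|unit_interval. s ^ (N - q) * (1 - s) ^ q) =
      (LINT s|lborel. indicator {0..1} s *\<^sub>R (s ^ (N - q) * (1 - s) ^ q))"
    by (subst integral_restrict_space) auto
  also have "\<dots> = integral {0..1} (\<lambda>s::real. s ^ (N - q) * (1 - s) ^ q)"
    by (intro set_borel_integral_eq_integral(2)[unfolded set_lebesgue_integral_def]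
        borel_integrable_atLeastAtMost')
      (auto intro!: continuous_intros)
  also have "((\<lambda>s::real. s powr (real (Suc (N - q)) - 1) * (1 - s) powr (real (Suc q) -
      1)) has_integral Beta (Suc (N - q)) (Suc q)) {0..1}"
    by (rule has_integral_Beta_real) auto
  hence "((\<lambda>s::real. s ^ (N - q) * (1 - s) ^ q) has_integral Beta (Suc (N - q)) (Suc q)) {0..1}"
    by (rule has_integral_spike_finite[of "{0, 1}", rotated 2]) (auto simp: powr_realpow)
  hence "integral {0..1} (\<lambda>s::real. s ^ (N - q) * (1 - s) ^ q) = Beta (Suc (N - q)) (Suc q)"
    by (rule integral_unique)
  also have "Beta (real (Suc (N - q))) (Suc q) = fact (N - q) * fact q / fact (N + 1)"
    using Gamma_fact[of "N - q", where 'a=real] Gamma_fact[of q, where 'a=real] Gamma_fact[of "N +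
        1", where 'a=real] assms
    by (simp add: Beta_def add_ac of_nat_diff)
  also have "\<dots> = 1 / (real (N + 1) * real (N choose q))"
    using assms by (simp add: binomial_fact field_simps)
  finally show ?thesis .
qed

lemma norm_sphere_param:
  assumes "p \<in> space sphere_measure" shows "cmod (sphere_param p a) \<le> 1"
proof -
  have "(cmod (sphere_param p a))\<^sup>2 \<le> 1"
    using sphere_param_norm[OF assms] cases_2_01[of a] zero_le_power2[of "cmod (sphere_param p 0)"]
      zero_le_power2[of "cmod (sphere_param p 1)"]
    by (elim disjE) (hypsubst, linarith)+
  thus ?thesis by (simp add: power_le_one_iff)
qed

lemma norm_sphere_monomial:
  assumes "p \<in> space sphere_measure" shows "cmod (sphere_monomial p w) \<le> 1"
  by (induction w) (auto simp: norm_mult intro!: mult_le_one norm_sphere_param assms)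

lemma measurable_sphere_monomial [measurable]: "(\<lambda>p. sphere_monomial p w) \<in> borel_measurable sphere_measure"
  by (induction w) simp_all

lemma integrable_sphere_moment:
  "integrable sphere_measure (\<lambda>p. cnj (sphere_monomial p u) * sphere_monomial p w)"
proof (rule sphere.integrable_const_bound[where B=1])
  show "AE p in sphere_measure. norm (cnj (sphere_monomial p u) * sphere_monomial p w) \<le> 1"
    by (rule AE_I2) (auto simp: norm_mult intro!: mult_le_one norm_sphere_monomial)
qed measurable

text \<open>
  Schur orthogonality for the symmetric power \<open>\<odot>\<^sup>N \<complex>\<^sup>2\<close>, of dimension \<open>N + 1\<close>: the phase integral forces equal
  numbers of ones, and the Beta integral gives \<open>1 / (N + 1)\<close> times the inverse of the number of words with that many ones.
\<close>

lemma sphere_moment: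
  assumes "length u = N" "length w = N"
  shows "(LINT p|sphere_measure. cnj (sphere_monomial p u) * sphere_monomial p w) =
     (if mset u = mset w then 1 / of_nat ((N + 1) * card {v \<in> words N. mset v = mset w}) else 0)"
proof -
  define c d where "c = count_list u (1::2)" and "d = count_list w (1::2)"
  have cd: "c \<le> N" "d \<le> N" using assms count_le_length[of u 1] count_le_length[of w 1]
      by (auto simp: c_def d_def)
  have card: "card {v \<in> words N. mset v = mset w} = N choose d"
  proof -
    have "{v \<in> words N. mset v = mset w} = {v \<in> words N. count_list v 1 = d}"
      using assms mset_eq_iff_count by (auto simp: d_def)
    thus ?thesis using card_words_count by metis
  qed
  have "(LINT p|sphere_measure. cnj (sphere_monomial p u) * sphere_monomial p w) =
     (LINT s|unit_interval. LINT b|unit_interval. cnj (monomial (sphere_param (s, b)) u) *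
         monomial (sphere_param (s, b)) w)"
    using unit_square.integral_fst'[OF integrable_sphere_moment[unfolded sphere_measure_def]]
    by (simp add: sphere_measure_def)
  also have "\<dots> = (LINT s|unit_interval. (if c = d then of_real (s ^ (N - d) * (1 - s) ^ d) else 0))"
  proof (rule Bochner_Integration.integral_cong[OF refl])
    fix s assume "s \<in> space unit_interval"
    hence s: "0 \<le> s" "s \<le> 1" by (auto simp: space_restrict_space)
    have "cnj (monomial (sphere_param (s, b)) u) * monomial (sphere_param (s, b)) w =
      of_real (sqrt s ^ (N - c) * sqrt (1 - s) ^ c * (sqrt s ^ (N - d) * sqrt (1 -
          s) ^ d)) * cis (2 * pi * of_int (int d - int c) * b)" for b
    proof -
      have "cnj (cis (2 * pi * b * c)) * cis (2 * pi * b * d) = cis (2 * pi * of_int (int d - int c) * b)"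
        by (simp add: cis_cnj cis_mult algebra_simps)
      thus ?thesis unfolding monomial_sphere assms c_def[symmetric] d_def[symmetric] fst_conv snd_conv
          complex_cnj_mult complex_cnj_complex_of_real of_real_mult
        by (metis (no_types, lifting) mult.assoc mult.left_commute)
    qed
    hence I: "(LINT b|unit_interval. cnj (monomial (sphere_param (s, b)) u) *
        monomial (sphere_param (s, b)) w) =
      of_real (sqrt s ^ (N - c) * sqrt (1 - s) ^ c * (sqrt s ^ (N - d) * sqrt (1 - s) ^ d)) * (if int d -
          int c = 0 then 1 else 0)"
      by (simp only: integral_mult_right_zero integral_cis_int)
    have E: "sqrt s ^ (N - d) * sqrt (1 - s) ^ d * (sqrt s ^ (N - d) * sqrt (1 - s) ^ d) =
        s ^ (N - d) * (1 - s) ^ d"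
    proof -
      have "sqrt s ^ n * sqrt s ^ n = s ^ n" "sqrt (1 - s) ^ n * sqrt (1 - s) ^ n = (1 - s) ^ n" for n
        using s by (simp_all flip: power_mult_distrib)
      thus ?thesis by (metis (no_types, lifting) mult.assoc mult.left_commute)
    qed
    show "(LINT b|unit_interval. cnj (monomial (sphere_param (s, b)) u) * monomial (sphere_param (s, b)) w) =
      (if c = d then of_real (s ^ (N - d) * (1 - s) ^ d) else 0)"
    proof (cases "c = d")
      case True
      show ?thesis unfolding I unfolding True E by simp
    qed (simp add: I)
  qed
  also have "\<dots> = (if c = d then of_real (1 / (real (N + 1) * real (N choose d))) else 0)"
  proof (cases "c = d")
    case True
    show ?thesis by (simp only: True simp_thms if_True integral_complex_of_real integral_beta[OF cd(2)])
  qed simp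
  also have "\<dots> = (if mset u = mset w then 1 / of_nat ((N + 1) * card {v \<in> words N. mset v = mset w}) else 0)"
    unfolding card using mset_eq_iff_count[of u w] assms by (simp add: c_def d_def distrib_right)
  finally show ?thesis .
qed

text \<open>
  Averaging over the sphere turns the isotropic derivatives of order \<open>m\<close> into the derivative in the real direction
  \<open>x\<close>. For a fixed word \<open>as\<close> the sum runs over the words \<open>w\<close> of length \<open>m + k\<close> that consist of the derivative indices
  and the tensor indices. The moments keep exactly the rearrangements of \<open>as @ J\<close>; by symmetry they all
  carry the same coefficient, and the moment is normalised by their number.
\<close>

lemma sphere_coefficient_identity:
  assumes f: "f \<in> bergman_space k sq_norm" and k: "k \<ge> 1" and J: "length J = k"
  shows "(LINT p|sphere_measure. cnj (sphere_monomial p J) *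
      (\<Sum>I\<in>words k. sphere_monomial p I *
         coefficient f I (\<lambda>y. pairing (sphere_param p) x y ^ m * gaussian 2 0 y)))
    = (-1) ^ m / of_nat (m + k + 1) * coefficient f J ((real_deriv x ^^ m) (gaussian 2 0))"
proof -
  define T where "T as w = coefficient f (drop m w) (iter_deriv x as (take m w) (gaussian 2 0))" for as w
  define \<mu> where "\<mu> u w = (LINT p|sphere_measure. cnj (sphere_monomial p u) * sphere_monomial p w)" for u w
  have it: "iter_deriv x as bs (gaussian 2 0) \<in> gauss_poly 2 0" for as bs
    by (intro gauss_poly_iter_deriv gauss_poly.gaussian)
  have 1: "coefficient f I (\<lambda>y. pairing \<theta> x y ^ m * gaussian 2 0 y) =
      (\<Sum>as\<in>words m. \<Sum>bs\<in>words m. (-1) ^ m * (cnj (monomial \<theta> as) * monomial \<theta> bs) * T as (bs @ I))" for I \<theta>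
  proof -
    have "(\<lambda>y. pairing \<theta> x y ^ m * gaussian 2 0 y) = 
       (\<lambda>y. \<Sum>q\<in>words m \<times> words m. ((-1) ^ m * (cnj (monomial \<theta> (fst q)) * monomial \<theta> (snd q))) *
           (\<lambda>q. iter_deriv x (fst q) (snd q) (gaussian 2 0)) q y)"
    proof (rule ext)
      fix y :: "'a pt"
      have "pairing \<theta> x y ^ m * gaussian 2 0 y = (-1) ^ m * ((-1) ^ m * (pairing \<theta> x y ^ m * gaussian 2 0 y))"
        by (simp flip: mult.assoc power_mult_distrib)
      also have "\<dots> = (-1) ^ m * (null_deriv \<theta> x ^^ m) (gaussian 2 0) y"
        unfolding null_deriv_power ..
      finally show "pairing \<theta> x y ^ m * gaussian 2 0 y =
          (\<Sum>q\<in>words m \<times> words m. ((-1) ^ m * (cnj (monomial \<theta> (fst q)) * monomial \<theta> (snd q))) *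
          (\<lambda>q. iter_deriv x (fst q) (snd q) (gaussian 2 0)) q y)"
        unfolding null_deriv_power_expand[OF gauss_poly.gaussian]
        by (simp add: sum.cartesian_product case_prod_unfold sum_distrib_left mult.assoc)
    qed
    hence "coefficient f I (\<lambda>y. pairing \<theta> x y ^ m * gaussian 2 0 y) =
      (\<Sum>q\<in>words m \<times> words m. ((-1) ^ m * (cnj (monomial \<theta> (fst q)) * monomial \<theta> (snd q))) *
          coefficient f I (iter_deriv x (fst q) (snd q) (gaussian 2 0)))"
      by (simp only:) (rule coefficient_sum_scale[OF f, of 2 _ _ 0], simp, rule it)
    also have "\<dots> = (\<Sum>as\<in>words m. \<Sum>bs\<in>words m. (-1) ^ m * (cnj (monomial \<theta> as) * monomial \<theta> bs) * T as (bs @ I))"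
      unfolding sum.cartesian_product by (intro sum.cong) (auto simp: T_def)
    finally show ?thesis .
  qed
  have 2: "cnj (monomial \<theta> J) * (\<Sum>I\<in>words k. monomial \<theta> I * coefficient f I (\<lambda>y. pairing \<theta> x y ^ m *
      gaussian 2 0 y))
     = (\<Sum>as\<in>words m. \<Sum>w\<in>words (m + k). (-1) ^ m * (cnj (monomial \<theta> (as @ J)) * monomial \<theta> w) * T as w)" for \<theta>
  proof -
    have "(\<Sum>I\<in>words k. monomial \<theta> I * coefficient f I (\<lambda>y. pairing \<theta> x y ^ m * gaussian 2 0 y)) = 
      (\<Sum>as\<in>words m. \<Sum>bs\<in>words m. \<Sum>I\<in>words k. monomial \<theta> I * ((-1) ^ m * (cnj (monomial \<theta> as) *
          monomial \<theta> bs) * T as (bs @ I)))"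
      unfolding 1 sum_distrib_left
      by (subst sum.swap) (intro sum.cong refl sum.swap)
    thus ?thesis unfolding sum_words_append by (simp add: sum_distrib_left mult_ac)
  qed
  have 3: "(\<Sum>w\<in>words (m + k). \<mu> (as @ J) w * T as w) =
      1 / of_nat (m + k + 1) * coefficient f J (iter_deriv x as as (gaussian 2 0))"
    if as: "as \<in> words m" for as
  proof -
    let ?S = "{w \<in> words (m + k). mset w = mset (as @ J)}"
    have len: "length (as @ J) = m + k" using as J by simp
    have "(\<Sum>w\<in>words (m + k). \<mu> (as @ J) w * T as w) = (\<Sum>w\<in>?S. \<mu> (as @ J) w * T as w)"
    proof (rule sum.mono_neutral_right)
      show "\<forall>w\<in>words (m + k) - ?S. \<mu> (as @ J) w * T as w = 0"
      proof
        fix w assume "w \<in> words (m + k) - ?S"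
        hence "length w = m + k" "mset (as @ J) \<noteq> mset w" by auto
        hence "\<mu> (as @ J) w = 0" unfolding \<mu>_def by (subst sphere_moment[OF len]) simp_all
        thus "\<mu> (as @ J) w * T as w = 0" by simp
      qed
    qed auto
    also have "\<dots> = (\<Sum>w\<in>?S. 1 / of_nat ((m + k + 1) * card ?S) *
        coefficient f J (iter_deriv x as as (gaussian 2 0)))"
    proof (rule sum.cong[OF refl])
      fix w assume w: "w \<in> ?S"
      have "T as w = coefficient f J (iter_deriv x as as (gaussian 2 0))"
        unfolding T_def using w as J
        by (intro coefficient_iter_deriv_symmetric[OF f k _ gauss_poly.gaussian]) auto
      moreover have "\<mu> (as @ J) w = 1 / of_nat ((m + k + 1) * card ?S)"
        using w unfolding \<mu>_def by (subst sphere_moment[OF len]) (auto simp del: mset_append)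
      ultimately show "\<mu> (as @ J) w * T as w = 1 / of_nat ((m + k +
          1) * card ?S) * coefficient f J (iter_deriv x as as (gaussian 2 0))"
        by simp
    qed
    also have "\<dots> = 1 / of_nat (m + k + 1) * coefficient f J (iter_deriv x as as (gaussian 2 0))"
    proof -
      have "finite ?S" by simp
      moreover have "as @ J \<in> ?S" using len by simp
      ultimately have "card ?S > 0" by (subst card_gt_0_iff) blast
      moreover have "(of_nat n :: complex) * (1 / of_nat (N * n) * c) = 1 / of_nat N * c" if "n > 0" for n N c
        using that by simp
      ultimately show ?thesis by (simp only: sum_constant)
    qed
    finally show ?thesis .
  qed
  have "(LINT p|sphere_measure. cnj (sphere_monomial p J) *
      (\<Sum>I\<in>words k. sphere_monomial p I * coefficient f I (\<lambda>y. pairing (sphere_param p) x y ^ m *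
          gaussian 2 0 y)))
    = (\<Sum>as\<in>words m. \<Sum>w\<in>words (m + k). (-1) ^ m * \<mu> (as @ J) w * T as w)"
  proof -
    have i: "integrable sphere_measure (\<lambda>p. (-1) ^ m * (cnj (sphere_monomial p (as @ J)) *
        sphere_monomial p w) * T as w)" for as w
      by (intro integrable_mult_left integrable_mult_right integrable_sphere_moment)
    show ?thesis unfolding 2
      by (simp only: Bochner_Integration.integral_sum Bochner_Integration.integrable_sum i
            integral_mult_left_zero integral_mult_right_zero \<mu>_def)
  qed
  also have "\<dots> = (\<Sum>as\<in>words m. (-1) ^ m * (\<Sum>w\<in>words (m + k). \<mu> (as @ J) w * T as w))"
    by (simp add: sum_distrib_left mult.assoc)
  also have "\<dots> = (\<Sum>as\<in>words m. (-1) ^ m * (1 / of_nat (m + k +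
      1) * coefficient f J (iter_deriv x as as (gaussian 2 0))))"
    by (intro sum.cong refl) (simp only: 3)
  also have "\<dots> = (-1) ^ m / of_nat (m + k + 1) * (\<Sum>as\<in>words m. coefficient f J (iter_deriv x as as (gaussian
      2 0)))"
    by (simp add: sum_distrib_left)
  also have "(\<Sum>as\<in>words m. coefficient f J (iter_deriv x as as (gaussian 2 0))) =
      coefficient f J ((real_deriv x ^^ m) (gaussian 2 0))"
  proof -
    have "(real_deriv x ^^ m) (gaussian 2 0) = (\<lambda>y. \<Sum>as\<in>words m. 1 * iter_deriv x as as (gaussian 2 0) y)"
      by (rule ext) (simp only: real_deriv_power_expand[OF gauss_poly.gaussian] mult_1)
    moreover have "coefficient f J (\<lambda>y. \<Sum>as\<in>words m. 1 * iter_deriv x as as (gaussian 2 0) y) =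
        (\<Sum>as\<in>words m. 1 * coefficient f J (iter_deriv x as as (gaussian 2 0)))"
      by (rule coefficient_sum_scale[OF f order.refl it])
    ultimately show ?thesis by (simp only: mult_1)
  qed
  finally show ?thesis .
qed

section \<open>Taylor expansion of a shifted Gaussian\<close>

definition exp_coeff :: "real \<Rightarrow> nat \<Rightarrow> real" where
  "exp_coeff a j = a ^ j / fact j"

definition exp_square_coeff :: "real \<Rightarrow> nat \<Rightarrow> real" where
  "exp_square_coeff b l = (if even l then exp_coeff (- b) (l div 2) else 0)"

text \<open>
  The Taylor coefficients of \<open>exp (a s - b s\<^sup>2)\<close> in \<open>s\<close>, as a Cauchy product. They are rescaled Hermite polynomials;
  with \<open>a = 4 x \<bullet> y\<close> and \<open>b = 2 |x|\<^sup>2\<close> the function is the quotient of the Gaussian centred at \<open>s x\<close> and the centred one.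
\<close>

definition hermite_coeff :: "real \<Rightarrow> real \<Rightarrow> nat \<Rightarrow> real" where
  "hermite_coeff a b m = (\<Sum>j\<le>m. exp_coeff a j * exp_square_coeff b (m - j))"

lemma exp_coeff_sums: "exp_coeff a sums exp a"
  using exp_converges[of a] by (simp add: exp_coeff_def[abs_def] divide_inverse mult.commute)

lemma exp_square_coeff_sums: "exp_square_coeff b sums exp (- b)"
  using sums_if[OF sums_zero exp_coeff_sums[of "- b"]] by (simp add: exp_square_coeff_def[abs_def])

lemma norm_exp_coeff: "norm (exp_coeff a j) = exp_coeff \<bar>a\<bar> j"
  by (simp add: exp_coeff_def power_abs)

lemma norm_exp_square_coeff: "norm (exp_square_coeff b l) = exp_square_coeff (- \<bar>b\<bar>) l"
  by (simp add: exp_square_coeff_def exp_coeff_def power_abs)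

lemma hermite_coeff_sums: "hermite_coeff a b sums exp (a - b)"
proof -
  have 1: "summable (\<lambda>j. norm (exp_coeff a j))" "summable (\<lambda>j. norm (exp_square_coeff b j))" for a b
    unfolding norm_exp_coeff norm_exp_square_coeff
    using exp_coeff_sums exp_square_coeff_sums sums_summable by blast+
  have "(\<Sum>j. exp_coeff a j) = exp a" "(\<Sum>j. exp_square_coeff b j) = exp (- b)"
    using exp_coeff_sums exp_square_coeff_sums sums_unique by metis+
  thus ?thesis
    using Cauchy_product_sums[OF 1(1)[of a] 1(2)[of b]] unfolding hermite_coeff_def[abs_def]
        by (simp add: exp_diff exp_minus divide_inverse)
qed

lemma abs_hermite_coeff_le: "\<bar>hermite_coeff a b m\<bar> \<le> hermite_coeff \<bar>a\<bar> (- \<bar>b\<bar>) m"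
  unfolding hermite_coeff_def
  by (rule order.trans[OF sum_abs]) (simp add: abs_mult norm_exp_coeff[unfolded real_norm_def]
      norm_exp_square_coeff[unfolded real_norm_def])

lemma sum_abs_hermite_coeff_le: "(\<Sum>m<M. \<bar>hermite_coeff a b m\<bar>) \<le> exp (\<bar>a\<bar> + \<bar>b\<bar>)"
proof -
  have s: "hermite_coeff \<bar>a\<bar> (- \<bar>b\<bar>) sums exp (\<bar>a\<bar> + \<bar>b\<bar>)"
    using hermite_coeff_sums[of "\<bar>a\<bar>" "- \<bar>b\<bar>"] by simp
  have "(\<Sum>m<M. \<bar>hermite_coeff a b m\<bar>) \<le> (\<Sum>m<M. hermite_coeff \<bar>a\<bar> (- \<bar>b\<bar>) m)"
    by (intro sum_mono abs_hermite_coeff_le)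
  also have "\<dots> \<le> exp (\<bar>a\<bar> + \<bar>b\<bar>)"
    by (rule sum_le_suminf[OF sums_summable[OF s], unfolded sums_unique[OF s, symmetric]])
      (auto intro: order.trans[OF abs_ge_zero abs_hermite_coeff_le[of a b]])
  finally show ?thesis .
qed

lemma exp_coeff_Suc: "real (Suc j) * exp_coeff a (Suc j) = a * exp_coeff a j"
  unfolding exp_coeff_def fact_Suc power_Suc by (simp del: of_nat_Suc)

lemma exp_square_coeff_Suc_Suc: "real (Suc (Suc l)) * exp_square_coeff b (Suc (Suc l)) =
    - 2 * b * exp_square_coeff b l"
proof (cases "even l")
  case True
  then obtain h where l: "l = 2 * h" by blast
  have "real (Suc (Suc l)) * exp_square_coeff b (Suc (Suc l)) = 2 * (real (Suc h) * exp_coeff (- b) (Suc h))"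
    by (simp add: l exp_square_coeff_def)
  thus ?thesis unfolding exp_coeff_Suc by (simp add: l exp_square_coeff_def)
qed (simp add: exp_square_coeff_def)

text \<open>
  The coefficient form of the differential equation \<open>g' = (a - 2 b s) g\<close> of \<open>g(s) = exp (a s - b s\<^sup>2)\<close>.
\<close>

lemma hermite_coeff_Suc:
  "real (Suc m) * hermite_coeff a b (Suc m) = a * hermite_coeff a b m - 2 * b * (if m =
      0 then 0 else hermite_coeff a b (m - 1))"
proof -
  have "real (Suc m) * hermite_coeff a b (Suc m) =
      (\<Sum>j\<le>Suc m. (real j + real (Suc m - j)) * (exp_coeff a j * exp_square_coeff b (Suc m - j)))"
    unfolding hermite_coeff_def sum_distrib_left by (intro sum.cong) auto
  also have "\<dots> = (\<Sum>j\<le>Suc m. real j * exp_coeff a j * exp_square_coeff b (Suc m - j)) +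
      (\<Sum>j\<le>Suc m. exp_coeff a j * (real (Suc m - j) * exp_square_coeff b (Suc m - j)))"
    unfolding sum.distrib[symmetric] by (intro sum.cong refl) (simp only: ring_distribs mult_ac)
  also have "(\<Sum>j\<le>Suc m. real j * exp_coeff a j * exp_square_coeff b (Suc m - j)) = a * hermite_coeff a b m"
    unfolding sum.atMost_Suc_shift exp_coeff_Suc hermite_coeff_def by (simp add: sum_distrib_left mult.assoc)
  also have "(\<Sum>j\<le>Suc m. exp_coeff a j * (real (Suc m - j) * exp_square_coeff b (Suc m - j))) =
      - 2 * b * (if m = 0 then 0 else hermite_coeff a b (m - 1))"
  proof (cases m)
    case 0
    thus ?thesis by (simp add: exp_square_coeff_def)
  next
    case (Suc n)
    have "(\<Sum>j\<le>n. exp_coeff a j * (real (Suc m - j) * exp_square_coeff b (Suc m - j))) =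
        (\<Sum>j\<le>n. - 2 * b * (exp_coeff a j * exp_square_coeff b (n - j)))"
    proof (rule sum.cong[OF refl])
      fix j assume "j \<in> {..n}"
      hence "Suc m - j = Suc (Suc (n - j))" using Suc by auto
      thus "exp_coeff a j * (real (Suc m - j) * exp_square_coeff b (Suc m - j)) =
          - 2 * b * (exp_coeff a j * exp_square_coeff b (n - j))"
        by (simp only: exp_square_coeff_Suc_Suc mult_ac)
    qed
    thus ?thesis using Suc by (simp add: exp_square_coeff_def hermite_coeff_def sum_distrib_left sum_negf)
  qed
  finally show ?thesis by simp
qed

lemma hermite_coeff_has_derivative:
  "((\<lambda>a. hermite_coeff a b m) has_real_derivative (if m = 0 then 0 else hermite_coeff a b (m - 1))) (at a)"
proof -
  have 1: "((\<lambda>a. exp_coeff a j) has_real_derivative (if j = 0 then 0 else exp_coeff a (j - 1))) (at a)" for j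
  proof (cases j)
    case (Suc i)
    have "((\<lambda>a. a ^ Suc i / fact (Suc i)) has_real_derivative (real (Suc i) * a ^ i / fact (Suc i))) (at a)"
      using DERIV_cdivide[OF DERIV_pow[of "Suc i" a], of "fact (Suc i)"]
          by (simp del: of_nat_Suc fact_Suc power_Suc)
    also have "real (Suc i) * a ^ i / fact (Suc i) = a ^ i / fact i" by (simp del: of_nat_Suc)
    finally show ?thesis by (simp add: Suc exp_coeff_def[abs_def] del: power_Suc fact_Suc)
  qed (simp add: exp_coeff_def)
  have "((\<lambda>a. hermite_coeff a b m) has_real_derivative (\<Sum>j\<le>m. (if j =
      0 then 0 else exp_coeff a (j - 1)) * exp_square_coeff b (m - j))) (at a)"
    unfolding hermite_coeff_def by (intro DERIV_sum DERIV_cmult_right 1)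
  moreover have "(\<Sum>j\<le>m. (if j = 0 then 0 else exp_coeff a (j - 1)) * exp_square_coeff b (m - j)) = (if m =
      0 then 0 else hermite_coeff a b (m - 1))"
    by (cases m) (simp_all add: sum.atMost_Suc_shift hermite_coeff_def del: sum.atMost_Suc)
  ultimately show ?thesis by simp
qed

lemma pt_expansion: "(x :: 'n::finite pt) = (\<Sum>l\<in>UNIV. \<Sum>j\<in>UNIV. x $ l $ j *\<^sub>R axis l (axis j 1))"
proof (intro vec_eq_iff[THEN iffD2] allI)
  fix l j
  have "(\<Sum>l'\<in>UNIV. \<Sum>j'\<in>UNIV. x $ l' $ j' *\<^sub>R axis l' (axis j' (1::real))) $ l $ j =
     (\<Sum>l'\<in>UNIV. \<Sum>j'\<in>UNIV. if l' = l then if j' = j then x $ l' $ j' else 0 else 0)"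
    unfolding sum_component vector_scaleR_component axis_axis_nth by (intro sum.cong refl) simp
  also have "\<dots> = (\<Sum>l'\<in>UNIV. if l' = l then x $ l' $ j else 0)"
    by (intro sum.cong refl) simp
  finally show "x $ l $ j = (\<Sum>l'\<in>UNIV. \<Sum>j'\<in>UNIV. x $ l' $ j' *\<^sub>R axis l' (axis j' (1::real))) $ l $ j"
    by simp
qed

lemma real_deriv_eqI:
  assumes "(u has_derivative u') (at y)"
  shows "real_deriv x u y = u' x"
proof -
  interpret u': bounded_linear u' using assms by (rule has_derivative_bounded_linear)
  have "u' x = (\<Sum>l\<in>UNIV. \<Sum>j\<in>UNIV. x $ l $ j *\<^sub>R u' (axis l (axis j 1)))"
    by (subst (1) pt_expansion) (simp only: u'.sum u'.scaleR)
  thus ?thesis by (simp add: real_deriv_def partial_eqI[OF assms] scaleR_conv_of_real)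
qed

lemma real_deriv_power_gaussian:
  "(real_deriv x ^^ m) (gaussian 2 0) =
     (\<lambda>y. (-1) ^ m * fact m * of_real (hermite_coeff (4 * (x \<bullet> y)) (2 * (norm x)\<^sup>2) m) * gaussian 2 0 y)"
proof (induction m)
  case 0
  show ?case by (simp add: hermite_coeff_def exp_coeff_def exp_square_coeff_def)
next
  case (Suc m)
  let ?H = "\<lambda>y. hermite_coeff (4 * (x \<bullet> y)) (2 * (norm x)\<^sup>2)"
  show ?case
  proof (rule ext)
    fix y
    define p where "p = (if m = 0 then 0 else ?H y (m - 1))"
    have "((\<lambda>y. ?H y m) has_derivative (\<lambda>h. p * (4 * (x \<bullet> h)))) (at y)"
      using has_derivative_compose[OF has_derivative_mult_right[OF has_derivative_inner_right[OF
          has_derivative_ident]], of "\<lambda>a. hermite_coeff a (2 * (norm x)\<^sup>2) m" "\<lambda>h. p * h" 4 x y UNIV]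
        hermite_coeff_has_derivative[of "2 * (norm x)\<^sup>2" m "4 * (x \<bullet> y)"]
      by (simp add: has_field_derivative_def p_def)
    from bounded_linear.has_derivative[OF bounded_linear_of_real this]
    have d1: "((\<lambda>y. complex_of_real (?H y m)) has_derivative (\<lambda>h. of_real (p * (4 * (x \<bullet> h))))) (at y)" .
    have "((\<lambda>y. (-1) ^ m * fact m * (of_real (?H y m) * gaussian 2 0 y)) has_derivative
       (\<lambda>h. (-1) ^ m * fact m * (of_real (?H y m) * (of_real (- 2 * 2 * ((y - 0) \<bullet> h)) * gaussian 2 0 y) +
           of_real (p * (4 * (x \<bullet> h))) * gaussian 2 0 y))) (at y)"
      by (intro has_derivative_mult_right has_derivative_mult[OF d1 has_derivative_gaussian])
    from real_deriv_eqI[OF this, of x]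
    have "(real_deriv x ^^ Suc m) (gaussian 2 0) y =
        (-1) ^ m * fact m * (of_real (?H y m) * (of_real (- 4 * (x \<bullet> y)) * gaussian 2 0 y) +
        of_real (p * (4 * (norm x)\<^sup>2)) * gaussian 2 0 y)"
      unfolding funpow.simps comp_apply Suc.IH by (simp add: power2_norm_eq_inner inner_commute mult.assoc)
    also have "\<dots> = (-1) ^ m * fact m * (of_real (- (4 * (x \<bullet> y) * ?H y m -
        2 * (2 * (norm x)\<^sup>2) * p)) * gaussian 2 0 y)"
      by (simp add: algebra_simps)
    also have "4 * (x \<bullet> y) * ?H y m - 2 * (2 * (norm x)\<^sup>2) * p = real (Suc m) * ?H y (Suc m)"
      unfolding hermite_coeff_Suc p_def ..
    finally show "(real_deriv x ^^ Suc m) (gaussian 2 0) y =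
        (-1) ^ Suc m * fact (Suc m) * of_real (?H y (Suc m)) * gaussian 2 0 y"
      by (simp add: mult_ac)
  qed
qed

text \<open>
  The Taylor series of the Gaussian under a translation by \<open>x\<close>. Its partial sums are dominated by
  \<open>exp (|a| + |b|)\<close> times the Gaussian, which still pairs with \<open>f\<close>.
\<close>

lemma hermite_expansion_sums:
  assumes f: "f \<in> bergman_space k sq_norm"
  shows "(\<lambda>m. (-1) ^ m / fact m * coefficient f J ((real_deriv x ^^ m) (gaussian 2 0))) sums coefficient f J
      (gaussian 2 x)"
proof -
  let ?H = "\<lambda>y. hermite_coeff (4 * (x \<bullet> y)) (2 * (norm x)\<^sup>2)"
  let ?G = "gaussian 2 (0 :: 'a pt)"
  define B where "B = exp (2 * (norm x)\<^sup>2)"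
  have mem: "(real_deriv x ^^ m) ?G \<in> gauss_poly 2 0" for m
  proof (induction m)
    case (Suc m)
    thus ?case unfolding funpow.simps comp_apply real_deriv_def[abs_def]
      by (intro gauss_poly_sum gauss_poly.scale gauss_poly_partial)
  qed (simp only: funpow.simps id_apply gauss_poly.gaussian)
  have tm: "(-1) ^ m / fact m * (real_deriv x ^^ m) ?G y = of_real (?H y m) * ?G y" for m y
    unfolding real_deriv_power_gaussian by (simp flip: power_mult_distrib mult.assoc)
  have part: "(\<Sum>m<M. (-1) ^ m / fact m * coefficient f J ((real_deriv x ^^ m) ?G)) =
     (LINT y|lborel. f y J * (of_real (\<Sum>m<M. ?H y m) * ?G y))" for M
  proof -
    have "(\<Sum>m<M. (-1) ^ m / fact m * coefficient f J ((real_deriv x ^^ m) ?G)) = 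
       coefficient f J (\<lambda>y. \<Sum>m<M. (-1) ^ m / fact m * (real_deriv x ^^ m) ?G y)"
      by (rule coefficient_sum_scale[OF f order.refl mem, symmetric])
    thus ?thesis unfolding tm coefficient_def by (simp add: sum_distrib_right)
  qed
  have fm [measurable]: "(\<lambda>y. f y J) \<in> borel_measurable borel"
    using bergman_weighted_L2[OF f] by (auto simp: weighted_L2_def)
  have [measurable]: "(\<lambda>y. ?H y m) \<in> borel_measurable borel" for m
  proof -
    have "continuous_on UNIV (\<lambda>a. hermite_coeff a (2 * (norm x)\<^sup>2) m)"
      by (intro continuous_at_imp_continuous_on ballI DERIV_isCont[OF hermite_coeff_has_derivative])
    hence "(\<lambda>a. hermite_coeff a (2 * (norm x)\<^sup>2) m) \<in> borel_measurable borel"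
      by (rule borel_measurable_continuous_onI)
    moreover have "(\<lambda>y. 4 * (x \<bullet> y)) \<in> borel_measurable borel"
      by (intro borel_measurable_continuous_onI continuous_intros)
    ultimately show ?thesis by (rule measurable_compose[rotated])
  qed
  have dom: "gauss_dominated (\<lambda>y. of_real (B * exp (4 * norm x * norm y)) * ?G y)"
    by (rule gauss_dominated_mult[OF gauss_dominated_shifted_gaussian[OF order.refl], of _ B "4 * norm x"])
      (simp_all add: B_def norm_mult)
  have "(\<lambda>M. LINT y|lborel. f y J * (of_real (\<Sum>m<M. ?H y m) * ?G y)) \<longlonglongrightarrow> (LINT y|lborel. f y J * gaussian 2 x y)"
  proof (rule integral_dominated_convergence)
    show "integrable lborel (\<lambda>y. cmod (f y J * (of_real (B * exp (4 * norm x * norm y)) * ?G y)))"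
      by (intro integrable_norm integrable_weighted_pairing bergman_weighted_L2[OF f] dom)
    show "AE y in lborel. (\<lambda>M. f y J * (of_real (\<Sum>m<M. ?H y m) * ?G y)) \<longlonglongrightarrow> f y J * gaussian 2 x y"
    proof (rule AE_I2)
      fix y
      have "(\<lambda>M. \<Sum>m<M. ?H y m) \<longlonglongrightarrow> exp (4 * (x \<bullet> y) - 2 * (norm x)\<^sup>2)"
        using hermite_coeff_sums unfolding sums_def .
      hence "(\<lambda>M. f y J * (of_real (\<Sum>m<M. ?H y m) * ?G y)) \<longlonglongrightarrow>
          f y J * (of_real (exp (4 * (x \<bullet> y) - 2 * (norm x)\<^sup>2)) * ?G y)"
        by (intro tendsto_intros)
      also have "of_real (exp (4 * (x \<bullet> y) - 2 * (norm x)\<^sup>2)) * ?G y = gaussian 2 x y"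
      proof -
        have "4 * (x \<bullet> y) - 2 * (norm x)\<^sup>2 + (- (2 * (norm (y - 0))\<^sup>2)) = - (2 * (norm (y - x))\<^sup>2)"
          by (simp add: power2_norm_eq_inner inner_diff_left inner_diff_right inner_commute)
        thus ?thesis by (simp only: exp_add[symmetric] of_real_mult[symmetric])
      qed
      finally show "(\<lambda>M. f y J * (of_real (\<Sum>m<M. ?H y m) * ?G y)) \<longlonglongrightarrow> f y J * gaussian 2 x y" .
    qed
    show "AE y in lborel. norm (f y J * (of_real (\<Sum>m<M. ?H y m) * ?G y)) \<le>
        cmod (f y J * (of_real (B * exp (4 * norm x * norm y)) * ?G y))" for M
    proof (rule AE_I2)
      fix y
      have "\<bar>\<Sum>m<M. ?H y m\<bar> \<le> exp (\<bar>4 * (x \<bullet> y)\<bar> + \<bar>2 * (norm x)\<^sup>2\<bar>)"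
        by (rule order.trans[OF sum_abs sum_abs_hermite_coeff_le])
      also have "\<dots> \<le> B * exp (4 * norm x * norm y)"
        using Cauchy_Schwarz_ineq2[of x y] by (simp add: B_def abs_mult flip: exp_add)
      finally have "\<bar>\<Sum>m<M. ?H y m\<bar> \<le> B * exp (4 * norm x * norm y)" .
      moreover have "0 \<le> B" by (simp add: B_def)
      ultimately show "norm (f y J * (of_real (\<Sum>m<M. ?H y m) * ?G y)) \<le>
          cmod (f y J * (of_real (B * exp (4 * norm x * norm y)) * ?G y))"
        unfolding norm_mult norm_of_real by (intro mult_left_mono mult_right_mono) auto
    qed
  qed measurable
  thus ?thesis unfolding sums_def part unfolding coefficient_def .
qed

section \<open>The Gaussian mean value property\<close>

lemma has_vector_derivative_integral:
  fixes h h' :: "real \<Rightarrow> 'a::euclidean_space \<Rightarrow> complex"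
  assumes der: "\<And>s y. s \<in> {a..b} \<Longrightarrow> ((\<lambda>s. h s y) has_vector_derivative h' s y) (at s within {a..b})"
    and bound: "\<And>s y. s \<in> {a..b} \<Longrightarrow> cmod (h' s y) \<le> D y" and D: "integrable lborel D"
    and int: "\<And>s. s \<in> {a..b} \<Longrightarrow> integrable lborel (h s)"
    and meas: "\<And>s. s \<in> {a..b} \<Longrightarrow> h' s \<in> borel_measurable lborel"
    and s: "s \<in> {a..b}"
  shows "((\<lambda>s. LINT y|lborel. h s y) has_vector_derivative (LINT y|lborel. h' s y)) (at s within {a..b})"
proof -
  \<comment> \<open>Difference quotients are the form to which dominated convergence applies.\<close>
  have quotient_iff: "(g has_vector_derivative g') (at s within {a..b}) \<longleftrightarrow>
      ((\<lambda>u. (1 / (u - s)) *\<^sub>R (g u - g s)) \<longlongrightarrow> g') (at s within {a..b})" for g :: "real \<Rightarrow> complex" and g'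
  proof -
    have "norm ((1 / norm (u - s)) *\<^sub>R (g u - (g s + (u - s) *\<^sub>R g'))) =
        norm ((1 / (u - s)) *\<^sub>R (g u - g s) - g')" if "u \<noteq> s" for u
    proof -
      have "(1 / (u - s)) *\<^sub>R (g u - g s) - g' = (1 / (u - s)) *\<^sub>R (g u - (g s + (u - s) *\<^sub>R g'))"
        using that by (simp add: scaleR_diff_right scaleR_add_right)
      thus ?thesis by (simp only: norm_scaleR) simp
    qed
    hence "((\<lambda>u. norm ((1 / norm (u - s)) *\<^sub>R (g u - (g s + (u - s) *\<^sub>R g')))) \<longlongrightarrow> 0) (at s within {a..b}) \<longleftrightarrow>
       ((\<lambda>u. norm ((1 / (u - s)) *\<^sub>R (g u - g s) - g')) \<longlongrightarrow> 0) (at s within {a..b})"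
      by (intro tendsto_cong) (simp add: eventually_at_filter)
    thus ?thesis
      unfolding has_vector_derivative_def has_derivative_within tendsto_norm_zero_iff LIM_zero_iff
      by (simp add: bounded_linear_scaleR_left)
  qed
  define \<Phi> where "\<Phi> s = (LINT y|lborel. h s y)" for s
  have "((\<lambda>u. (1 / (u - s)) *\<^sub>R (\<Phi> u - \<Phi> s)) \<longlongrightarrow> (LINT y|lborel. h' s y)) (at s within {a..b})"
    unfolding tendsto_at_iff_sequentially
    proof (intro allI impI)
      fix X assume X: "\<forall>i. X i \<in> {a..b} - {s}" "X \<longlonglongrightarrow> s"
      have "(\<lambda>i. LINT y|lborel. (1 / (X i - s)) *\<^sub>R (h (X i) y - h s y)) \<longlonglongrightarrow> (LINT y|lborel. h' s y)"
      proof (rule integral_dominated_convergence[OF _ _ D])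
        show "h' s \<in> borel_measurable lborel" by (rule meas[OF s])
        show "(\<lambda>y. (1 / (X i - s)) *\<^sub>R (h (X i) y - h s y)) \<in> borel_measurable lborel" for i
          using int[of "X i"] int[OF s] X(1) by (intro borel_measurable_scaleR borel_measurable_diff) auto
        show "AE y in lborel. (\<lambda>i. (1 / (X i - s)) *\<^sub>R (h (X i) y - h s y)) \<longlonglongrightarrow> h' s y"
        proof (rule AE_I2)
          fix y
          have "((\<lambda>u. (1 / (u - s)) *\<^sub>R (h u y - h s y)) \<longlongrightarrow> h' s y) (at s within {a..b})"
            using der[OF s, of y] by (simp only: quotient_iff)
          thus "(\<lambda>i. (1 / (X i - s)) *\<^sub>R (h (X i) y - h s y)) \<longlonglongrightarrow> h' s y"
            unfolding tendsto_at_iff_sequentially using X by (auto simp: comp_def)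
        qed
        show "AE y in lborel. norm ((1 / (X i - s)) *\<^sub>R (h (X i) y - h s y)) \<le> D y" for i
        proof (rule AE_I2)
          fix y
          have "norm (h (X i) y - h s y) \<le> D y * norm (X i - s)"
          proof (rule differentiable_bound[of "{a..b}" "\<lambda>u. h u y" "\<lambda>u d. d *\<^sub>R h' u y"])
            fix u assume u: "u \<in> {a..b}"
            show "((\<lambda>u. h u y) has_derivative (\<lambda>d. d *\<^sub>R h' u y)) (at u within {a..b})"
              using der[OF u] by (simp add: has_vector_derivative_def)
            show "onorm (\<lambda>d. d *\<^sub>R h' u y) \<le> D y"
            proof (rule onorm_le)
              fix d :: real
              show "norm (d *\<^sub>R h' u y) \<le> D y * norm d"
                using mult_right_mono[OF bound[OF u, of y], of "norm d"] by (simp add: mult.commute)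
            qed
          qed (use X(1) s in auto)
          moreover have "X i - s \<noteq> 0" using X(1) by auto
          ultimately show "norm ((1 / (X i - s)) *\<^sub>R (h (X i) y - h s y)) \<le> D y"
            unfolding norm_scaleR by (simp add: field_simps)
        qed
      qed
      moreover have "(LINT y|lborel. (1 / (X i - s)) *\<^sub>R (h (X i) y - h s y)) =
          (1 / (X i - s)) *\<^sub>R (\<Phi> (X i) - \<Phi> s)" for i
        unfolding \<Phi>_def using int[of "X i"] int[OF s] X(1) by (simp add: Bochner_Integration.integral_diff)
      ultimately show "((\<lambda>u. (1 / (u - s)) *\<^sub>R (\<Phi> u - \<Phi> s)) \<circ> X) \<longlonglongrightarrow> (LINT y|lborel. h' s y)"
        by (simp only: comp_def)
    qed
  thus ?thesis unfolding \<Phi>_def by (simp only: quotient_iff)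
qed

definition laplacian :: "('n::finite pt \<Rightarrow> complex) \<Rightarrow> 'n pt \<Rightarrow> complex" where
  "laplacian u y = (\<Sum>l\<in>UNIV. \<Sum>j\<in>UNIV. partial l j (partial l j u) y)"

text \<open>
  In each quaternionic block the Laplacian is the determinant of the \<open>2 \<times> 2\<close> matrix of the fields \<open>Z\<close>.
\<close>

lemma laplacian_Z_low:
  assumes "u \<in> gauss_poly s x"
  shows "laplacian u y = (\<Sum>l\<in>UNIV. Z_low (l, 0) 0 (Z_low (l, 1) 1 u) y - Z_low (l, 0) 1 (Z_low (l, 1) 0 u) y)"
proof -
  have p: "partial l j u \<in> gauss_poly s x" for l j by (rule gauss_poly_partial[OF assms])
  have *: "partial l j (\<lambda>y. partial l' i u y + c * partial l' i' u y) =
      (\<lambda>y. partial l j (partial l' i u) y + c * partial l j (partial l' i' u) y)" for l j l' i c i'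
    by (simp only: partial_gauss_poly_add[OF p gauss_poly.scale[OF p]] partial_gauss_poly_scale[OF p])
  have Z: "Z_low (l, 1) 1 u = (\<lambda>y. partial l 1 u y + (- \<i>) * partial l 2 u y)"
    "Z_low (l, 1) 0 u = (\<lambda>y. partial l 3 u y + (- \<i>) * partial l 4 u y)" for l
    by (simp_all add: fun_eq_iff Z_low_cases)
  have "Z_low (l, 0) 0 (Z_low (l, 1) 1 u) y - Z_low (l, 0) 1 (Z_low (l, 1) 0 u) y =
      (\<Sum>j\<in>UNIV. partial l j (partial l j u) y)" for l
    unfolding Z_low_cases(1,2) unfolding Z * sum_4
    using partial_commute[OF assms, of l 1 l 2] partial_commute[OF assms, of l 3 l 4]
        by (simp add: algebra_simps)
  thus ?thesis by (simp add: laplacian_def)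
qed

text \<open>
  Weak harmonicity of each component: the two terms of the determinant differ by exchanging the primed indices of the two
  derivatives, which two applications of \<open>bergman_exchange\<close> permit.
\<close>

lemma coefficient_laplacian:
  assumes f: "f \<in> bergman_space k sq_norm" and k: "k \<ge> 1" and J: "length J = k"
    and u: "u \<in> gauss_poly s x" and s: "s \<ge> 2"
  shows "coefficient f J (laplacian u) = 0"
proof -
  obtain b I where JI: "J = b # I" and I: "length I = k - 1" using J k by (cases J) auto
  have ex: "coefficient f (0 # I) (Z_low A 1 v) = coefficient f (1 # I) (Z_low A 0 v)"
      if "v \<in> gauss_poly s x" for v A
    unfolding coefficient_def by (rule bergman_exchange[OF f I that s])
  have Z: "Z_low A b u \<in> gauss_poly s x" "Z_low A b (Z_low A' b' u) \<in> gauss_poly s x" for A b A' b'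
    by (intro gauss_poly_Z_low u)+
  have block: "coefficient f J (Z_low A 0 (Z_low B 1 u)) = coefficient f J (Z_low A 1 (Z_low B 0 u))" for A B
    using cases_2_01[of b]
  proof
    assume "b = 0"
    thus ?thesis unfolding JI
      by (simp only: Z_low_commute[OF u, of A 0 B 1] ex[OF Z(1)] Z_low_commute[OF u, of A 0 B 0])
  next
    assume "b = 1"
    thus ?thesis unfolding JI
      by (simp only: Z_low_commute[OF u, of A 1 B 0] ex[OF Z(1), symmetric] Z_low_commute[OF u, of A 1 B 1])
  qed
  have "coefficient f J (laplacian u) = coefficient f J (\<lambda>y. \<Sum>p\<in>UNIV \<times> {True, False}. (if snd p then 1 else
      -1) *
      (\<lambda>p. if snd p then Z_low (fst p, 0) 0 (Z_low (fst p, 1) 1 u) else Z_low (fst p, 0) 1 (Z_low (fst p, 1)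
          0 u)) p y)"
    by (simp add: laplacian_Z_low[OF u, abs_def] sum.cartesian_product' sum_subtractf)
  also have "\<dots> = (\<Sum>p\<in>UNIV \<times> {True, False}. (if snd p then 1 else -1) *
      coefficient f J ((\<lambda>p. if snd p then Z_low (fst p, 0) 0 (Z_low (fst p, 1) 1 u) else Z_low (fst p, 0) 1
          (Z_low (fst p, 1) 0 u)) p))"
    by (rule coefficient_sum_scale[OF f s, of _ _ x]) (auto intro: Z)
  also have "\<dots> = 0"
    by (simp add: sum.cartesian_product' block)
  finally show ?thesis .
qed

lemma norm_sq_pt: "(norm (x :: 'n::finite pt))\<^sup>2 = (\<Sum>l\<in>UNIV. \<Sum>j\<in>UNIV. (x $ l $ j)\<^sup>2)"
  unfolding power2_norm_eq_inner inner_vec_def by (simp add: power2_eq_square)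

lemma laplacian_gaussian:
  "laplacian (gaussian s x) y = of_real (4 * s\<^sup>2 * (norm (y - x))\<^sup>2 -
      8 * s * CARD('n)) * gaussian s (x :: 'n::finite pt) y"
proof -
  have *: "partial l j (\<lambda>y. c * (of_real (y $ l $ j) * gaussian s x y) + d * gaussian s x y) y =
    c * (gaussian s x y + of_real (y $ l $ j) * partial l j (gaussian s x) y) +
        d * partial l j (gaussian s x) y" for c d l j y
    by (simp only: partial_gauss_poly_coordinate[of _ s x] partial_gauss_poly_add[of _ s x]
        partial_gauss_poly_scale[of _ s x]
        gauss_poly.scale gauss_poly.coordinate gauss_poly.gaussian simp_thms if_True mult_1)
  have "partial l j (partial l j (gaussian s x)) y =
      of_real (4 * s\<^sup>2 * ((y - x) $ l $ j)\<^sup>2 - 2 * s) * gaussian s x y" for l j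
    unfolding partial_gaussian_fun * by (simp add: algebra_simps power2_eq_square)
  hence "laplacian (gaussian s x) y = of_real (\<Sum>l\<in>(UNIV::'n set). \<Sum>j\<in>(UNIV :: 4 set). 4 * s\<^sup>2 * ((y -
      x) $ l $ j)\<^sup>2 - 2 * s) * gaussian s x y"
    by (simp only: laplacian_def sum_distrib_right of_real_sum)
  also have "(\<Sum>l\<in>(UNIV::'n set). \<Sum>j\<in>(UNIV :: 4 set). 4 * s\<^sup>2 * ((y - x) $ l $ j)\<^sup>2 - 2 * s) =
      4 * s\<^sup>2 * (norm (y - x))\<^sup>2 - 8 * s * CARD('n)"
    by (simp add: norm_sq_pt sum_subtractf sum_distrib_left)
  finally show ?thesis .
qed

lemma gauss_poly_norm_sq:
  assumes "u \<in> gauss_poly s x" shows "(\<lambda>y. of_real ((norm (y - x))\<^sup>2) * u y) \<in> gauss_poly s x"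
proof -
  have "(\<lambda>y. of_real (((y - x) $ l $ j)\<^sup>2) * u y) \<in> gauss_poly s x" for l j
  proof -
    have 1: "(\<lambda>y. of_real (y $ l $ j) * v y + (- of_real (x $ l $ j)) * v y) \<in> gauss_poly s x"
        if "v \<in> gauss_poly s x" for v
      by (intro gauss_poly.add gauss_poly.scale gauss_poly.coordinate that)
    show ?thesis using 1[OF 1[OF assms]] by (simp add: power2_eq_square algebra_simps)
  qed
  thus ?thesis unfolding norm_sq_pt of_real_sum sum_distrib_right
    by (intro gauss_poly_sum) 
qed

text \<open>
  The normalised Gaussians \<open>s\<^sup>2\<^sup>n exp (- s |y - x|\<^sup>2)\<close> solve the heat equation in the variable \<open>1 / (4 s)\<close>, hence their
  \<open>s\<close>-derivative is a multiple of their Laplacian and their pairing with a weakly harmonic function is constant.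
\<close>

lemma coefficient_gaussian_scale:
  fixes f :: "'n::finite pt \<Rightarrow> tuple"
  assumes f: "f \<in> bergman_space k sq_norm" and k: "k \<ge> 1" and J: "length J = k" and s: "s \<ge> 2"
  shows "of_real (s ^ (2 * CARD('n))) * coefficient f J (gaussian s x) =
      of_real (2 ^ (2 * CARD('n))) * coefficient f J (gaussian 2 x)"
proof -
  let ?r = "\<lambda>y. (norm (y - x))\<^sup>2"
  define d where "d = 2 * CARD('n)"
  have d: "d > 0" by (simp add: d_def)
  define h where "h s y = f y J * of_real (s ^ d * exp (- (s * ?r y)))" for s y
  define h' where "h' s y = f y J * of_real ((real d * s ^ (d - 1) -
      s ^ d * ?r y) * exp (- (s * ?r y)))" for s y
  define D where "D y = cmod (f y J * (of_real (real d * s ^ (d - 1)) * gaussian 2 x y +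
      of_real (s ^ d) * (of_real (?r y) * gaussian 2 x y)))" for y
  have mem: "(\<lambda>y. c1 * gaussian t x y + c2 * (of_real (?r y) * gaussian t x y)) \<in> gauss_poly t x" for c1 c2 t
    by (intro gauss_poly.add gauss_poly.scale gauss_poly_norm_sq gauss_poly.gaussian)
  have h'_eq: "h' t y = of_real (- (t ^ d / (4 * t\<^sup>2))) * (f y J * laplacian (gaussian t x) y)"
      if "t \<ge> 2" for t y
  proof -
    have "t ^ d = t ^ (d - 1) * t" using d by (simp flip: power_Suc2)
    hence "real d * t ^ (d - 1) - t ^ d * ?r y = - (t ^ d / (4 * t\<^sup>2)) * (4 * t\<^sup>2 * ?r y - 8 * t * CARD('n))"
      using that by (simp add: d_def field_simps power2_eq_square)
    thus ?thesis unfolding h'_def laplacian_gaussian by (simp only: of_real_mult mult_ac)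
  qed
  have deriv: "((\<lambda>t. LINT y|lborel. h t y) has_vector_derivative (LINT y|lborel. h' t y)) (at t within
      {2..s})" if "t \<in> {2..s}" for t
  proof (rule has_vector_derivative_integral[of 2 s h h' D])
    fix t y assume t: "t \<in> {2..s}"
    have "((\<lambda>t. t ^ d * exp (- (t * r))) has_real_derivative ((real d * t ^ (d - 1) -
        t ^ d * r) * exp (- (t * r)))) (at t within {2..s})" for r
      by (auto intro!: derivative_eq_intros simp: algebra_simps)
    hence "((\<lambda>t. t ^ d * exp (- (t * ?r y))) has_vector_derivative ((real d * t ^ (d - 1) -
        t ^ d * ?r y) * exp (- (t * ?r y)))) (at t within {2..s})"
      by (simp add: has_real_derivative_iff_has_vector_derivative)
    from bounded_linear.has_vector_derivative[OF bounded_linear_compose[OF bounded_linear_mult_right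
        bounded_linear_of_real] this, of "f y J"]
    show "((\<lambda>t. h t y) has_vector_derivative h' t y) (at t within {2..s})"
      unfolding h_def h'_def .
    have "\<bar>(real d * t ^ (d - 1) - t ^ d * ?r y) * exp (- (t * ?r y))\<bar> \<le>
       (real d * s ^ (d - 1) + s ^ d * ?r y) * exp (- (2 * ?r y))"
      unfolding abs_mult
    proof (intro mult_mono)
      have "\<bar>real d * t ^ (d - 1) - t ^ d * ?r y\<bar> \<le> real d * t ^ (d - 1) + t ^ d * ?r y"
        using t by (intro order.trans[OF abs_triangle_ineq4]) auto
      also have "\<dots> \<le> real d * s ^ (d - 1) + s ^ d * ?r y"
        using t by (intro add_mono mult_left_mono mult_right_mono power_mono) auto
      finally show "\<bar>real d * t ^ (d - 1) - t ^ d * ?r y\<bar> \<le> real d * s ^ (d - 1) + s ^ d * ?r y" .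
      show "\<bar>exp (- (t * ?r y))\<bar> \<le> exp (- (2 * ?r y))"
        using t by (auto intro: mult_right_mono)
    qed (use s in auto)
    hence "cmod (h' t y) \<le> cmod (f y J) * ((real d * s ^ (d - 1) + s ^ d * ?r y) * exp (- (2 * ?r y)))"
      unfolding h'_def norm_mult[of "f y J"] norm_of_real by (intro mult_left_mono) auto
    also have "\<dots> = cmod (f y J) * cmod (of_real ((real d * s ^ (d - 1) + s ^ d * ?r y) * exp (- (2 * ?r y))))"
      unfolding norm_of_real using s by (subst abs_of_nonneg) auto
    also have "\<dots> = D y"
      unfolding D_def norm_mult[of "f y J"] by (simp add: algebra_simps)
    finally show "cmod (h' t y) \<le> D y" .
  next
    show "integrable lborel D" unfolding D_def
      by (intro integrable_norm integrable_coefficient[OF f mem order.refl])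
  next
    fix t assume t: "t \<in> {2..s}"
    have "integrable lborel (\<lambda>y. of_real (t ^ d) * (f y J * gaussian t x y))"
      using t by (intro integrable_mult_right integrable_coefficient[OF f gauss_poly.gaussian]) auto
    thus "integrable lborel (h t)" unfolding h_def[abs_def] by (simp add: mult_ac)
    have lap: "laplacian (gaussian t x) \<in> gauss_poly t x"
      unfolding laplacian_def[abs_def] by (intro gauss_poly_sum gauss_poly_partial gauss_poly.gaussian)
    have h'': "h' t = (\<lambda>y. of_real (- (t ^ d / (4 * t\<^sup>2))) * (f y J * laplacian (gaussian t x) y))"
      using h'_eq t by auto
    have "integrable lborel (\<lambda>y. f y J * laplacian (gaussian t x) y)"
      using t by (intro integrable_coefficient[OF f lap]) auto
    hence "integrable lborel (h' t)" unfolding h'' by (rule integrable_mult_right)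
    thus "h' t \<in> borel_measurable lborel" by (rule borel_measurable_integrable)
  qed (use that in auto)
  have zero: "(LINT y|lborel. h' t y) = 0" if t: "t \<in> {2..s}" for t
  proof -
    have h'': "h' t = (\<lambda>y. of_real (- (t ^ d / (4 * t\<^sup>2))) * (f y J * laplacian (gaussian t x) y))"
      using h'_eq t by auto
    show ?thesis
      unfolding h'' integral_mult_right_zero
      using coefficient_laplacian[OF f k J gauss_poly.gaussian, of t x] t by (simp add: coefficient_def)
  qed
  obtain c where "\<And>t. t \<in> {2..s} \<Longrightarrow> (LINT y|lborel. h t y) = c"
    using has_vector_derivative_zero_constant[of "{2..s}" "\<lambda>t. LINT y|lborel. h t y"] deriv zero by auto
  hence "(LINT y|lborel. h s y) = (LINT y|lborel. h 2 y)" using s by auto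
  moreover have "(LINT y|lborel. h t y) = of_real (t ^ d) * coefficient f J (gaussian t x)" for t
  proof -
    have "h t = (\<lambda>y. of_real (t ^ d) * (f y J * gaussian t x y))"
      unfolding h_def of_real_mult by (simp only: mult_ac)
    thus ?thesis unfolding coefficient_def by (simp only: integral_mult_right_zero)
  qed
  ultimately show ?thesis unfolding d_def by simp
qed

definition gauss_mass :: "'n::finite itself \<Rightarrow> real" where
  "gauss_mass _ = (LINT y|lborel. exp (- (2 * (norm (y :: 'n pt))\<^sup>2)))"

lemma gauss_mass_pos: "gauss_mass TYPE('n::finite) > 0"
proof -
  have "0 \<le> gauss_mass TYPE('n)" unfolding gauss_mass_def by simp
  moreover have "gauss_mass TYPE('n) \<noteq> 0"
  proof
    assume "gauss_mass TYPE('n) = 0"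
    hence "AE y in lborel. exp (- (2 * (norm (y :: 'n pt))\<^sup>2)) = 0"
      unfolding gauss_mass_def
      using integral_nonneg_eq_0_iff_AE[OF integrable_gauss[of 2, where 'a="'n pt"]] by simp
    hence "ae_filter (lborel :: 'n pt measure) = bot" by (simp add: eventually_False)
    thus False unfolding ae_filter_eq_bot_iff by simp
  qed
  ultimately show ?thesis by linarith
qed

lemma gauss_integral_scale:
  assumes "s > 0"
  shows "s ^ (2 * CARD('n)) * (LINT y|lborel. exp (- (s * (norm (y - x :: 'n::finite pt))\<^sup>2))) =
      2 ^ (2 * CARD('n)) * gauss_mass TYPE('n)"
proof -
  \<comment> \<open>The scaling \<open>y \<mapsto> c (y - x)\<close> turns the exponent \<open>2 |y|\<^sup>2\<close> into \<open>s |y - x|\<^sup>2\<close>.\<close>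
  define c where "c = sqrt (s / 2)"
  have c: "c > 0" "c\<^sup>2 = s / 2" using assms by (auto simp: c_def)
  have dim: "DIM('n pt) = 2 * (2 * CARD('n))" by simp
  have "gauss_mass TYPE('n) = (LINT y|density (distr lborel borel (\<lambda>y. (- c *\<^sub>R x) +
      c *\<^sub>R y)) (\<lambda>_. ennreal (\<bar>c\<bar> ^ DIM('n pt))). exp (- (2 * (norm (y :: 'n pt))\<^sup>2)))"
    unfolding gauss_mass_def using c by (subst lborel_affine[of c "- c *\<^sub>R x"]) auto
  also have "\<dots> = (LINT y|lborel. c ^ DIM('n pt) * exp (- (2 * (norm (- c *\<^sub>R x + c *\<^sub>R y))\<^sup>2)))"
    using c by (subst integral_density) (auto simp: integral_distr)
  also have "\<dots> = (LINT y|lborel. (s / 2) ^ (2 * CARD('n)) * exp (- (s * (norm (y - x))\<^sup>2)))"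
  proof -
    have n: "2 * (norm (- c *\<^sub>R x + c *\<^sub>R y))\<^sup>2 = s * (norm (y - x))\<^sup>2" for y
    proof -
      have "- c *\<^sub>R x + c *\<^sub>R y = c *\<^sub>R (y - x)" by (simp add: algebra_simps)
      thus ?thesis by (simp only: norm_scaleR power_mult_distrib) (simp add: c)
    qed
    have cp: "c ^ DIM('n pt) = (s / 2) ^ (2 * CARD('n))"
      unfolding dim power_mult[of c 2 "2 * CARD('n)"] c ..
    show ?thesis by (simp only: n cp)
  qed
  finally show ?thesis using assms by (simp add: power_divide field_simps)
qed

lemma power_exp_tendsto_0:
  assumes "c > 0" shows "(\<lambda>n::nat. real n ^ d * exp (- (real n * c))) \<longlonglongrightarrow> 0"
proof -
  have "filterlim (\<lambda>n. real n * c) at_top sequentially"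
    using assms by (intro filterlim_at_top_mult_tendsto_pos[OF tendsto_const _ filterlim_real_sequentially,
        where ?c = c] | simp add: mult.commute)+
  from filterlim_compose[OF tendsto_power_div_exp_0[of d] this]
  have "(\<lambda>n. (1 / c ^ d) * ((real n * c) ^ d / exp (real n * c))) \<longlonglongrightarrow> (1 / c ^ d) * 0"
    by (intro tendsto_mult tendsto_const)
  thus ?thesis using assms by (simp add: power_mult_distrib exp_minus divide_inverse mult_ac)
qed

text \<open>
  By \<open>coefficient_gaussian_scale\<close> the Gaussian may be replaced by arbitrarily concentrated ones, which recover
  the value at \<open>x\<close> by continuity.
\<close>

lemma gaussian_mean_value:
  fixes f :: "'n::finite pt \<Rightarrow> tuple"
  assumes f: "f \<in> bergman_space k sq_norm" and k: "k \<ge> 1" and J: "length J = k"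
    and cont: "continuous_on UNIV (\<lambda>y. f y J)"
  shows "coefficient f J (gaussian 2 x) = of_real (gauss_mass TYPE('n)) * f x J"
proof -
  let ?e = "\<lambda>s y. exp (- (s * (norm (y - x))\<^sup>2))"
  define d where "d = 2 * CARD('n)"
  define \<gamma> where "\<gamma> = gauss_mass TYPE('n)"
  define E where "E = coefficient f J (gaussian 2 x) - of_real \<gamma> * f x J"
  define g where "g y = f y J - f x J" for y
  have int_gauss: "integrable lborel (\<lambda>y. ?e s y)" if "s \<ge> 2" for s
  proof -
    have "weighted_L2 (\<lambda>y::'n pt. 1)"
      using integrable_gauss[of 2, where 'a="'n pt"] by (simp add: weighted_L2_def)
    from integrable_weighted_pairing[OF this gauss_dominated_shifted_gaussian[OF that]]
    show ?thesis by (simp only: mult_1 complex_of_real_integrable_eq)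
  qed
  have int_f: "integrable lborel (\<lambda>y. f y J * gaussian s x y)" if "s \<ge> 2" for s
    by (rule integrable_coefficient[OF f gauss_poly.gaussian that])
  have int_g: "integrable lborel (\<lambda>y. g y * gaussian s x y)" if "s \<ge> 2" for s
    unfolding g_def left_diff_distrib using int_gauss[OF that] int_f[OF that]
    by (intro Bochner_Integration.integrable_diff integrable_mult_right integrable_of_real) auto
  have E_eq: "of_real (2 ^ d) * E = of_real (s ^ d) * (LINT y|lborel. g y * gaussian s x y)" if "s \<ge> 2" for s
  proof -
    have eq: "(LINT y|lborel. g y * gaussian s x y) =
        coefficient f J (gaussian s x) - f x J * of_real (LINT y|lborel. ?e s y)"
      unfolding g_def left_diff_distrib coefficient_def using int_gauss[OF that] int_f[OF that]
      by (subst Bochner_Integration.integral_diff) (auto simp del: of_real_exp intro!: integrable_mult_right)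
    have "of_real (s ^ d) * (LINT y|lborel. g y * gaussian s x y) =
        of_real (s ^ d) * coefficient f J (gaussian s x) - f x J * of_real (s ^ d * (LINT y|lborel. ?e s y))"
      unfolding eq of_real_mult by (simp only: right_diff_distrib mult_ac)
    also have "\<dots> = of_real (2 ^ d) * E"
      using coefficient_gaussian_scale[OF f k J that, of x] gauss_integral_scale[of s x] that
      unfolding E_def \<gamma>_def d_def by (simp add: algebra_simps)
    finally show ?thesis ..
  qed
  have "2 ^ d * cmod E \<le> e * (2 ^ d * \<gamma>)" if e: "e > 0" for e
  proof -
    from cont have "isCont (\<lambda>y. f y J) x" by (simp add: continuous_on_eq_continuous_at)
    then obtain \<delta> where \<delta>: "\<delta> > 0" and close: "\<And>y. norm (y - x) < \<delta> \<Longrightarrow> cmod (g y) \<le> e"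
      using e unfolding continuous_at_eps_delta g_def dist_norm by (metis less_imp_le)
    define W where "W = (LINT y|lborel. cmod (g y * gaussian 2 x y))"
    have est: "2 ^ d * cmod E \<le> e * (2 ^ d * \<gamma>) + (exp (2 * \<delta>\<^sup>2) * W) * (real N ^ d * exp (- (real N *
        \<delta>\<^sup>2)))" if N: "N \<ge> 2" for N :: nat
    proof -
      have N2: "real N \<ge> 2" using N by simp
      have "cmod (g y * gaussian N x y) \<le> e * ?e (real N) y + exp (- ((real N -
          2) * \<delta>\<^sup>2)) * cmod (g y * gaussian 2 x y)" for y
      proof (cases "norm (y - x) < \<delta>")
        case True
        \<comment> \<open>Near \<open>x\<close> use continuity; away from \<open>x\<close> compare with the Gaussian with exponent \<open>2\<close>, which pairs with \<open>f\<close>.\<close>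
        have "cmod (g y * gaussian N x y) \<le> e * ?e (real N) y"
          unfolding norm_mult norm_of_real using close[OF True] by (simp add: mult_right_mono)
        thus ?thesis by (rule order.trans) simp
      next
        case False
        hence "\<delta>\<^sup>2 \<le> (norm (y - x))\<^sup>2" using \<delta> by (intro power_mono) auto
        hence "(real N - 2) * \<delta>\<^sup>2 \<le> (real N - 2) * (norm (y - x))\<^sup>2" using N2 by (intro mult_left_mono) auto
        hence "?e (real N) y \<le> exp (- ((real N - 2) * \<delta>\<^sup>2)) * ?e 2 y"
          unfolding exp_add[symmetric] by (simp add: algebra_simps)
        hence "cmod (g y) * ?e (real N) y \<le> cmod (g y) * (exp (- ((real N - 2) * \<delta>\<^sup>2)) * ?e 2 y)"
          by (intro mult_left_mono) auto
        hence "cmod (g y * gaussian N x y) \<le> exp (- ((real N - 2) * \<delta>\<^sup>2)) * cmod (g y * gaussian 2 x y)"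
          unfolding norm_mult norm_of_real abs_exp_cancel by (simp only: mult_ac)
        thus ?thesis by (rule order.trans) (use e in simp)
      qed
      hence "cmod (LINT y|lborel. g y * gaussian N x y) \<le>
          (LINT y|lborel. e * ?e (real N) y + exp (- ((real N - 2) * \<delta>\<^sup>2)) * cmod (g y * gaussian 2 x y))"
        using int_gauss[OF N2] int_g[OF order.refl] int_g[OF N2]
        by (intro order.trans[OF integral_norm_bound] integral_mono Bochner_Integration.integrable_add
            integrable_mult_right integrable_norm) auto
      also have "\<dots> = e * (LINT y|lborel. ?e (real N) y) + exp (- ((real N - 2) * \<delta>\<^sup>2)) * W"
        unfolding W_def using int_gauss[OF N2] int_g[OF order.refl]
        by (subst Bochner_Integration.integral_add) (auto intro!: integrable_mult_right integrable_norm)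
      finally have "real N ^ d * cmod (LINT y|lborel. g y * gaussian N x y) \<le>
          real N ^ d * (e * (LINT y|lborel. ?e (real N) y) + exp (- ((real N - 2) * \<delta>\<^sup>2)) * W)"
        by (intro mult_left_mono) auto
      also have "\<dots> = e * (real N ^ d * (LINT y|lborel. ?e (real N) y)) + real N ^ d * exp (- ((real N -
          2) * \<delta>\<^sup>2)) * W"
        by (simp add: algebra_simps)
      also have "real N ^ d * (LINT y|lborel. ?e (real N) y) = 2 ^ d * \<gamma>"
        unfolding d_def \<gamma>_def by (rule gauss_integral_scale) (use N in simp)
      also have "exp (- ((real N - 2) * \<delta>\<^sup>2)) = exp (2 * \<delta>\<^sup>2) * exp (- (real N * \<delta>\<^sup>2))"
        by (simp add: algebra_simps flip: exp_add)
      also have "real N ^ d * cmod (LINT y|lborel. g y * gaussian N x y) = cmod (of_real (2 ^ d) * E)"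
        unfolding E_eq[OF N2] by (simp add: norm_mult norm_power)
      also have "\<dots> = 2 ^ d * cmod E" by (simp add: norm_mult norm_power)
      finally show ?thesis by (simp add: mult_ac)
    qed
    have lim: "(\<lambda>N. e * (2 ^ d * \<gamma>) + (exp (2 * \<delta>\<^sup>2) * W) * (real N ^ d * exp (- (real N * \<delta>\<^sup>2)))) \<longlonglongrightarrow>
        e * (2 ^ d * \<gamma>) + (exp (2 * \<delta>\<^sup>2) * W) * 0"
      by (intro tendsto_intros power_exp_tendsto_0) (use \<delta> in simp)
    have "2 ^ d * cmod E \<le> e * (2 ^ d * \<gamma>) + (exp (2 * \<delta>\<^sup>2) * W) * 0"
      by (rule LIMSEQ_le_const[OF lim]) (use est in blast)
    thus ?thesis by (simp only: mult_zero_right add_0_right)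
  qed
  hence "2 ^ d * cmod E \<le> 0"
    using gauss_mass_pos[where 'n='n] field_le_epsilon[of "2 ^ d * cmod E" 0]
    by (metis \<gamma>_def add_0 divide_pos_pos less_imp_neq mult_pos_pos nonzero_eq_divide_eq zero_less_numeral
        zero_less_power)
  hence "E = 0"
    by (metis mult_pos_pos not_le zero_less_norm_iff zero_less_numeral zero_less_power)
  thus ?thesis by (simp add: E_def \<gamma>_def)
qed

section \<open>Size of the explicit kernel\<close>

lemma monomial_cong_mset: "mset I = mset J \<Longrightarrow> monomial \<theta> I = monomial \<theta> J"
  unfolding monomial_def by (metis mset_map prod_mset_prod_list)

lemma Re_cnj_spinor_block:
  fixes a b :: complex
  assumes "(cmod a)\<^sup>2 + (cmod b)\<^sup>2 = 1"
  shows "Re (cnj (a * null_coord x (l, 0) 0 + b * null_coord x (l, 0) 1) * (a * null_coord y (l, 0) 0 +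
      b * null_coord y (l, 0) 1)
     + cnj (a * null_coord x (l, 1) 0 + b * null_coord x (l, 1) 1) * (a * null_coord y (l, 1) 0 +
         b * null_coord y (l, 1) 1))
    = (\<Sum>j\<in>UNIV. x $ l $ j * y $ l $ j)"
proof -
  have "Re (cnj (a * null_coord x (l, 0) 0 + b * null_coord x (l, 0) 1) * (a * null_coord y (l, 0) 0 +
      b * null_coord y (l, 0) 1)
     + cnj (a * null_coord x (l, 1) 0 + b * null_coord x (l, 1) 1) * (a * null_coord y (l, 1) 0 +
         b * null_coord y (l, 1) 1))
    = ((cmod a)\<^sup>2 + (cmod b)\<^sup>2) * (x $ l $ 1 * y $ l $ 1 + x $ l $ 2 * y $ l $ 2 + x $ l $ 3 * y $ l $ 3 +
        x $ l $ 4 * y $ l $ 4)"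
    unfolding cmod_power2 by (simp add: algebra_simps power2_eq_square)
  thus ?thesis unfolding assms sum_4 by simp
qed

text \<open>
  A Hermitian form whose real part is the Euclidean inner product, whatever the complex structure.
\<close>

lemma Re_pairing:
  assumes "(cmod (\<theta> 0))\<^sup>2 + (cmod (\<theta> 1))\<^sup>2 = 1"
  shows "Re (pairing \<theta> x y) = 2 * (x \<bullet> y)"
proof -
  have "Re (pairing \<theta> x y) = 2 * Re (\<Sum>l\<in>UNIV. cnj (spinor_coord \<theta> x (l, 0)) * spinor_coord \<theta> y (l, 0) +
      cnj (spinor_coord \<theta> x (l, 1)) * spinor_coord \<theta> y (l, 1))"
    unfolding pairing_def sum_UNIV_unprimed by simp
  also have "\<dots> = 2 * (\<Sum>l\<in>UNIV. \<Sum>j\<in>UNIV. x $ l $ j * y $ l $ j)"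
    unfolding spinor_coord_def sum_UNIV_2 Re_sum Re_cnj_spinor_block[OF assms] ..
  finally show ?thesis by (simp add: inner_vec_def)
qed

lemma sum_norm_spinor_coord:
  assumes "(cmod (\<theta> 0))\<^sup>2 + (cmod (\<theta> 1))\<^sup>2 = 1"
  shows "(\<Sum>A\<in>UNIV. (cmod (spinor_coord \<theta> x A))\<^sup>2) = (norm x)\<^sup>2"
proof -
  have "pairing \<theta> x x = of_real (2 * (\<Sum>A\<in>UNIV. (cmod (spinor_coord \<theta> x A))\<^sup>2))"
    unfolding pairing_def of_real_mult of_real_sum complex_norm_square by (simp add: mult.commute)
  hence "Re (pairing \<theta> x x) = 2 * (\<Sum>A\<in>UNIV. (cmod (spinor_coord \<theta> x A))\<^sup>2)"
    by (simp only: Re_complex_of_real)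
  thus ?thesis using Re_pairing[OF assms, of x x] by (simp add: power2_norm_eq_inner)
qed

lemma norm_pairing:
  assumes "(cmod (\<theta> 0))\<^sup>2 + (cmod (\<theta> 1))\<^sup>2 = 1"
  shows "cmod (pairing \<theta> x y) \<le> 2 * norm x * norm y"
proof -
  have "cmod (pairing \<theta> x y) \<le> 2 * (\<Sum>A\<in>UNIV. cmod (spinor_coord \<theta> x A) * cmod (spinor_coord \<theta> y A))"
    unfolding pairing_def norm_mult by (intro mult_mono order.trans[OF norm_sum]) (auto simp: norm_mult)
  also have "\<dots> \<le> 2 * (L2_set (\<lambda>A. cmod (spinor_coord \<theta> x A)) UNIV *
      L2_set (\<lambda>A. cmod (spinor_coord \<theta> y A)) UNIV)"
    using L2_set_mult_ineq[of "\<lambda>A. cmod (spinor_coord \<theta> x A)" "\<lambda>A. cmod (spinor_coord \<theta> y A)" UNIV] by simp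
  also have "\<dots> = 2 * norm x * norm y"
    unfolding L2_set_def sum_norm_spinor_coord[OF assms] by simp
  finally show ?thesis .
qed

text \<open>
  The factor \<open>m + k + 1\<close> in the Taylor coefficients (\<open>profile_sums\<close>) is the dimension of \<open>\<odot>\<^sup>m\<^sup>+\<^sup>k \<complex>\<^sup>2\<close>, the inverse of
  the factor in \<open>sphere_coefficient_identity\<close>.
\<close>

definition profile :: "nat \<Rightarrow> complex \<Rightarrow> complex" where
  "profile k t = (t + of_nat (k + 1)) * exp t"

lemma norm_profile: "cmod (profile k t) \<le> (cmod t + real (k + 1)) * exp (Re t)"
  unfolding profile_def norm_mult norm_exp_eq_Re
  by (intro mult_right_mono order.trans[OF norm_triangle_ineq]) (simp_all del: of_nat_add of_nat_Suc)

lemma profile_sums: "(\<lambda>m. of_nat (m + k + 1) / fact m * t ^ m) sums profile k t"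
proof -
  have e: "(\<lambda>m. t ^ m / fact m) sums exp t"
    using exp_converges[of t] by (simp add: scaleR_conv_of_real divide_inverse mult.commute)
  have "(\<lambda>m. of_nat (Suc m) * t ^ Suc m / fact (Suc m)) sums (t * exp t)"
  proof -
    have "of_nat (Suc m) * t ^ Suc m / fact (Suc m) = t * (t ^ m / fact m)" for m
      by (simp del: of_nat_Suc)
    thus ?thesis using sums_mult[OF e, of t] by simp
  qed
  hence "(\<lambda>m. of_nat m * t ^ m / fact m) sums (t * exp t)"
    by (subst (asm) sums_Suc_iff) simp
  from sums_add[OF this sums_mult[OF e, of "of_nat (k + 1)"]]
  show ?thesis by (simp add: profile_def ring_distribs add_divide_distrib add_ac)
qed

lemma profile_has_derivative: "(profile k has_field_derivative (profile k t + exp t)) (at t)"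
  unfolding profile_def by (auto intro!: derivative_eq_intros simp: algebra_simps)

lemma norm_profile_partial_sum:
  "cmod (\<Sum>m<M. of_nat (m + k + 1) / fact m * t ^ m) \<le> (cmod t + real (k + 1)) * exp (cmod t)"
proof -
  let ?a = "\<lambda>m. real (m + k + 1) / fact m * cmod t ^ m"
  have s: "?a sums ((cmod t + real (k + 1)) * exp (cmod t))"
  proof -
    have 1: "of_nat (m + k + 1) / fact m * complex_of_real (cmod t) ^ m = of_real (?a m)" for m
      by simp
    have 2: "profile k (of_real (cmod t)) = of_real ((cmod t + real (k + 1)) * exp (cmod t))"
      by (simp add: profile_def exp_of_real)
    show ?thesis using sums_Re[OF profile_sums[of k "of_real (cmod t)"]]
      unfolding 1 2 Re_complex_of_real .
  qed
  have "cmod (\<Sum>m<M. of_nat (m + k + 1) / fact m * t ^ m) \<le> (\<Sum>m<M. ?a m)"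
    by (rule order.trans[OF norm_sum]) (simp add: norm_mult norm_divide norm_power del: of_nat_add of_nat_Suc)
  also have "\<dots> \<le> (cmod t + real (k + 1)) * exp (cmod t)"
    by (rule sum_le_suminf[OF sums_summable[OF s], unfolded sums_unique[OF s, symmetric]]) auto
  finally show ?thesis .
qed

text \<open>
  The row of the kernel that evaluates the component \<open>J\<close> at \<open>x\<close>, conjugated so that the evaluation is the inner
  product with it.
\<close>

definition kernel_section :: "nat \<Rightarrow> 'n::finite pt \<Rightarrow> 2 list \<Rightarrow> 'n pt \<Rightarrow> tuple" where
  "kernel_section k x J y I = (if length I = k then
     (LINT p|sphere_measure. cnj (profile k (pairing (sphere_param p) x y)) * sphere_monomial p J *
         cnj (sphere_monomial p I))
       / of_real (gauss_mass TYPE('n)) else 0)"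

definition kernel_bound :: "nat \<Rightarrow> 'n::finite pt \<Rightarrow> 'n pt \<Rightarrow> real" where
  "kernel_bound k x y = (2 * norm x * norm y + real (k + 1)) * exp (2 * (x \<bullet> y))"

lemma kernel_bound_nonneg: "0 \<le> kernel_bound k x y"
  by (simp add: kernel_bound_def)

lemma norm_profile_pairing:
  assumes "p \<in> space sphere_measure"
  shows "cmod (profile k (pairing (sphere_param p) x y)) \<le> kernel_bound k x y"
proof -
  note n = sphere_param_norm[OF assms]
  have "cmod (profile k (pairing (sphere_param p) x y)) \<le>
      (cmod (pairing (sphere_param p) x y) + real (k + 1)) * exp (2 * (x \<bullet> y))"
    using norm_profile[of k "pairing (sphere_param p) x y"] unfolding Re_pairing[OF n] .
  also have "\<dots> \<le> kernel_bound k x y"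
    unfolding kernel_bound_def by (intro mult_right_mono add_right_mono norm_pairing[OF n]) simp
  finally show ?thesis .
qed

lemma measurable_pairing_joint [measurable]:
  "(\<lambda>(y, p). pairing (sphere_param p) x y) \<in> borel_measurable (borel \<Otimes>\<^sub>M sphere_measure)"
proof -
  have [measurable]: "(\<lambda>y. null_coord y A b) \<in> borel_measurable borel" for A :: "'a \<times> 2" and b
    unfolding null_coord_def Let_def
    by (cases "snd A = 0"; cases "b = 0"; simp; intro borel_measurable_continuous_onI continuous_intros)
  have [measurable]: "(\<lambda>q. cnj (sphere_param (snd q) b)) \<in> borel_measurable (borel \<Otimes>\<^sub>M sphere_measure)" for b
    by measurable
  show ?thesis
    unfolding pairing_def spinor_coord_def case_prod_unfold cnj_sum complex_cnj_mult by measurable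
qed

lemma measurable_profile [measurable]: "profile k \<in> borel_measurable borel"
  unfolding profile_def by (intro borel_measurable_continuous_onI continuous_intros)

lemma measurable_kernel_integrand [measurable]:
  "(\<lambda>(y, p). cnj (profile k (pairing (sphere_param p) x y)) * sphere_monomial p J * cnj (sphere_monomial p I))
     \<in> borel_measurable (borel \<Otimes>\<^sub>M sphere_measure)"
proof -
  have [measurable]: "(\<lambda>q. pairing (sphere_param (snd q)) x (fst q)) \<in> borel_measurable (borel \<Otimes>\<^sub>M
      sphere_measure)"
    using measurable_pairing_joint[of x] by (simp add: case_prod_unfold)
  show ?thesis unfolding case_prod_unfold by measurable
qed

lemma norm_kernel_integrand:
  assumes "p \<in> space sphere_measure"
  shows "cmod (cnj (profile k (pairing (sphere_param p) x y)) * sphere_monomial p J *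
      cnj (sphere_monomial p I)) \<le> kernel_bound k x y"
proof -
  have "cmod (profile k (pairing (sphere_param p) x y)) * cmod (sphere_monomial p J) *
      cmod (sphere_monomial p I) \<le> kernel_bound k x y * 1 * 1"
    by (intro mult_mono norm_profile_pairing norm_sphere_monomial assms order.trans[OF norm_ge_zero
        norm_profile_pairing[OF assms]] mult_nonneg_nonneg) auto
  thus ?thesis by (simp add: norm_mult)
qed

lemma integrable_kernel_integrand:
  "integrable sphere_measure (\<lambda>p. cnj (profile k (pairing (sphere_param p) x y)) * sphere_monomial p J *
      cnj (sphere_monomial p I))"
proof (rule sphere.integrable_const_bound[where B="kernel_bound k x y"])
  show "(\<lambda>p. cnj (profile k (pairing (sphere_param p) x y)) * sphere_monomial p J *
      cnj (sphere_monomial p I)) \<in> borel_measurable sphere_measure"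
    using measurable_compose[OF measurable_Pair1'[of y borel sphere_measure] measurable_kernel_integrand[of
        k x J I]] by simp
qed (auto intro!: AE_I2 norm_kernel_integrand)

lemma norm_kernel_section:
  "cmod (kernel_section k x J y I) \<le> kernel_bound k x y / gauss_mass TYPE('n)" for x :: "'n::finite pt"
proof -
  have nn: "0 \<le> kernel_bound k x y" by (simp add: kernel_bound_def)
  have "cmod (LINT p|sphere_measure. cnj (profile k (pairing (sphere_param p) x y)) * sphere_monomial p J *
      cnj (sphere_monomial p I))
      \<le> (LINT p|sphere_measure. kernel_bound k x y)"
    by (intro order.trans[OF integral_norm_bound] integral_mono integrable_norm integrable_kernel_integrand
        norm_kernel_integrand)
      auto
  hence "cmod (LINT p|sphere_measure. cnj (profile k (pairing (sphere_param p) x y)) * sphere_monomial p J *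
      cnj (sphere_monomial p I)) \<le> kernel_bound k x y"
    by (simp add: sphere.prob_space)
  thus ?thesis using gauss_mass_pos[where 'n='n] nn
    by (auto simp: kernel_section_def norm_divide intro!: divide_right_mono)
qed

lemma measurable_kernel_section [measurable]: "(\<lambda>y. kernel_section k x J y I) \<in> borel_measurable borel"
proof (cases "length I = k")
  case True
  have "(\<lambda>y. LINT p|sphere_measure. cnj (profile k (pairing (sphere_param p) x y)) * sphere_monomial p J *
      cnj (sphere_monomial p I)) \<in> borel_measurable borel"
    by (rule sphere.borel_measurable_lebesgue_integral) (rule measurable_kernel_integrand)
  thus ?thesis using True by (simp add: kernel_section_def)
qed (simp add: kernel_section_def)

lemma kernel_section_in_V0: "kernel_section k x J y \<in> V0 k"
  unfolding V0_def
proof (intro CollectI conjI allI impI)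
  fix I I' :: "2 list" assume "length I = k" and m: "mset I = mset I'"
  hence "length I' = k" by (metis size_mset)
  thus "kernel_section k x J y I = kernel_section k x J y I'"
    using \<open>length I = k\<close> monomial_cong_mset[OF m] by (simp add: kernel_section_def)
qed (simp add: kernel_section_def)

lemma gauss_dominated_mono:
  assumes "gauss_dominated v" "u \<in> borel_measurable borel" "\<And>y. cmod (u y) \<le> cmod (v y)"
  shows "gauss_dominated u"
  using assms unfolding gauss_dominated_def by (meson order.trans)

text \<open>
  Unlike \<open>kernel_bound\<close>, this also bounds the partial sums of the power series of \<open>profile\<close>, which are
  estimated term by term.
\<close>

definition profile_bound :: "nat \<Rightarrow> 'n::finite pt \<Rightarrow> 'n pt \<Rightarrow> real" where
  "profile_bound k x y = (2 * norm x * norm y + real (k + 1)) * exp (2 * norm x * norm y)"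

lemma kernel_bound_le_profile_bound: "kernel_bound k x y \<le> profile_bound k x y"
  unfolding kernel_bound_def profile_bound_def using norm_cauchy_schwarz[of x y]
  by (intro mult_left_mono) (auto simp: mult.assoc)

lemma profile_bound_nonneg: "0 \<le> profile_bound k x y"
  by (simp add: profile_bound_def)

lemma profile_bound_gauss_dominated:
  "gauss_dominated (\<lambda>y. of_real (profile_bound k x y) * gaussian 2 0 y)" for x :: "'n::finite pt"
proof (rule gauss_dominated_mult[OF gauss_dominated_shifted_gaussian[OF order.refl], of _ "real (k +
    1)" "4 * norm x"])
  fix y :: "'n pt"
  have "2 * norm x * norm y + real (k + 1) \<le> real (k + 1) * (1 + 2 * norm x * norm y)"
    by (simp add: algebra_simps)
  also have "\<dots> \<le> real (k + 1) * exp (2 * norm x * norm y)"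
    by (intro mult_left_mono) auto
  finally have "profile_bound k x y \<le> real (k + 1) * exp (2 * norm x * norm y) * exp (2 * norm x * norm y)"
    unfolding profile_bound_def by (intro mult_right_mono) auto
  also have "\<dots> = real (k + 1) * exp (4 * norm x * norm y)"
    by (simp add: mult.assoc flip: exp_add)
  finally show "cmod (of_real (profile_bound k x y)) \<le> real (k + 1) * exp (4 * norm x * norm y)"
    unfolding norm_of_real abs_of_nonneg[OF profile_bound_nonneg] .
qed (simp add: profile_bound_def)

lemma kernel_bound_gauss_dominated:
  "gauss_dominated (\<lambda>y. of_real (kernel_bound k x y) * gaussian 2 0 y)"
proof (rule gauss_dominated_mono[OF profile_bound_gauss_dominated[of k x]])
  show "cmod (of_real (kernel_bound k x y) * gaussian 2 0 y) \<le>
      cmod (of_real (profile_bound k x y) * gaussian 2 0 y)" for y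
    unfolding norm_mult norm_of_real abs_of_nonneg[OF kernel_bound_nonneg] abs_of_nonneg[OF
        profile_bound_nonneg]
    by (intro mult_right_mono kernel_bound_le_profile_bound) simp
qed (simp add: kernel_bound_def)

lemma kernel_section_gauss_dominated:
  "gauss_dominated (\<lambda>y. kernel_section k x J y I * gaussian 2 0 y)" for x :: "'n::finite pt"
proof (rule gauss_dominated_mono)
  show "gauss_dominated (\<lambda>y. (1 / of_real (gauss_mass TYPE('n))) * (of_real (kernel_bound k x y) *
      gaussian 2 0 y))"
    by (rule gauss_dominated_scale[OF kernel_bound_gauss_dominated])
  fix y :: "'n pt"
  have "cmod (kernel_section k x J y I) * exp (- (2 * (norm y)\<^sup>2)) \<le>
      (kernel_bound k x y / gauss_mass TYPE('n)) * exp (- (2 * (norm y)\<^sup>2))"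
    by (intro mult_right_mono norm_kernel_section) simp
  thus "cmod (kernel_section k x J y I * gaussian 2 0 y) \<le>
      cmod ((1 / of_real (gauss_mass TYPE('n))) * (of_real (kernel_bound k x y) * gaussian 2 0 y))"
    using gauss_mass_pos[where 'n='n] kernel_bound_nonneg[of k x y] by (simp add: norm_mult norm_divide)
qed simp

lemma kernel_section_in_L2:
  "kernel_section k x J \<in> L2_phi k sq_norm"
  unfolding L2_phi_def
proof (intro CollectI conjI allI kernel_section_in_V0)
  show "(\<lambda>y. kernel_section k x J y I) \<in> borel_measurable lborel" for I by simp
  have "integrable lborel (\<lambda>y. (cmod (kernel_section k x J y I))\<^sup>2 * exp (- 2 * (norm y)\<^sup>2))" for I
  proof -
    have "(cmod (kernel_section k x J y I * gaussian 2 0 y))\<^sup>2 * exp (2 * (norm y)\<^sup>2) =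
        (cmod (kernel_section k x J y I))\<^sup>2 * exp (- 2 * (norm y)\<^sup>2)" for y
    proof -
      have "(exp (- (2 * r)))\<^sup>2 * exp (2 * r) = exp (- 2 * r)" for r :: real
        by (simp add: power2_eq_square flip: exp_add)
      thus ?thesis unfolding norm_mult norm_of_real abs_exp_cancel power_mult_distrib diff_zero
          by (simp only: mult.assoc)
    qed
    thus ?thesis using gauss_dominated_weighted_square[OF kernel_section_gauss_dominated[of k x J I]] by simp
  qed
  hence "integrable lborel (\<lambda>y. \<Sum>I\<in>words k. complex_of_real ((cmod (kernel_section k x J y I))\<^sup>2 *
      exp (- 2 * (norm y)\<^sup>2)))"
    by (intro Bochner_Integration.integrable_sum integrable_of_real)
  thus "integrable lborel (\<lambda>y. inner_V0 k (kernel_section k x J y) (kernel_section k x J y) * exp (- 2 *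
      (norm y)\<^sup>2))"
    unfolding inner_V0_def sum_distrib_right of_real_mult complex_norm_square by simp
qed

section \<open>Integration by parts against test functions\<close>

lemma supported_bound:
  fixes u :: "'a::euclidean_space \<Rightarrow> complex"
  assumes "continuous_on UNIV u" "\<And>y. norm y > R \<Longrightarrow> u y = 0"
  obtains B where "\<And>y. cmod (u y) \<le> B * indicator (cball 0 R) y"
proof -
  have "compact (u ` cball 0 R)"
    by (intro compact_continuous_image continuous_on_subset[OF assms(1)]) auto
  then obtain B where B: "\<And>y. y \<in> cball 0 R \<Longrightarrow> cmod (u y) \<le> B"
    using compact_imp_bounded bounded_iff by (metis imageI)
  have "cmod (u y) \<le> B * indicator (cball 0 R) y" for y
    using B[of y] assms(2)[of y] by (cases "y \<in> cball 0 R") auto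
  thus ?thesis using that by blast
qed

lemma integrable_ball_bound: "integrable lborel (\<lambda>y. B *
    indicator (cball 0 R) (y::'a::euclidean_space) :: real)"
  by (intro integrable_mult_right integrable_real_indicator) (use emeasure_bounded_finite[OF
      bounded_cball[of 0 R]] in auto)

lemma integrable_supported:
  fixes u :: "'a::euclidean_space \<Rightarrow> complex"
  assumes "continuous_on UNIV u" "\<And>y. norm y > R \<Longrightarrow> u y = 0"
  shows "integrable lborel u"
proof -
  obtain B where B: "\<And>y. cmod (u y) \<le> B * indicator (cball 0 R) y"
    using supported_bound[OF assms] by blast
  show ?thesis
  proof (rule Bochner_Integration.integrable_bound[OF integrable_ball_bound[of B R]])
    show "AE y in lborel. norm (u y) \<le> norm (B * indicator (cball 0 R) y)"
      using B by (intro AE_I2) (metis abs_ge_self order.trans real_norm_def)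
  qed (use assms(1) in \<open>simp add: borel_measurable_continuous_onI\<close>)
qed

lemma partial_supported:
  fixes u :: "'n::finite pt \<Rightarrow> complex"
  assumes "\<And>y. norm y > R \<Longrightarrow> u y = 0" "norm y > R"
  shows "partial l j u y = 0"
proof -
  have "(u has_derivative (\<lambda>h. 0)) (at y)"
  proof (rule has_derivative_transform_within_open)
    show "((\<lambda>y. 0) has_derivative (\<lambda>h. 0)) (at y)" by simp
    show "open {y :: 'n pt. norm y > R}" by (intro open_Collect_less continuous_intros)
  qed (use assms in auto)
  thus ?thesis by (rule partial_eqI)
qed

text \<open>
  The integral of \<open>u (y + s e)\<close> does not depend on \<open>s\<close>; its derivative at \<open>s = 0\<close> is the integral of the partial
  derivative.
\<close>

lemma integral_partial_zero:
  fixes u :: "'n::finite pt \<Rightarrow> complex"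
  assumes diff: "\<And>y. u differentiable (at y)" and cont: "continuous_on UNIV (partial l j u)"
    and supp: "\<And>y. norm y > R \<Longrightarrow> u y = 0"
  shows "(LINT y|lborel. partial l j u y) = 0"
proof -
  define e :: "'n pt" where "e = axis l (axis j 1)"
  have e: "norm e = 1" by (simp add: e_def norm_eq_sqrt_inner inner_axis_axis)
  have cu: "continuous_on UNIV u"
    using diff by (auto intro!: continuous_at_imp_continuous_on differentiable_imp_continuous_within)
  have "partial l j u y = 0" if "norm y > R" for y by (rule partial_supported[OF supp that])
  then obtain B where B: "\<And>y. cmod (partial l j u y) \<le> B * indicator (cball 0 R) y"
    using supported_bound[OF cont] by blast
  have far: "norm (y + s *\<^sub>R e) > R" if "s \<in> {-1..1}" "norm y > R + 1" for s y
  proof -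
    have "norm (s *\<^sub>R e) \<le> 1" using that(1) e by auto
    moreover have "norm y - norm (s *\<^sub>R e) \<le> norm (y + s *\<^sub>R e)" by (rule norm_diff_ineq)
    ultimately show ?thesis using that(2) by linarith
  qed
  have "((\<lambda>s. LINT y|lborel. u (y + s *\<^sub>R e)) has_vector_derivative (LINT y|lborel. partial l j u (y +
      0 *\<^sub>R e))) (at 0 within {-1..1})"
  proof (rule has_vector_derivative_integral[of "-1" 1 _ "\<lambda>s y. partial l j u (y +
      s *\<^sub>R e)" "\<lambda>y. \<bar>B\<bar> * indicator (cball 0 (R + 1)) y"])
    fix s y
    obtain u' where u': "(u has_derivative u') (at (y + s *\<^sub>R e))" using diff differentiable_def by blast
    have "((\<lambda>s. u (y + s *\<^sub>R e)) has_derivative (\<lambda>h. u' (h *\<^sub>R e))) (at s within {-1..1})"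
      by (rule has_derivative_compose[of "\<lambda>s. y + s *\<^sub>R e" "\<lambda>h. h *\<^sub>R e" s "{-1..1}" u u'])
        (use u' in \<open>auto intro!: derivative_eq_intros\<close>)
    moreover have "u' (h *\<^sub>R e) = h *\<^sub>R partial l j u (y + s *\<^sub>R e)" for h
      using linear_scale[OF has_derivative_linear[OF u']] partial_eqI[OF u', of l j] by (simp add: e_def)
    ultimately show "((\<lambda>s. u (y + s *\<^sub>R e)) has_vector_derivative partial l j u (y +
        s *\<^sub>R e)) (at s within {-1..1})"
      by (simp add: has_vector_derivative_def)
  next
    fix s :: real and y assume s: "s \<in> {-1..1}"
    show "cmod (partial l j u (y + s *\<^sub>R e)) \<le> \<bar>B\<bar> * indicator (cball 0 (R + 1)) y"
    proof (cases "norm y > R + 1")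
      case True
      thus ?thesis using partial_supported[OF supp far[OF s True]] by simp
    next
      case False
      have "cmod (partial l j u (y + s *\<^sub>R e)) \<le> B * indicator (cball 0 R) (y + s *\<^sub>R e)" by (rule B)
      also have "\<dots> \<le> \<bar>B\<bar>" by (auto simp: indicator_def)
      finally show ?thesis using False by simp
    qed
  next
    fix s :: real assume s: "s \<in> {-1..1}"
    show "integrable lborel (\<lambda>y. u (y + s *\<^sub>R e))"
      by (rule integrable_supported[of _ "R + 1"])
        (auto intro!: supp far[OF s] continuous_on_compose2[OF cu] continuous_intros)
    show "(\<lambda>y. partial l j u (y + s *\<^sub>R e)) \<in> borel_measurable lborel"
      by (auto intro!: borel_measurable_continuous_onI continuous_on_compose2[OF cont] continuous_intros)
  qed (rule integrable_ball_bound, simp)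
  moreover have "(LINT y|lborel. u (y + s *\<^sub>R e)) = (LINT y|lborel. u y)" for s
  proof -
    have "(LINT y|lborel. u y) = (LINT y|distr lborel borel ((+) (s *\<^sub>R e)). u y)"
      by (simp only: lborel_distr_plus)
    also have "\<dots> = (LINT y|lborel. u (s *\<^sub>R e + y))"
      using cu by (subst integral_distr) (auto intro: borel_measurable_continuous_onI)
    finally show ?thesis by (simp add: add.commute)
  qed
  ultimately have "((\<lambda>s::real. LINT y|lborel. u y) has_vector_derivative (LINT y|lborel. partial l j u y))
      (at 0)"
    by (simp add: at_within_Icc_at)
  from vector_derivative_unique_at[OF this has_vector_derivative_const]
  show ?thesis .
qed

lemma integral_Z_low_zero:
  fixes u :: "'n::finite pt \<Rightarrow> complex"
  assumes diff: "\<And>y. u differentiable (at y)" and cont: "\<And>l j. continuous_on UNIV (partial l j u)"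
    and supp: "\<And>y. norm y > R \<Longrightarrow> u y = 0"
  shows "integrable lborel (Z_low A b u)" "(LINT y|lborel. Z_low A b u y) = 0"
proof -
  obtain c d l i j where "\<And>y. Z_low A b u y = c * partial l i u y + d * partial l j u y"
    using Z_low_linear_combination[of A b] by blast
  hence Z: "Z_low A b u = (\<lambda>y. c * partial l i u y + d * partial l j u y)" by blast
  have i: "integrable lborel (partial l j u)" for l j
    by (rule integrable_supported[OF cont partial_supported[OF supp]])
  show "integrable lborel (Z_low A b u)" unfolding Z
    by (intro Bochner_Integration.integrable_add integrable_mult_right i)
  show "(LINT y|lborel. Z_low A b u y) = 0" unfolding Z
    by (simp add: Bochner_Integration.integral_add i integral_partial_zero[OF diff cont supp])
qed

lemma test_function_support:
  fixes \<psi> :: "'n::finite pt \<Rightarrow> complex"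
  assumes "test_function \<psi>"
  obtains R where "\<And>y. norm y > R \<Longrightarrow> \<psi> y = 0"
proof -
  have "bounded {y. \<psi> y \<noteq> 0}"
    using assms compact_imp_bounded bounded_subset closure_subset unfolding test_function_def by metis
  then obtain R where "\<And>y. \<psi> y \<noteq> 0 \<Longrightarrow> norm y \<le> R" by (auto simp: bounded_iff)
  thus ?thesis using that by (metis not_le)
qed

lemma test_function_C1:
  fixes \<psi> :: "'n::finite pt \<Rightarrow> complex"
  assumes "test_function \<psi>"
  shows "\<psi> differentiable (at y)" "continuous_on UNIV \<psi>" "continuous_on UNIV (partial l j \<psi>)"
proof -
  have "C_k (Suc 0) \<psi>" "C_k 0 \<psi>" using assms by (auto simp: test_function_def simp del: C_k.simps)
  thus "\<psi> differentiable (at y)" "continuous_on UNIV \<psi>" "continuous_on UNIV (partial l j \<psi>)"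
    unfolding C_k_Suc_partial by auto
qed

section \<open>The sections of the kernel lie in the Bergman space\<close>

lemma has_derivative_cnj_profile:
  "((\<lambda>y. cnj (profile k (pairing \<theta> x y))) has_derivative
     (\<lambda>h. cnj ((profile k (pairing \<theta> x y) + exp (pairing \<theta> x y)) * pairing \<theta> x h))) (at y)"
proof -
  have "(profile k has_derivative (\<lambda>h. (profile k t + exp t) * h)) (at t)" for t
    using profile_has_derivative by (simp add: has_field_derivative_def)
  from bounded_linear.has_derivative[OF bounded_linear_cnj has_derivative_compose[OF has_derivative_pairing
      this]]
  show ?thesis .
qed

text \<open>
  Conjugation exchanges the two fields of a block, up to sign, and so turns the Cauchy-Riemann operators of the structure
  into the contraction of \<open>Z\<close> with \<open>cnj \<theta>\<close> that occurs in the Cauchy-Fueter operator.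
\<close>

lemma conjugate_spinor_deriv_pairing:
  "cnj (\<theta> 1) * Z_low A 0 (\<lambda>y. cnj (pairing \<theta> x y)) y - cnj (\<theta> 0) * Z_low A 1 (\<lambda>y. cnj (pairing \<theta> x y)) y = 0"
proof -
  have p: "partial l j (\<lambda>y. cnj (pairing \<theta> x y)) y = cnj (partial l j (pairing \<theta> x) y)" for l j
    using partial_eqI[OF bounded_linear.has_derivative[OF bounded_linear_cnj has_derivative_pairing]]
    by (simp add: partial_pairing)
  obtain l a where A: "A = (l, a)" by fastforce
  have s: "spinor_deriv \<theta> B (pairing \<theta> x) y = 0" for B by (rule spinor_deriv_pairing)
  show ?thesis using cases_2_01[of a]
  proof
    assume "a = 0"
    thus ?thesis using arg_cong[OF s[of "(l, 1)"], of cnj]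
      by (simp add: A Z_low_cases p spinor_deriv_def sum_UNIV_2 algebra_simps)
  next
    assume "a = 1"
    thus ?thesis using arg_cong[OF s[of "(l, 0)"], of cnj]
      by (simp add: A Z_low_cases p spinor_deriv_def sum_UNIV_2 algebra_simps)
  qed
qed

text \<open>
  The weak Cauchy-Fueter equation for a single \<open>\<theta>\<close>: the derivation annihilates the first factor, so the integrand is the
  derivation applied to a function of compact support.
\<close>

lemma integral_cnj_profile_Z_low:
  fixes \<psi> :: "'n::finite pt \<Rightarrow> complex"
  assumes \<psi>: "test_function \<psi>"
  shows "(LINT y|lborel. cnj (profile k (pairing \<theta> x y)) * (cnj (\<theta> 1) * Z_low A 0 \<psi> y -
      cnj (\<theta> 0) * Z_low A 1 \<psi> y)) = 0"
proof -
  define w where "w y = cnj (profile k (pairing \<theta> x y))" for y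
  define c where "c y = cnj (profile k (pairing \<theta> x y) + exp (pairing \<theta> x y))" for y
  have wd: "w differentiable (at y)" for y
    unfolding w_def[abs_def] using has_derivative_cnj_profile differentiable_def by blast
  have wp: "partial l j w y = c y * partial l j (\<lambda>y. cnj (pairing \<theta> x y)) y" for l j y
    using partial_eqI[OF has_derivative_cnj_profile, of l j k \<theta> x y]
      partial_eqI[OF bounded_linear.has_derivative[OF bounded_linear_cnj has_derivative_pairing], of l j \<theta> x y]
    by (simp add: w_def[abs_def] c_def)
  have wZ: "Z_low A b w y = c y * Z_low A b (\<lambda>y. cnj (pairing \<theta> x y)) y" for b y
    unfolding Z_low_def Let_def wp by (simp add: algebra_simps)
  obtain R where R: "\<And>y. norm y > R \<Longrightarrow> \<psi> y = 0" using test_function_support[OF \<psi>] by blast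
  define u where "u y = w y * \<psi> y" for y
  have ud: "u differentiable (at y)" for y
    unfolding u_def[abs_def] by (intro differentiable_mult wd test_function_C1[OF \<psi>])
  have cp: "continuous_on UNIV (pairing \<theta> x)"
    by (auto intro!: continuous_at_imp_continuous_on differentiable_imp_continuous_within
        differentiable_pairing)
  have cprof: "continuous_on UNIV (\<lambda>y. profile k (pairing \<theta> x y))"
    unfolding profile_def by (intro continuous_intros cp)
  have up: "partial l j u = (\<lambda>y. w y * partial l j \<psi> y +
      (c y * cnj (pairing \<theta> x (axis l (axis j 1)))) * \<psi> y)" for l j
    unfolding u_def[abs_def] partial_mult[OF wd test_function_C1(1)[OF \<psi>]] wp
    using partial_eqI[OF bounded_linear.has_derivative[OF bounded_linear_cnj has_derivative_pairing], of l j
        \<theta> x]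
    by (simp add: fun_eq_iff)
  have ucont: "continuous_on UNIV (partial l j u)" for l j
    unfolding up w_def c_def by (intro continuous_intros cprof cp test_function_C1[OF \<psi>])
  have usupp: "u y = 0" if "norm y > R" for y using R[OF that] by (simp add: u_def)
  have Zu: "Z_low A b u y = w y * Z_low A b \<psi> y + Z_low A b w y * \<psi> y" for b y
    unfolding u_def[abs_def] by (rule Z_low_mult[OF wd test_function_C1(1)[OF \<psi>]])
  have "w y * (cnj (\<theta> 1) * Z_low A 0 \<psi> y - cnj (\<theta> 0) * Z_low A 1 \<psi> y) =
      cnj (\<theta> 1) * Z_low A 0 u y - cnj (\<theta> 0) * Z_low A 1 u y" for y
  proof -
    have "cnj (\<theta> 1) * Z_low A 0 u y - cnj (\<theta> 0) * Z_low A 1 u y =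
        w y * (cnj (\<theta> 1) * Z_low A 0 \<psi> y - cnj (\<theta> 0) * Z_low A 1 \<psi> y)
      + c y * \<psi> y * (cnj (\<theta> 1) * Z_low A 0 (\<lambda>y. cnj (pairing \<theta> x y)) y -
          cnj (\<theta> 0) * Z_low A 1 (\<lambda>y. cnj (pairing \<theta> x y)) y)"
      unfolding Zu wZ by (simp add: algebra_simps)
    thus ?thesis unfolding conjugate_spinor_deriv_pairing by simp
  qed
  hence "(LINT y|lborel. w y * (cnj (\<theta> 1) * Z_low A 0 \<psi> y - cnj (\<theta> 0) * Z_low A 1 \<psi> y)) =
    (LINT y|lborel. cnj (\<theta> 1) * Z_low A 0 u y - cnj (\<theta> 0) * Z_low A 1 u y)" by simp
  also have "\<dots> = 0"
    by (subst Bochner_Integration.integral_diff)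
      (simp_all add: integral_Z_low_zero[OF ud ucont usupp] integrable_mult_right)
  finally show ?thesis by (simp add: w_def)
qed

interpretation sphere_lborel: pair_sigma_finite sphere_measure "lborel :: 'a::euclidean_space measure" ..

lemma measurable_swap_sphere:
  assumes "F \<in> borel_measurable (borel \<Otimes>\<^sub>M sphere_measure)"
  shows "(\<lambda>(p, y). F (y, p)) \<in> borel_measurable (sphere_measure \<Otimes>\<^sub>M lborel)"
proof -
  have "(\<lambda>q. (snd q, fst q)) \<in> measurable (sphere_measure \<Otimes>\<^sub>M lborel) (borel \<Otimes>\<^sub>M sphere_measure)"
    by (intro measurable_Pair measurable_fst) (simp add: measurable_lborel2 measurable_snd)
  from measurable_compose[OF this assms] show ?thesis by (simp add: case_prod_unfold)
qed

lemma integrable_sphere_product: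
  fixes F :: "(real \<times> real) \<times> 'a::euclidean_space \<Rightarrow> complex"
  assumes meas: "F \<in> borel_measurable (sphere_measure \<Otimes>\<^sub>M lborel)"
    and bound: "\<And>p y. p \<in> space sphere_measure \<Longrightarrow> cmod (F (p, y)) \<le> W y" and W: "integrable lborel W"
  shows "integrable (sphere_measure \<Otimes>\<^sub>M lborel) F"
proof (rule Bochner_Integration.integrable_bound)
  have [measurable]: "W \<in> borel_measurable borel" using W by auto
  show "integrable (sphere_measure \<Otimes>\<^sub>M lborel) (\<lambda>q. W (snd q))"
    by (rule sphere_lborel.Fubini_integrable) (use W in auto)
  show "AE q in sphere_measure \<Otimes>\<^sub>M lborel. norm (F q) \<le> norm (W (snd q))"
  proof (rule AE_I2)
    fix q :: "(real \<times> real) \<times> 'a" assume "q \<in> space (sphere_measure \<Otimes>\<^sub>M lborel)"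
    hence "cmod (F (fst q, snd q)) \<le> W (snd q)" by (intro bound) (auto simp: space_pair_measure)
    thus "norm (F q) \<le> norm (W (snd q))" by simp
  qed
qed (rule meas)

text \<open>
  Fubini's theorem reduces the equation to the one for a single \<open>\<theta>\<close>, \<open>integral_cnj_profile_Z_low\<close>.
\<close>

lemma kernel_section_in_bergman:
  fixes x :: "'n::finite pt"
  assumes k: "k \<ge> 1"
  shows "kernel_section k x J \<in> bergman_space k sq_norm"
  unfolding bergman_space_def
proof (intro CollectI conjI allI impI kernel_section_in_L2)
  fix I :: "2 list" and A :: "'n \<times> 2" and \<psi> :: "'n pt \<Rightarrow> complex"
  assume I: "length I = k - 1" and \<psi>: "test_function \<psi>"
  define H where "H b y p = cnj (profile k (pairing (sphere_param p) x y)) * sphere_monomial p J *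
      cnj (sphere_monomial p (b # I))" for b y p
  define F where "F q = H 1 (snd q) (fst q) * Z_low A 0 \<psi> (snd q) -
      H 0 (snd q) (fst q) * Z_low A 1 \<psi> (snd q)" for q
  obtain R where R: "\<And>y. norm y > R \<Longrightarrow> \<psi> y = 0" using test_function_support[OF \<psi>] by blast
  have Zcont: "continuous_on UNIV (Z_low A b \<psi>)" and Zsupp: "\<And>y. norm y > R \<Longrightarrow> Z_low A b \<psi> y = 0" for b
  proof -
    obtain c d l i j where Z: "\<And>y. Z_low A b \<psi> y = c * partial l i \<psi> y + d * partial l j \<psi> y"
      using Z_low_linear_combination[of A b] by blast
    have "Z_low A b \<psi> = (\<lambda>y. c * partial l i \<psi> y + d * partial l j \<psi> y)" using Z by blast
    thus "continuous_on UNIV (Z_low A b \<psi>)" by (simp only:) (intro continuous_intros test_function_C1[OF \<psi>])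
    show "Z_low A b \<psi> y = 0" if "norm y > R" for y using partial_supported[OF R that] by (simp add: Z)
  qed
  have Zm [measurable]: "Z_low A b \<psi> \<in> borel_measurable borel" for b
    by (rule borel_measurable_continuous_onI[OF Zcont])
  define W where "W y = cmod (of_real (kernel_bound k x y) * Z_low A 0 \<psi> y) +
      cmod (of_real (kernel_bound k x y) * Z_low A 1 \<psi> y)" for y
  have Hb: "cmod (H b y p) \<le> kernel_bound k x y" if "p \<in> space sphere_measure" for b y p
    unfolding H_def by (rule norm_kernel_integrand[OF that])
  have kc: "continuous_on UNIV (\<lambda>y. complex_of_real (kernel_bound k x y))"
    unfolding kernel_bound_def by (intro continuous_intros)
  have W: "integrable lborel W" unfolding W_def
    by (intro Bochner_Integration.integrable_add integrable_norm integrable_supported[of _ R]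
        continuous_intros kc Zcont)
      (simp_all add: Zsupp)
  have Fb: "cmod (F (p, y)) \<le> W y" if "p \<in> space sphere_measure" for p y
    unfolding F_def W_def fst_conv snd_conv norm_mult norm_of_real abs_of_nonneg[OF kernel_bound_nonneg]
    by (intro order.trans[OF norm_triangle_ineq4] add_mono) (auto simp: norm_mult intro!: mult_right_mono Hb
        that)
  have Hm [measurable]: "(\<lambda>q. H b (snd q) (fst q)) \<in> borel_measurable (sphere_measure \<Otimes>\<^sub>M lborel)" for b
    using measurable_swap_sphere[OF measurable_kernel_integrand[of k x J "b # I"]]
        by (simp add: H_def case_prod_unfold)
  have Fm: "F \<in> borel_measurable (sphere_measure \<Otimes>\<^sub>M lborel)"
    unfolding F_def[abs_def] by measurable
  have Fi: "integrable (sphere_measure \<Otimes>\<^sub>M lborel) (\<lambda>(p, y). F (p, y))"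
    using integrable_sphere_product[OF Fm Fb W] by simp
  have Hi: "integrable sphere_measure (\<lambda>p. H b y p)" for b y
    unfolding H_def by (rule integrable_kernel_integrand)
  let ?c = "complex_of_real (gauss_mass TYPE('n))"
  have sec: "kernel_section k x J y (b # I) = (LINT p|sphere_measure. H b y p) / ?c" for y b
    using I k by (simp add: kernel_section_def H_def)
  have "gauss_dominated (Z_low A b \<psi>)" for b
  proof -
    obtain B where B: "\<And>y. cmod (Z_low A b \<psi> y) \<le> B * indicator (cball 0 R) y"
      using supported_bound[OF Zcont Zsupp] by blast
    have "cmod (Z_low A b \<psi> y) \<le> (\<bar>B\<bar> * exp (2 * R\<^sup>2)) * exp (- 2 * (norm y)\<^sup>2 + 0 * norm y)" for y
    proof (cases "norm y \<le> R")
      case True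
      hence "(norm y)\<^sup>2 \<le> R\<^sup>2" by (intro power_mono) auto
      have "cmod (Z_low A b \<psi> y) \<le> \<bar>B\<bar> * 1" using B[of y] True by auto
      also have "\<dots> \<le> \<bar>B\<bar> * exp (2 * R\<^sup>2 - 2 * (norm y)\<^sup>2)"
        using \<open>(norm y)\<^sup>2 \<le> R\<^sup>2\<close> by (intro mult_left_mono) auto
      finally show ?thesis by (simp add: exp_diff exp_minus field_simps)
    next
      case False
      thus ?thesis using Zsupp[of y] by simp
    qed
    thus ?thesis unfolding gauss_dominated_def by (intro conjI Zm) blast
  qed
  hence Si: "integrable lborel (\<lambda>y. kernel_section k x J y (b # I) * Z_low A b' \<psi> y)" for b b'
    by (rule integrable_weighted_pairing[OF L2_phi_component[OF kernel_section_in_L2]])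
  have "D0 (kernel_section k x J) I A \<psi> = (LINT y|lborel. kernel_section k x J y (1 # I) * Z_low A 0 \<psi> y -
      kernel_section k x J y (0 # I) * Z_low A 1 \<psi> y)"
    unfolding D0_expand by (subst Bochner_Integration.integral_diff[OF Si Si]) simp
  also have "\<dots> = (LINT y|lborel. (LINT p|sphere_measure. F (p, y)) / ?c)"
  proof (rule Bochner_Integration.integral_cong[OF refl])
    fix y
    have "(LINT p|sphere_measure. F (p, y)) = (LINT p|sphere_measure. H 1 y p) * Z_low A 0 \<psi> y -
        (LINT p|sphere_measure. H 0 y p) * Z_low A 1 \<psi> y"
      unfolding F_def fst_conv snd_conv using Hi
      by (subst Bochner_Integration.integral_diff) auto
    thus "kernel_section k x J y (1 # I) * Z_low A 0 \<psi> y - kernel_section k x J y (0 # I) * Z_low A 1 \<psi> y =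
        (LINT p|sphere_measure. F (p, y)) / ?c"
      unfolding sec by (simp add: diff_divide_distrib)
  qed
  also have "\<dots> = (LINT y|lborel. LINT p|sphere_measure. F (p, y)) / ?c" by simp
  also have "(LINT y|lborel. LINT p|sphere_measure. F (p, y)) =
      (LINT p|sphere_measure. LINT y|lborel. F (p, y))"
    by (rule sphere_lborel.Fubini_integral[OF Fi])
  also have "\<dots> = (LINT p|sphere_measure. 0)"
  proof (rule Bochner_Integration.integral_cong[OF refl])
    fix p
    let ?\<theta> = "sphere_param p"
    have "F (p, y) = (monomial ?\<theta> J * cnj (monomial ?\<theta> I)) * (cnj (profile k (pairing ?\<theta> x y)) *
        (cnj (?\<theta> 1) * Z_low A 0 \<psi> y - cnj (?\<theta> 0) * Z_low A 1 \<psi> y))" for y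
      by (simp add: F_def H_def algebra_simps)
    thus "(LINT y|lborel. F (p, y)) = 0"
      by (simp only: integral_mult_right_zero integral_cnj_profile_Z_low[OF \<psi>] mult_zero_right)
  qed
  finally show "D0 (kernel_section k x J) I A \<psi> = 0" by simp
qed

section \<open>The reproducing formula\<close>

text \<open>
  Expand \<open>profile\<close> in powers of \<open>t\<close> on the product of the sphere and \<open>\<real>\<^sup>4\<^sup>n\<close>. The term of order \<open>m\<close> is given by
  \<open>sphere_coefficient_identity\<close>, the sum of the series by \<open>hermite_expansion_sums\<close>, and the resulting Gaussian average
  by \<open>gaussian_mean_value\<close>.
\<close>

lemma reproducing_formula:
  fixes f :: "'n::finite pt \<Rightarrow> tuple"
  assumes f: "f \<in> bergman_space k sq_norm" and k: "k \<ge> 1" and J: "length J = k"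
    and cont: "continuous_on UNIV (\<lambda>y. f y J)"
  shows "inner_phi k sq_norm f (kernel_section k x J) = f x J"
proof -
  let ?Q = "sphere_measure \<Otimes>\<^sub>M (lborel :: 'n pt measure)"
  let ?c = "complex_of_real (gauss_mass TYPE('n))"
  \<comment> \<open>The integrand on the product of the sphere and \<open>\<real>\<^sup>4\<^sup>n\<close> is \<open>profile k t\<close> times \<open>b\<close>.\<close>
  define b where "b q = (\<Sum>I\<in>words k. cnj (monomial (sphere_param (fst q)) J) *
      monomial (sphere_param (fst q)) I * (f (snd q) I * gaussian 2 0 (snd q)))" for q
  define t where "t q = pairing (sphere_param (fst q)) x (snd q)" for q
  define w where "w y = (\<Sum>I\<in>words k. cmod (f y I * (of_real (profile_bound k x y) * gaussian 2 0 y)))" for y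
  have fm [measurable]: "(\<lambda>y. f y I) \<in> borel_measurable borel" for I
    using bergman_weighted_L2[OF f] by (auto simp: weighted_L2_def)
  have w: "integrable lborel w" unfolding w_def
    by (intro Bochner_Integration.integrable_sum integrable_norm integrable_weighted_pairing
        bergman_weighted_L2[OF f] profile_bound_gauss_dominated)
  have [measurable]: "t \<in> borel_measurable ?Q"
    using measurable_swap_sphere[OF measurable_pairing_joint[of x]]
        by (simp add: t_def[abs_def] case_prod_unfold)
  have [measurable]: "b \<in> borel_measurable ?Q" unfolding b_def[abs_def] by measurable
  have bound: "cmod (z * b (p, y)) \<le> C * w y" if p: "p \<in> space sphere_measure" and z: "cmod z \<le>
      C * profile_bound k x y" and C: "C \<ge> 0" for z C p y
  proof -
    have "cmod (b (p, y)) \<le> (\<Sum>I\<in>words k. cmod (f y I * gaussian 2 0 y))"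
      unfolding b_def fst_conv snd_conv
    proof (intro order.trans[OF norm_sum] sum_mono)
      fix I
      have "cmod (sphere_monomial p J) * cmod (sphere_monomial p I) * cmod (f y I * gaussian 2 0 y) \<le>
          1 * 1 * cmod (f y I * gaussian 2 0 y)"
        by (intro mult_mono norm_sphere_monomial p) auto
      thus "cmod (cnj (sphere_monomial p J) * sphere_monomial p I * (f y I * gaussian 2 0 y)) \<le>
          cmod (f y I * gaussian 2 0 y)"
        unfolding norm_mult[of "cnj (sphere_monomial p J) *
            sphere_monomial p I"] norm_mult[of "cnj (sphere_monomial p J)"] complex_mod_cnj by simp
    qed
    hence "cmod (z * b (p, y)) \<le> (C * profile_bound k x y) * (\<Sum>I\<in>words k. cmod (f y I * gaussian 2 0 y))"
      unfolding norm_mult[of z] using z C profile_bound_nonneg[of k x y] by (intro mult_mono) auto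
    also have "\<dots> = C * w y"
      unfolding w_def sum_distrib_left norm_mult norm_of_real abs_of_nonneg[OF profile_bound_nonneg]
      by (intro sum.cong refl) (simp only: mult_ac)
    finally show ?thesis .
  qed
  have tb: "cmod (t (p, y)) \<le> 2 * norm x * norm y" if "p \<in> space sphere_measure" for p y
    unfolding t_def fst_conv snd_conv by (rule norm_pairing[OF sphere_param_norm[OF that]])
  have partial_sum: "cmod (\<Sum>m<M. of_nat (m + k + 1) / fact m * t (p, y) ^ m) \<le> 1 * profile_bound k x y"
      if p: "p \<in> space sphere_measure" for M p y
  proof -
    have "cmod (\<Sum>m<M. of_nat (m + k + 1) / fact m * t (p, y) ^ m) \<le>
        (cmod (t (p, y)) + real (k + 1)) * exp (cmod (t (p, y)))"
      by (rule norm_profile_partial_sum)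
    also have "\<dots> \<le> profile_bound k x y"
      unfolding profile_bound_def using tb[OF p, of y] by (intro mult_mono) auto
    finally show ?thesis by simp
  qed
  have power_bound: "cmod (t (p, y) ^ m) \<le> fact m * profile_bound k x y"
      if p: "p \<in> space sphere_measure" for m p y
  proof -
    let ?r = "2 * norm x * norm y"
    have "cmod (t (p, y) ^ m) \<le> ?r ^ m" unfolding norm_power by (intro power_mono tb[OF p]) auto
    also have "?r ^ m / fact m \<le> exp ?r"
      using sum_le_suminf[OF sums_summable[OF exp_coeff_sums], of "{m}" ?r] sums_unique[OF exp_coeff_sums[of
          ?r]]
      by (simp add: exp_coeff_def)
    hence "?r ^ m \<le> fact m * exp ?r" by (simp add: field_simps)
    also have "\<dots> \<le> fact m * profile_bound k x y"
    proof -
      have "1 * exp ?r \<le> (?r + real (k + 1)) * exp ?r" by (intro mult_right_mono) auto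
      thus ?thesis unfolding profile_bound_def by (intro mult_left_mono) auto
    qed
    finally show ?thesis .
  qed
  have power_int: "integrable ?Q (\<lambda>q. t q ^ m * b q)" for m
  proof (rule integrable_sphere_product)
    show "integrable lborel (\<lambda>y. fact m * w y)" by (intro integrable_mult_right w)
    show "cmod (t (p, y) ^ m * b (p, y)) \<le> fact m * w y" if "p \<in> space sphere_measure" for p y
      by (rule bound[OF that power_bound[OF that]]) simp
  qed measurable
  have power_val: "(LINT q|?Q. t q ^ m * b q) = (-1) ^ m / of_nat (m + k +
      1) * coefficient f J ((real_deriv x ^^ m) (gaussian 2 0))" for m
  proof -
    have "(LINT q|?Q. t q ^ m * b q) = (LINT p|sphere_measure. LINT y|lborel. t (p, y) ^ m * b (p, y))"
      using sphere_lborel.integral_fst'[OF power_int] by simp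
    also have "\<dots> = (LINT p|sphere_measure. cnj (sphere_monomial p J) * (\<Sum>I\<in>words k. sphere_monomial p I *
        coefficient f I (\<lambda>y. pairing (sphere_param p) x y ^ m * gaussian 2 0 y)))"
    proof (rule Bochner_Integration.integral_cong[OF refl])
      fix p
      have "t (p, y) ^ m * b (p, y) = (\<Sum>I\<in>words k. (cnj (sphere_monomial p J) * sphere_monomial p I) *
          (f y I * (pairing (sphere_param p) x y ^ m * gaussian 2 0 y)))" for y
        unfolding t_def b_def fst_conv snd_conv sum_distrib_left by (intro sum.cong refl) (simp only: mult_ac)
      hence "(LINT y|lborel. t (p, y) ^ m * b (p, y)) =
          (\<Sum>I\<in>words k. LINT y|lborel. (cnj (sphere_monomial p J) * sphere_monomial p I) * (f y I *
          (pairing (sphere_param p) x y ^ m * gaussian 2 0 y)))"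
        by (simp only:) (intro Bochner_Integration.integral_sum integrable_mult_right
            integrable_coefficient[OF f gauss_poly_pairing_power order.refl])
      thus "(LINT y|lborel. t (p, y) ^ m * b (p, y)) =
          cnj (sphere_monomial p J) * (\<Sum>I\<in>words k. sphere_monomial p I *
          coefficient f I (\<lambda>y. pairing (sphere_param p) x y ^ m * gaussian 2 0 y))"
        by (simp only: integral_mult_right_zero coefficient_def sum_distrib_left mult.assoc)
    qed
    also have "\<dots> = (-1) ^ m / of_nat (m + k + 1) * coefficient f J ((real_deriv x ^^ m) (gaussian 2 0))"
      by (rule sphere_coefficient_identity[OF f k J])
    finally show ?thesis .
  qed
  have "(\<lambda>M. LINT q|?Q. (\<Sum>m<M. of_nat (m + k + 1) / fact m * t q ^ m) * b q) \<longlonglongrightarrow>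
      (LINT q|?Q. profile k (t q) * b q)"
  proof (rule integral_dominated_convergence[where w="\<lambda>q. w (snd q)"])
    show "AE q in ?Q. (\<lambda>M. (\<Sum>m<M. of_nat (m + k + 1) / fact m * t q ^ m) * b q) \<longlonglongrightarrow> profile k (t q) * b q"
      using profile_sums unfolding sums_def by (intro AE_I2 tendsto_intros) auto
    show "AE q in ?Q. norm ((\<Sum>m<M. of_nat (m + k + 1) / fact m * t q ^ m) * b q) \<le> w (snd q)" for M
    proof (rule AE_I2)
      fix q assume "q \<in> space ?Q"
      hence "fst q \<in> space sphere_measure" by (auto simp: space_pair_measure)
      from bound[OF this partial_sum[OF this, of "snd q" M]]
      show "norm ((\<Sum>m<M. of_nat (m + k + 1) / fact m * t q ^ m) * b q) \<le> w (snd q)" by simp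
    qed
    have "w \<in> borel_measurable borel" using w by auto
    thus "integrable ?Q (\<lambda>q. w (snd q))"
      by (intro sphere_lborel.Fubini_integrable) (use w in auto)
  qed measurable
  moreover have "(LINT q|?Q. (\<Sum>m<M. of_nat (m + k + 1) / fact m * t q ^ m) * b q) =
      (\<Sum>m<M. (-1) ^ m / fact m * coefficient f J ((real_deriv x ^^ m) (gaussian 2 0)))" for M
  proof -
    have "(LINT q|?Q. (\<Sum>m<M. of_nat (m + k + 1) / fact m * t q ^ m) * b q) =
        (\<Sum>m<M. of_nat (m + k + 1) / fact m * (LINT q|?Q. t q ^ m * b q))"
      unfolding sum_distrib_right mult.assoc
      by (subst Bochner_Integration.integral_sum) (auto intro!: integrable_mult_right power_int)
    also have "\<dots> = (\<Sum>m<M. (-1) ^ m / fact m * coefficient f J ((real_deriv x ^^ m) (gaussian 2 0)))"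
    proof -
      have "(of_nat n :: complex) / a * (c / of_nat n * d) = c / a * d" if "n > 0" for n a c d
        using that by simp
      thus ?thesis unfolding power_val by (intro sum.cong refl) (simp del: of_nat_add of_nat_Suc)
    qed
    finally show ?thesis .
  qed
  ultimately have prod: "(LINT q|?Q. profile k (t q) * b q) = coefficient f J (gaussian 2 x)"
    using hermite_expansion_sums[OF f, of J x] LIMSEQ_unique unfolding sums_def by auto
  have full_int: "integrable ?Q (\<lambda>(p, y). profile k (t (p, y)) * b (p, y))"
  proof -
    have "integrable ?Q (\<lambda>q. profile k (t q) * b q)"
    proof (rule integrable_sphere_product[OF _ _ w])
      fix p :: "real \<times> real" and y assume p: "p \<in> space sphere_measure"
      have "cmod (profile k (t (p, y))) \<le> 1 * profile_bound k x y"
        unfolding t_def fst_conv snd_conv using norm_profile_pairing[OF p, of k x y]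
            kernel_bound_le_profile_bound[of k x y] by simp
      from bound[OF p this] show "cmod (profile k (t (p, y)) * b (p, y)) \<le> w y" by simp
    qed measurable
    thus ?thesis by (simp add: case_prod_unfold)
  qed
  have "inner_phi k sq_norm f (kernel_section k x J) =
      (LINT y|lborel. (LINT p|sphere_measure. profile k (t (p, y)) * b (p, y)) / ?c)"
    unfolding inner_phi_def
  proof (rule Bochner_Integration.integral_cong[OF refl])
    fix y
    let ?h = "\<lambda>I p. cnj (profile k (pairing (sphere_param p) x y)) * sphere_monomial p J *
        cnj (sphere_monomial p I)"
    have hi: "integrable sphere_measure (\<lambda>p. cnj (?h I p))" for I
      by (intro integrable_cnj integrable_kernel_integrand)
    have "profile k (t (p, y)) * b (p, y) = (\<Sum>I\<in>words k. (f y I * gaussian 2 0 y) * cnj (?h I p))" for p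
      unfolding t_def b_def fst_conv snd_conv sum_distrib_left by (intro sum.cong refl) (simp add: mult_ac)
    hence "(LINT p|sphere_measure. profile k (t (p, y)) * b (p, y)) =
        (\<Sum>I\<in>words k. (f y I * gaussian 2 0 y) * (LINT p|sphere_measure. cnj (?h I p)))"
      by (simp only: Bochner_Integration.integral_sum integrable_mult_right[OF hi] integral_mult_right_zero)
    also have "\<dots> = (\<Sum>I\<in>words k. (f y I * gaussian 2 0 y) * cnj (kernel_section k x J y I * ?c))"
    proof (intro sum.cong refl)
      fix I assume "I \<in> words k"
      hence "kernel_section k x J y I * ?c = (LINT p|sphere_measure. ?h I p)"
        using gauss_mass_pos[where 'n='n] by (simp add: kernel_section_def)
      thus "(f y I * gaussian 2 0 y) * (LINT p|sphere_measure. cnj (?h I p)) =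
          (f y I * gaussian 2 0 y) * cnj (kernel_section k x J y I * ?c)"
        by (simp only: integral_bounded_linear[OF bounded_linear_cnj integrable_kernel_integrand])
    qed
    also have "\<dots> = (inner_V0 k (f y) (kernel_section k x J y) * exp (- 2 * (norm y)\<^sup>2)) * ?c"
      unfolding inner_V0_def sum_distrib_right by (intro sum.cong refl) (simp add: mult_ac)
    finally show "inner_V0 k (f y) (kernel_section k x J y) * exp (- 2 * (norm y)\<^sup>2) =
        (LINT p|sphere_measure. profile k (t (p, y)) * b (p, y)) / ?c"
      using gauss_mass_pos[where 'n='n] by (simp add: field_simps)
  qed
  also have "\<dots> = (LINT y|lborel. LINT p|sphere_measure. profile k (t (p, y)) * b (p, y)) / ?c" by simp
  also have "(LINT y|lborel. LINT p|sphere_measure. profile k (t (p, y)) * b (p, y)) =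
      (LINT q|?Q. profile k (t q) * b q)"
    using sphere_lborel.integral_snd[OF full_int] by (simp add: case_prod_unfold)
  also have "\<dots> = ?c * f x J"
    unfolding prod by (rule gaussian_mean_value[OF f k J cont])
  finally show ?thesis using gauss_mass_pos[where 'n='n] by simp
qed

section \<open>Identification of the Bergman kernel and its decay\<close>

definition coord_word :: "nat \<Rightarrow> nat \<Rightarrow> 2 list" where
  "coord_word k j = replicate j 1 @ replicate (k - j) 0"

lemma coord_word: "coord k v j = v (coord_word k j)"
  by (simp add: coord_def coord_word_def)

lemma length_coord_word: "j \<le> k \<Longrightarrow> length (coord_word k j) = k"
  by (simp add: coord_word_def)

lemma count_list_replicate: "count_list (replicate n a) b = (if a = b then n else 0)"
  by (induction n) auto

lemma count_coord_word: "count_list (coord_word k j) 1 = j"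
  by (simp add: coord_word_def count_list_replicate)

lemma V0_coord:
  assumes "v \<in> V0 k" "length I = k"
  shows "v I = coord k v (count_list I 1)"
proof -
  have c: "count_list I 1 \<le> k" using assms(2) count_le_length[of I 1] by simp
  have "mset I = mset (coord_word k (count_list I 1))"
    by (subst mset_eq_iff_count) (simp_all add: assms(2) length_coord_word[OF c] count_coord_word)
  thus ?thesis using assms by (simp add: V0_def coord_word)
qed

text \<open>
  The inner product sums over all words, the identification with \<open>\<complex>\<^sup>k\<^sup>+\<^sup>1\<close> picks one word for each number of ones; this
  accounts for the binomial coefficients.
\<close>

lemma inner_V0_coord:
  assumes "v \<in> V0 k" "w \<in> V0 k"
  shows "inner_V0 k v w = (\<Sum>j\<le>k. of_nat (k choose j) * (coord k v j * cnj (coord k w j)))"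
proof -
  let ?g = "\<lambda>j. coord k v j * cnj (coord k w j)"
  have "inner_V0 k v w = (\<Sum>I\<in>words k. ?g (count_list I 1))"
    unfolding inner_V0_def by (intro sum.cong refl) (simp add: V0_coord[OF assms(1)] V0_coord[OF assms(2)])
  also have "\<dots> = (\<Sum>j\<le>k. \<Sum>I\<in>{I\<in>words k. count_list I 1 = j}. ?g (count_list I 1))"
  proof (rule sum.group[symmetric])
    show "(\<lambda>I. count_list I 1) ` words k \<subseteq> {..k}"
    proof (rule image_subsetI)
      fix I :: "2 list" assume "I \<in> words k"
      thus "count_list I 1 \<in> {..k}" using count_le_length[of I 1] by simp
    qed
  qed auto
  also have "\<dots> = (\<Sum>j\<le>k. of_nat (k choose j) * ?g j)"
  proof (intro sum.cong refl)
    fix j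
    have "(\<Sum>I\<in>{I\<in>words k. count_list I 1 = j}. ?g (count_list I 1)) = (\<Sum>I\<in>{I\<in>words k. count_list I 1 =
        j}. ?g j)"
      by (rule sum.cong) auto
    thus "(\<Sum>I\<in>{I\<in>words k. count_list I 1 = j}. ?g (count_list I 1)) = of_nat (k choose j) * ?g j"
      by (simp only: sum_constant card_words_count)
  qed
  finally show ?thesis .
qed

lemma integrable_inner_kernel_section:
  fixes x :: "'n::finite pt"
  assumes f: "f \<in> L2_phi k sq_norm"
  shows "integrable lborel (\<lambda>y. inner_V0 k (f y) (kernel_section k x J y) * exp (- 2 * (norm y)\<^sup>2))"
proof -
  have g: "gauss_dominated (\<lambda>y. cnj (kernel_section k x J y I) * gaussian 2 0 y)" for I
    by (rule gauss_dominated_mono[OF kernel_section_gauss_dominated[of k x J I]]) (simp_all add: norm_mult)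
  have "integrable lborel (\<lambda>y. \<Sum>I\<in>words k. f y I * (cnj (kernel_section k x J y I) * gaussian 2 0 y))"
    by (intro Bochner_Integration.integrable_sum integrable_weighted_pairing L2_phi_component[OF f] g)
  thus ?thesis by (simp add: inner_V0_def sum_distrib_right mult.assoc)
qed

text \<open>
  The section lies in the Bergman space, hence it is orthogonal to \<open>f - P f\<close>, and it reproduces \<open>P f\<close>.
\<close>

lemma projection_formula:
  fixes x :: "'n::finite pt"
  assumes k: "k \<ge> 1" and J: "length J = k"
    and f: "f \<in> L2_phi k sq_norm" and g: "bergman_projection k sq_norm f g"
    and cont: "continuous_on UNIV (\<lambda>y. g y J)"
  shows "g x J = inner_phi k sq_norm f (kernel_section k x J)"
proof -
  let ?h = "kernel_section k x J"
  have gb: "g \<in> bergman_space k sq_norm" using g by (simp add: bergman_projection_def)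
  hence g2: "g \<in> L2_phi k sq_norm" by (simp add: bergman_space_def)
  have "0 = inner_phi k sq_norm (\<lambda>y I. f y I - g y I) ?h"
    using g kernel_section_in_bergman[OF k, of x J] by (simp add: bergman_projection_def)
  also have "\<dots> = inner_phi k sq_norm f ?h - inner_phi k sq_norm g ?h"
    unfolding inner_phi_def
    by (subst Bochner_Integration.integral_diff[OF integrable_inner_kernel_section[OF f]
        integrable_inner_kernel_section[OF g2], symmetric])
      (simp add: inner_V0_def left_diff_distrib sum_subtractf)
  finally show ?thesis using reproducing_formula[OF gb k J cont, of x] by simp
qed

lemma AE_open_empty:
  fixes S :: "'a::euclidean_space set"
  assumes "open S" "AE y in lborel. y \<notin> S"
  shows "S = {}"
proof -
  have "S \<in> sets lborel" using assms(1) by simp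
  hence "S \<in> null_sets lborel" using assms(2) by (subst AE_iff_null_sets) auto
  hence "negligible S" by (simp add: negligible_iff_null_sets null_sets_completionI)
  thus ?thesis using open_not_negligible[OF assms(1)] by blast
qed

lemma bergman_kernel_continuous:
  assumes "is_bergman_kernel k \<phi> K" "i \<le> k" "j \<le> k"
  shows "continuous_on UNIV (\<lambda>y. K x y i j)"
proof -
  have "continuous_on UNIV (\<lambda>(x, y). K x y i j)" using assms by (simp add: is_bergman_kernel_def)
  moreover have "continuous_on UNIV (\<lambda>y. (x, y))" by (intro continuous_intros)
  ultimately show ?thesis using continuous_on_compose2[of UNIV "\<lambda>(x, y). K x y i j" UNIV "\<lambda>y. (x, y)"] by simp
qed

text \<open>
  Two kernels of the same operator. Testing with the conjugate of their difference \<open>D\<close>, cut off to a ball so that it lies in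
  the weighted space, gives \<open>\<integral> |D|\<^sup>2 exp (- 2 |y|\<^sup>2) = 0\<close> over that ball.
\<close>

lemma bergman_kernel_AE_eq:
  fixes K :: "'n::finite pt \<Rightarrow> 'n pt \<Rightarrow> nat \<Rightarrow> nat \<Rightarrow> complex"
  assumes K: "is_bergman_kernel k sq_norm K" and k: "k \<ge> 1" and i: "i \<le> k"
  shows "AE y in lborel. \<forall>j\<le>k. K x y i j = of_nat (k choose j) *
      cnj (coord k (kernel_section k x (coord_word k i) y) j)"
proof -
  let ?h = "kernel_section k x (coord_word k i)"
  define D where "D j y = K x y i j - of_nat (k choose j) * cnj (coord k (?h y) j)" for j y
  have Kc: "continuous_on UNIV (\<lambda>y. K x y i j)" if "j \<le> k" for j
    by (rule bergman_kernel_continuous[OF K i that])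
  have Dm [measurable]: "D j \<in> borel_measurable borel" if "j \<le> k" for j
    unfolding D_def[abs_def] coord_word
    by (intro borel_measurable_diff borel_measurable_continuous_onI[OF Kc[OF that]] borel_measurable_times
        measurable_compose[OF measurable_kernel_section measurable_cnj] borel_measurable_const)
  have ball: "AE y in lborel. norm y \<le> R \<longrightarrow> (\<forall>j\<le>k. D j y = 0)" for R
  proof -
    \<comment> \<open>The entry at the word \<open>I\<close> depends only on the number of ones, which makes the tuple symmetric.\<close>
    define f :: "'n pt \<Rightarrow> tuple" where "f y I = (if length I = k \<and> norm y \<le>
        R then cnj (D (count_list I 1) y) else 0)" for y I
    have bound: "\<exists>B. \<forall>y. norm y \<le> R \<longrightarrow> cmod (D j y) \<le> B" if j: "j \<le> k" for j
    proof -
      have "compact ((\<lambda>y. K x y i j) ` cball 0 R)"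
        by (intro compact_continuous_image continuous_on_subset[OF Kc[OF j]]) auto
      then obtain B where B: "\<And>y. y \<in> cball 0 R \<Longrightarrow> cmod (K x y i j) \<le> B"
        using compact_imp_bounded bounded_iff by (metis imageI)
      have "compact ((\<lambda>y. kernel_bound k x y / gauss_mass TYPE('n)) ` cball 0 R)"
        unfolding kernel_bound_def by (intro compact_continuous_image continuous_intros) (use
            gauss_mass_pos[where 'n='n] in auto)
      then obtain B' where B': "\<And>y. y \<in> cball 0 R \<Longrightarrow> norm (kernel_bound k x y / gauss_mass TYPE('n)) \<le> B'"
        using compact_imp_bounded bounded_iff by (metis imageI)
      have "cmod (D j y) \<le> B + real (k choose j) * B'" if "norm y \<le> R" for y
      proof -
        have "cmod (coord k (?h y) j) \<le> B'"
          unfolding coord_word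
          by (intro order.trans[OF norm_kernel_section order.trans[OF abs_ge_self]]) (use B'[of y] that in simp)
        hence "cmod (of_nat (k choose j) * cnj (coord k (?h y) j)) \<le> real (k choose j) * B'"
          by (simp add: norm_mult mult_left_mono)
        thus ?thesis unfolding D_def using B[of y] that norm_triangle_ineq4[of "K x y i j"]
            by (smt (verit) mem_cball_0)
      qed
      thus ?thesis by blast
    qed
    have fV0: "f y \<in> V0 k" for y
      unfolding V0_def f_def
      by (auto dest: mset_eq_length simp flip: count_mset)
    have cf: "coord k (f y) j = (if norm y \<le> R then cnj (D j y) else 0)" if "j \<le> k" for y j
      using that by (simp add: coord_word f_def length_coord_word count_coord_word)
    have fm: "(\<lambda>y. f y I) \<in> borel_measurable lborel" for I
    proof (cases "length I = k")
      case True
      hence "count_list I 1 \<le> k" using count_le_length[of I 1] by simp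
      note [measurable] = Dm[OF this]
      have "(\<lambda>y. if norm y \<le> R then cnj (D (count_list I 1) y) else 0) \<in> borel_measurable borel" by measurable
      thus ?thesis using True by (simp add: f_def)
    qed (simp add: f_def)
    have f2: "f \<in> L2_phi k sq_norm"
      unfolding L2_phi_def
    proof (intro CollectI conjI allI fV0 fm)
      have "integrable lborel (\<lambda>y. f y I * cnj (f y I) * exp (- 2 * (norm y)\<^sup>2))" if I: "I \<in> words k" for I
      proof -
        have "count_list I 1 \<le> k" using I count_le_length[of I 1] by simp
        from bound[OF this] obtain B where B: "\<And>y. norm y \<le> R \<Longrightarrow> cmod (D (count_list I 1) y) \<le> B" by blast
        show ?thesis
        proof (rule Bochner_Integration.integrable_bound[OF integrable_ball_bound[of "B\<^sup>2" R]])
          show "(\<lambda>y. f y I * cnj (f y I) * exp (- 2 * (norm y)\<^sup>2)) \<in> borel_measurable lborel"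
            using fm[of I] by measurable
          show "AE y in lborel. norm (f y I * cnj (f y I) * exp (- 2 * (norm y)\<^sup>2)) \<le>
              norm (B\<^sup>2 * indicator (cball 0 R) y)"
          proof (rule AE_I2)
            fix y
            show "norm (f y I * cnj (f y I) * exp (- 2 * (norm y)\<^sup>2)) \<le> norm (B\<^sup>2 * indicator (cball 0 R) y)"
            proof (cases "norm y \<le> R")
              case True
              have "cmod (D (count_list I 1) y) * cmod (D (count_list I 1) y) * exp (- 2 * (norm y)\<^sup>2) \<le>
                  B * B * 1"
                by (intro mult_mono B[OF True] order.trans[OF norm_ge_zero B[OF True]] mult_nonneg_nonneg) auto
              thus ?thesis using True I by (simp add: f_def norm_mult power2_eq_square)
            qed (simp add: f_def)
          qed
        qed
      qed
      thus "integrable lborel (\<lambda>y. inner_V0 k (f y) (f y) * exp (- 2 * (norm y)\<^sup>2))"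
        unfolding inner_V0_def sum_distrib_right by (intro Bochner_Integration.integrable_sum) auto
    qed
    obtain g where g: "bergman_projection k sq_norm f g" "\<And>I. continuous_on UNIV (\<lambda>x. g x I)"
      and Kint: "integrable lborel (\<lambda>y. (\<Sum>j\<le>k. K x y i j * coord k (f y) j) * exp (- 2 * (norm y)\<^sup>2))"
      and Kval: "coord k (g x) i = (LINT y|lborel. (\<Sum>j\<le>k. K x y i j * coord k (f y) j) * exp (- 2 *
          (norm y)\<^sup>2))"
      using K f2 i unfolding is_bergman_kernel_def by blast
    have proj: "coord k (g x) i = inner_phi k sq_norm f ?h"
      unfolding coord_word by (rule projection_formula[OF k length_coord_word[OF i] f2 g(1) g(2)])
    have h_int: "integrable lborel (\<lambda>y. inner_V0 k (f y) (?h y) * exp (- 2 * (norm y)\<^sup>2))"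
      by (rule integrable_inner_kernel_section[OF f2])
    define q where "q y = (\<Sum>j\<le>k. (if norm y \<le> R then (cmod (D j y))\<^sup>2 else 0)) * exp (- 2 * (norm y)\<^sup>2)" for y
    have q_eq: "(\<Sum>j\<le>k. K x y i j * coord k (f y) j) * exp (- 2 * (norm y)\<^sup>2) -
        inner_V0 k (f y) (?h y) * exp (- 2 * (norm y)\<^sup>2) = of_real (q y)" for y
    proof -
      have "(\<Sum>j\<le>k. K x y i j * coord k (f y) j) - inner_V0 k (f y) (?h y) = (\<Sum>j\<le>k. D j y * coord k (f y) j)"
        unfolding inner_V0_coord[OF fV0 kernel_section_in_V0] sum_subtractf[symmetric]
        by (intro sum.cong refl) (simp add: D_def algebra_simps)
      also have "\<dots> = of_real (\<Sum>j\<le>k. (if norm y \<le> R then (cmod (D j y))\<^sup>2 else 0))"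
        unfolding of_real_sum by (intro sum.cong refl) (simp add: cf complex_norm_square del: of_real_power)
      finally show ?thesis by (simp add: q_def left_diff_distrib[symmetric])
    qed
    have q_int: "integrable lborel q"
      using Bochner_Integration.integrable_diff[OF Kint h_int] unfolding q_eq complex_of_real_integrable_eq .
    have "(LINT y|lborel. complex_of_real (q y)) = 0"
      unfolding q_eq[symmetric] Bochner_Integration.integral_diff[OF Kint h_int]
      using Kval proj by (simp add: inner_phi_def)
    hence "(LINT y|lborel. q y) = 0" by simp
    moreover have q_nonneg: "q y \<ge> 0" for y unfolding q_def by (auto intro!: mult_nonneg_nonneg sum_nonneg)
    ultimately have "AE y in lborel. q y = 0"
      using integral_nonneg_eq_0_iff_AE[OF q_int] by simp
    thus ?thesis
    proof eventually_elim
      case (elim y)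
      show ?case
      proof (intro impI allI)
        fix j assume "norm y \<le> R" "j \<le> k"
        hence "(\<Sum>j\<le>k. (cmod (D j y))\<^sup>2) = 0" using elim by (simp add: q_def)
        thus "D j y = 0" using \<open>j \<le> k\<close> by (subst (asm) sum_nonneg_eq_0_iff) auto
      qed
    qed
  qed
  have "AE y in lborel. \<forall>R::nat. norm y \<le> real R \<longrightarrow> (\<forall>j\<le>k. D j y = 0)"
    unfolding AE_all_countable using ball by blast
  thus ?thesis
  proof eventually_elim
    case (elim y)
    obtain R :: nat where "norm y \<le> real R" using real_arch_simple by blast
    thus ?case using elim by (auto simp: D_def)
  qed
qed

text \<open>
  The equality almost everywhere suffices: by continuity of \<open>K\<close> the set where the bound fails is open, and it is a null set.
\<close>

lemma bergman_kernel_entry_bound: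
  fixes K :: "'n::finite pt \<Rightarrow> 'n pt \<Rightarrow> nat \<Rightarrow> nat \<Rightarrow> complex"
  assumes K: "is_bergman_kernel k sq_norm K" and k: "k \<ge> 1" and i: "i \<le> k" and j: "j \<le> k"
  shows "cmod (K x y i j) \<le> 2 ^ k / gauss_mass TYPE('n) * kernel_bound k x y"
proof -
  let ?b = "\<lambda>y. 2 ^ k / gauss_mass TYPE('n) * kernel_bound k x y"
  have Kc: "continuous_on UNIV (\<lambda>y. K x y i j)"
    by (rule bergman_kernel_continuous[OF K i j])
  have "open {y. ?b y < cmod (K x y i j)}"
    unfolding kernel_bound_def by (intro open_Collect_less continuous_intros Kc)
  moreover have "AE y in lborel. y \<notin> {y. ?b y < cmod (K x y i j)}"
    using bergman_kernel_AE_eq[OF K k i, of x]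
  proof eventually_elim
    case (elim y)
    have "cmod (K x y i j) = real (k choose j) * cmod (kernel_section k x (coord_word k i) y (coord_word k j))"
      using elim j by (simp add: norm_mult coord_word)
    also have "\<dots> \<le> 2 ^ k * (kernel_bound k x y / gauss_mass TYPE('n))"
      by (intro mult_mono norm_kernel_section) (use binomial_le_pow2[of k j] in \<open>simp_all flip: of_nat_le_iff\<close>)
    finally show ?case by simp
  qed
  ultimately have "{y. ?b y < cmod (K x y i j)} = {}" by (rule AE_open_empty)
  thus ?thesis by (auto simp: not_less)
qed

text \<open>
  The polynomial factor costs \<open>exp u\<close> with \<open>u = (|x| + |y|) / 2\<close>, as \<open>|x||y| \<le> u\<^sup>2\<close>; the
  Gaussian \<open>exp (- d\<^sup>2)\<close> with \<open>d = |x - y|\<close> is weakened to \<open>exp (1 - d)\<close>.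
\<close>

lemma kernel_bound_decay:
  "kernel_bound k x y \<le> 4 * real (k + 1) * exp 1 *
     exp ((norm x)\<^sup>2 + (norm y)\<^sup>2 + 1 / 2 * (norm x + norm y) - 1 * norm (x - y))"
proof -
  define r u d where "r = norm x * norm y" and "u = (norm x + norm y) / 2" and "d = norm (x - y)"
  have r0: "r \<ge> 0" by (simp add: r_def)
  have "0 \<le> (norm x - norm y)\<^sup>2" by simp
  hence "r \<le> u\<^sup>2" by (simp add: r_def u_def power2_eq_square field_simps)
  moreover have "1 + u + u\<^sup>2 / 2 \<le> exp u" "u \<ge> 0" by (auto simp: u_def intro!: exp_lower_Taylor_quadratic)
  ultimately have ru: "1 + 2 * r \<le> 4 * exp u" by linarith
  have "2 * norm x * norm y + real (k + 1) \<le> real (k + 1) * (1 + 2 * r)"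
    using r0 by (simp add: r_def algebra_simps)
  also have "\<dots> \<le> real (k + 1) * (4 * exp u)" by (intro mult_left_mono ru) simp
  finally have 1: "2 * norm x * norm y + real (k + 1) \<le> real (k + 1) * (4 * exp u)" .
  have "0 \<le> (d - 1 / 2)\<^sup>2" by simp
  hence "- d\<^sup>2 \<le> 1 - d" by (simp add: power2_eq_square algebra_simps)
  moreover have "2 * (x \<bullet> y) = (norm x)\<^sup>2 + (norm y)\<^sup>2 - d\<^sup>2"
    by (simp add: d_def power2_norm_eq_inner inner_diff_left inner_diff_right inner_commute)
  ultimately have 2: "exp (2 * (x \<bullet> y)) \<le> exp (1 + ((norm x)\<^sup>2 + (norm y)\<^sup>2 - d))" by simp
  have "kernel_bound k x y \<le> real (k + 1) * (4 * exp u) * exp (1 + ((norm x)\<^sup>2 + (norm y)\<^sup>2 - d))"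
    unfolding kernel_bound_def by (intro mult_mono 1 2) auto
  also have "\<dots> = 4 * real (k + 1) * exp 1 * exp ((norm x)\<^sup>2 + (norm y)\<^sup>2 + u - d)"
    by (simp add: exp_add exp_diff)
  finally show ?thesis by (simp add: u_def d_def)
qed

theorem theorem1p3:
  fixes k :: nat
  assumes "k \<ge> 2"
  shows "\<exists>\<epsilon>>0. \<exists>C>0. \<forall>K :: 'n::finite pt \<Rightarrow> 'n pt \<Rightarrow> nat \<Rightarrow> nat \<Rightarrow> complex.
    is_bergman_kernel k (\<lambda>x. (norm x)\<^sup>2) K \<longrightarrow>
    (\<forall>x y. norm (x - y) > 3 \<longrightarrow>
      matrix_norm k (K x y) \<le>
        C * exp ((norm x)\<^sup>2 + (norm y)\<^sup>2 + \<epsilon> / 2 * (norm x + norm y) - \<epsilon> * norm (x - y)))"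
proof -
  define c where "c = 2 ^ k / gauss_mass TYPE('n)"
  define C where "C = real (k + 1) * (c * (4 * real (k + 1) * exp 1))"
  have c: "c > 0" using gauss_mass_pos[where 'n='n] by (simp add: c_def)
  have "C > 0" using c unfolding C_def by (intro mult_pos_pos) auto
  moreover have "matrix_norm k (K x y) \<le> C * exp ((norm x)\<^sup>2 + (norm y)\<^sup>2 + 1 / 2 * (norm x + norm y) -
      1 * norm (x - y))"
    if K: "is_bergman_kernel k (\<lambda>x. (norm x)\<^sup>2) K" for K :: "'n pt \<Rightarrow> 'n pt \<Rightarrow> nat \<Rightarrow> nat \<Rightarrow> complex" and x y
  proof -
    define M where "M = c * kernel_bound k x y"
    have M0: "M \<ge> 0" unfolding M_def using c by (intro mult_nonneg_nonneg kernel_bound_nonneg) simp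
    have entry: "cmod (K x y i j) \<le> M" if "i \<le> k" "j \<le> k" for i j
      using bergman_kernel_entry_bound[OF K _ that, of x y] assms by (simp add: M_def c_def)
    have "(\<Sum>i\<le>k. \<Sum>j\<le>k. (cmod (K x y i j))\<^sup>2) \<le> (\<Sum>i\<le>k. \<Sum>j\<le>k. M\<^sup>2)"
      by (intro sum_mono power_mono entry) auto
    also have "\<dots> = (real (k + 1) * M)\<^sup>2" by (simp add: power2_eq_square algebra_simps)
    finally have "matrix_norm k (K x y) \<le> real (k + 1) * M"
      unfolding matrix_norm_def using M0 by (intro real_le_lsqrt) (auto intro!: sum_nonneg)
    also have "\<dots> \<le> real (k + 1) * (c * (4 * real (k + 1) * exp 1 * exp ((norm x)\<^sup>2 + (norm y)\<^sup>2 +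
        1 / 2 * (norm x + norm y) - 1 * norm (x - y))))"
      unfolding M_def using c by (intro mult_left_mono kernel_bound_decay) auto
    finally show ?thesis by (simp only: C_def mult.assoc)
  qed
  ultimately show ?thesis by (intro exI[of _ 1] conjI exI[of _ C] allI impI) auto
qed

end
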